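(* Let $\Psi_1,\ldots,\Psi_m$ be bounded sets of positive kernel operators on a Banach function space $L$ and let $\alpha_1,\ldots,\alpha_m$ be positive numbers such that $\sum_{i=1}^m\alpha_i=1$. If $L$ and its Banach dual $L^*$ have order continuous norms, then $$r\left(\Psi_1^{(\alpha_1)}\circ\cdots\circ\Psi_m^{(\alpha_m)}\right)\le r(\Psi_1)^{\alpha_1}\cdots r(\Psi_m)^{\alpha_m}$$ and $$r\left(\Psi_1^{\left(\frac1m\right)}\circ\cdots\circ\Psi_m^{\left(\frac1m\right)}\right)\le r(\Psi_1\Psi_2\cdots\Psi_m)^{\frac1m}$$ hold for each $r\in\{\rho_{ess},\hat\rho_{ess}\}$.
   Context: Let $\mu$ be a $\sigma$-finite positive measure on a $\sigma$-algebra of subsets of a non-void set $X$, and let $M(X,\mu)$ be the vector space of equivalence classes (modulo a.e. equality) of complex measurable functions on $X$. A Banach space $L\subseteq M(X,\mu)$ is a Banach function space if $f\in L$, $g\in M(X,\mu)$ and $|g|\le |f|$ imply $g\in L$ and $\|g\|\le\|f\|$. It is assumed throughout that $X$ is the carrier of $L$: there is no subset $Y\subseteq X$ of strictly positive measure such that $f=0$ a.e. on $Y$ for all $f\in L$. A norm is order continuous if $0\le f_n\downarrow 0$ implies $\|f_n\|\to 0$. A (linear) operator $A$ on $L$ is positive if it maps nonnegative functions to nonnegative ones (positive operators are automatically bounded). $A$ is a kernel operator if there is a $\mu\times\mu$-measurable function $a(x,y)$ on $X\times X$ such that for all $f\in L$ and almost all $x\in X$, $\int_X|a(x,y)f(y)|\,d\mu(y)<\infty$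 and $(Af)(x)=\int_X a(x,y)f(y)\,d\mu(y)$; such an $A$ is positive iff $a\ge 0$ a.e. If $A_1,\dots,A_m$ are positive kernel operators on $L$ with kernels $a_1,\dots,a_m$ and $\alpha_1,\dots,\alpha_m>0$ with $\sum_j\alpha_j=1$, then the Hadamard weighted geometric mean $A_1^{(\alpha_1)}\circ\cdots\circ A_m^{(\alpha_m)}$ is the positive kernel operator on $L$ with kernel $a_1(x,y)^{\alpha_1}\cdots a_m(x,y)^{\alpha_m}$ (it is defined on all of $L$). For bounded sets $\Psi_1,\dots,\Psi_m$ of positive kernel operators on $L$, $$\Psi_1^{(\alpha_1)}\circ\cdots\circ\Psi_m^{(\alpha_m)}=\{A_1^{(\alpha_1)}\circ\cdots\circ A_m^{(\alpha_m)}: A_1\in\Psi_1,\dots,A_m\in\Psi_m\},$$ and $\Psi_1\cdots\Psi_m=\{A_1\cdots A_m: A_i\in\Psi_i\}$, $\Sigma^m=\{A_1\cdots A_m: A_i\in\Sigma\}$. The Hausdorff measure of noncompactness of a bounded operator $A$ on $L$ is $\beta(A)=\inf\{\delta>0: \text{there is a finite } M\subset L \text{ with } A(D_L)\subset M+\delta D_L\}$, where $D_L$ is the closed unit ball of $L$. For a single operator $A$, $\rho_{ess}(A)$ is the essential spectral radius (the spectral radius of the image of $A$ in the Calkin algebra), and $\rho_{ess}(A)=\lim_{j\to\infty}\beta(A^j)^{1/j}$. For a bounded set $\Sigma$ of bounded operators: $\rho_{ess}(\Sigma)=\limsup_{m\to\infty}[\sup_{A\in\Sigma^m}\rho_{ess}(A)]^{1/m}$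 (generalized essential spectral radius), $\hat\rho_{ess}(\Sigma)=\lim_{m\to\infty}[\sup_{A\in\Sigma^m}\beta(A)]^{1/m}$ (joint essential spectral radius). *)

theory Defs
  imports "HOL-Analysis.Analysis"
begin

text \<open>
  A Banach function space over \<open>M\<close> is given by a Banach space \<open>'l\<close> together with a map \<open>rep\<close>
  that picks a representative \<open>rep f\<close> of the a.e.-class \<open>f\<close>; \<open>rep\<close> induces an injective linear map
  from \<open>'l\<close> into the space of a.e.-classes of complex measurable functions.
  Only real scalars occur in the assumptions, since the library has no class of complex normed
  spaces. Solidity supplies the complex structure: the image of \<open>rep\<close> is closed under complex
  scalars up to a.e. equality and the norm is complex homogeneous
  (lemmas \<open>ae_rep_cscale\<close> and \<open>norm_cscale\<close> below).
\<close>

locale banach_function_space = sigma_finite_measure M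
  for M :: "'a measure" +
  fixes rep :: "'l::banach \<Rightarrow> 'a \<Rightarrow> complex"
  assumes nonvoid: "space M \<noteq> {}"
    and rep_measurable: "\<And>f. rep f \<in> borel_measurable M"
    and rep_add: "\<And>f g. AE x in M. rep (f + g) x = rep f x + rep g x"
    and rep_scaleR: "\<And>c f. AE x in M. rep (c *\<^sub>R f) x = of_real c * rep f x"
    and rep_inject: "\<And>f g. (AE x in M. rep f x = rep g x) \<Longrightarrow> f = g"
    and solid: "\<And>f g. g \<in> borel_measurable M \<Longrightarrow> (AE x in M. cmod (g x) \<le> cmod (rep f x)) \<Longrightarrow>
                  \<exists>h. (AE x in M. rep h x = g x) \<and> norm h \<le> norm f"
    and carrier: "\<And>Y. Y \<in> sets M \<Longrightarrow> (\<forall>f. AE x in M. x \<in> Y \<longrightarrow> rep f x = 0) \<Longrightarrow> emeasure M Y = 0"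

definition cscale :: "'a measure \<Rightarrow> ('l \<Rightarrow> 'a \<Rightarrow> complex) \<Rightarrow> complex \<Rightarrow> 'l \<Rightarrow> 'l" where
  "cscale M rep c f = (THE g. AE x in M. rep g x = c * rep f x)"

lemma (in banach_function_space) ae_rep_cscale:
  "AE x in M. rep (cscale M rep c f) x = c * rep f x"
proof -
  have 1: "(\<lambda>x. c * rep f x) \<in> borel_measurable M"
    using rep_measurable[of f] by measurable
  have 2: "AE x in M. cmod (c * rep f x) \<le> cmod (rep (cmod c *\<^sub>R f) x)"
    using rep_scaleR[of "cmod c" f] by eventually_elim (simp add: norm_mult)
  obtain h where h: "AE x in M. rep h x = c * rep f x"
    using solid[OF 1 2] by blast
  have uniq: "g = h" if g: "AE x in M. rep g x = c * rep f x" for g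
  proof (rule rep_inject)
    show "AE x in M. rep g x = rep h x" using g h by eventually_elim simp
  qed
  show ?thesis
    unfolding cscale_def by (rule theI[where P = "\<lambda>g. AE x in M. rep g x = c * rep f x", OF h uniq])
qed

lemma (in banach_function_space) norm_le:
  assumes "AE x in M. cmod (rep g x) \<le> cmod (rep f x)"
  shows "norm g \<le> norm f"
proof -
  obtain h where h: "AE x in M. rep h x = rep g x" "norm h \<le> norm f"
    using solid[OF rep_measurable assms] by blast
  then show ?thesis using rep_inject[OF h(1)] by simp
qed

lemma (in banach_function_space) norm_cscale:
  "norm (cscale M rep c f) = cmod c * norm f"
proof -
  have "AE x in M. cmod (rep (cscale M rep c f) x) = cmod (rep (cmod c *\<^sub>R f) x)"
    using ae_rep_cscale[of c f] rep_scaleR[of "cmod c" f]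
    by eventually_elim (simp add: norm_mult)
  then have "norm (cscale M rep c f) = norm (cmod c *\<^sub>R f)"
  proof (intro antisym norm_le)
    assume ae: "AE x in M. cmod (rep (cscale M rep c f) x) = cmod (rep (cmod c *\<^sub>R f) x)"
    show "AE x in M. cmod (rep (cscale M rep c f) x) \<le> cmod (rep (cmod c *\<^sub>R f) x)"
      using ae by eventually_elim simp
    show "AE x in M. cmod (rep (cmod c *\<^sub>R f) x) \<le> cmod (rep (cscale M rep c f) x)"
      using ae by eventually_elim simp
  qed
  then show ?thesis by simp
qed

definition fun_nonneg :: "'a measure \<Rightarrow> ('l \<Rightarrow> 'a \<Rightarrow> complex) \<Rightarrow> 'l set" where
  "fun_nonneg M rep = {f. AE x in M. rep f x \<in> \<real>\<^sub>\<ge>\<^sub>0}"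

text \<open>
  \<open>'l \<Rightarrow>\<^sub>L complex\<close> consists of the bounded real-linear functionals; the Banach dual is its
  subspace of complex-linear ones, with the inherited norm. A difference of functionals that lies
  in \<open>dual_nonneg\<close> is complex-linear, so \<open>order_continuous_norm (dual_nonneg M rep)\<close> only involves
  elements of the Banach dual.
\<close>

definition dual_nonneg :: "'a measure \<Rightarrow> ('l::banach \<Rightarrow> 'a \<Rightarrow> complex) \<Rightarrow> ('l \<Rightarrow>\<^sub>L complex) set" where
  "dual_nonneg M rep = {\<phi>. (\<forall>c f. blinfun_apply \<phi> (cscale M rep c f) = c * blinfun_apply \<phi> f) \<and>
                            (\<forall>f \<in> fun_nonneg M rep. blinfun_apply \<phi> f \<in> \<real>\<^sub>\<ge>\<^sub>0)}"

text \<open>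
  Order continuity of the norm with respect to the order \<open>g \<le> f \<longleftrightarrow> f - g \<in> P\<close>:
  a decreasing sequence in \<open>P\<close> with infimum \<open>0\<close> converges to \<open>0\<close> in norm.
\<close>

definition order_continuous_norm :: "'b::real_normed_vector set \<Rightarrow> bool" where
  "order_continuous_norm P \<longleftrightarrow>
     (\<forall>f :: nat \<Rightarrow> 'b.
        (\<forall>n. f n \<in> P) \<and> (\<forall>n. f n - f (Suc n) \<in> P) \<and>
        (\<forall>g. (\<forall>n. f n - g \<in> P) \<longrightarrow> 0 - g \<in> P) \<longrightarrow>
        (\<lambda>n. norm (f n)) \<longlonglongrightarrow> 0)"

definition complex_linear :: "'a measure \<Rightarrow> ('l::banach \<Rightarrow> 'a \<Rightarrow> complex) \<Rightarrow> ('l \<Rightarrow>\<^sub>L 'l) \<Rightarrow> bool" where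
  "complex_linear M rep A \<longleftrightarrow>
     (\<forall>c f. blinfun_apply A (cscale M rep c f) = cscale M rep c (blinfun_apply A f))"

definition has_kernel ::
  "'a measure \<Rightarrow> ('l::banach \<Rightarrow> 'a \<Rightarrow> complex) \<Rightarrow> ('l \<Rightarrow>\<^sub>L 'l) \<Rightarrow> ('a \<times> 'a \<Rightarrow> complex) \<Rightarrow> bool" where
  "has_kernel M rep A a \<longleftrightarrow>
     a \<in> borel_measurable (M \<Otimes>\<^sub>M M) \<and>
     (\<forall>f. AE x in M. integrable M (\<lambda>y. a (x, y) * rep f y) \<and>
            rep (blinfun_apply A f) x = (\<integral>y. a (x, y) * rep f y \<partial>M))"

definition positive_kernel_operator ::
  "'a measure \<Rightarrow> ('l::banach \<Rightarrow> 'a \<Rightarrow> complex) \<Rightarrow> ('l \<Rightarrow>\<^sub>L 'l) \<Rightarrow> bool" where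
  "positive_kernel_operator M rep A \<longleftrightarrow>
     complex_linear M rep A \<and>
     (\<forall>f \<in> fun_nonneg M rep. blinfun_apply A f \<in> fun_nonneg M rep) \<and>
     (\<exists>a. has_kernel M rep A a)"

text \<open>
  The kernel of a positive kernel operator is nonnegative a.e. and determined up to null sets of
  \<open>M \<Otimes>\<^sub>M M\<close>, so \<open>cmod\<close> only changes it on a null set and the choice of the kernels \<open>a i\<close>
  does not affect the resulting operator.
\<close>

definition hadamard_mean ::
  "'a measure \<Rightarrow> ('l::banach \<Rightarrow> 'a \<Rightarrow> complex) \<Rightarrow> nat \<Rightarrow> (nat \<Rightarrow> real) \<Rightarrow> (nat \<Rightarrow> 'l \<Rightarrow>\<^sub>L 'l) \<Rightarrow> 'l \<Rightarrow>\<^sub>L 'l" where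
  "hadamard_mean M rep m \<alpha> A =
     (THE H. \<exists>a. (\<forall>i \<in> {1..m}. has_kernel M rep (A i) (a i)) \<and>
                 has_kernel M rep H (\<lambda>p. of_real (\<Prod>i = 1..m. cmod (a i p) powr \<alpha> i)))"

definition hadamard_mean_set ::
  "'a measure \<Rightarrow> ('l::banach \<Rightarrow> 'a \<Rightarrow> complex) \<Rightarrow> nat \<Rightarrow> (nat \<Rightarrow> real) \<Rightarrow>
     (nat \<Rightarrow> ('l \<Rightarrow>\<^sub>L 'l) set) \<Rightarrow> ('l \<Rightarrow>\<^sub>L 'l) set" where
  "hadamard_mean_set M rep m \<alpha> \<Psi> = {hadamard_mean M rep m \<alpha> A | A. \<forall>i \<in> {1..m}. A i \<in> \<Psi> i}"

definition product_set ::
  "nat \<Rightarrow> (nat \<Rightarrow> ('l::banach \<Rightarrow>\<^sub>L 'l) set) \<Rightarrow> ('l \<Rightarrow>\<^sub>L 'l) set" where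
  "product_set m \<Psi> = {foldr (\<lambda>i B. A i o\<^sub>L B) [1..<Suc m] id_blinfun | A. \<forall>i \<in> {1..m}. A i \<in> \<Psi> i}"

definition set_power :: "('l::banach \<Rightarrow>\<^sub>L 'l) set \<Rightarrow> nat \<Rightarrow> ('l \<Rightarrow>\<^sub>L 'l) set" where
  "set_power \<Sigma> m = product_set m (\<lambda>_. \<Sigma>)"

definition hausdorff_noncompactness :: "('l::banach \<Rightarrow>\<^sub>L 'l) \<Rightarrow> real" where
  "hausdorff_noncompactness A =
     Inf {\<delta>. \<delta> > 0 \<and> (\<exists>F. finite F \<and> blinfun_apply A ` cball 0 1 \<subseteq> (\<Union>f\<in>F. cball f \<delta>))}"

definition compact_operator :: "('l::banach \<Rightarrow> 'l) \<Rightarrow> bool" where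
  "compact_operator K \<longleftrightarrow> compact (closure (K ` cball 0 1))"

text \<open>
  The spectrum of the image of \<open>A\<close> in the Calkin algebra: the \<open>z\<close> for which \<open>z - A\<close> has no inverse
  modulo the compact operators. If \<open>'l\<close> is finite dimensional, then the Calkin algebra is zero
  and the spectrum is empty; inserting \<open>0\<close> makes the spectral radius \<open>0\<close> in this case, and has no
  effect otherwise.
\<close>

definition ess_spectrum :: "'a measure \<Rightarrow> ('l::banach \<Rightarrow> 'a \<Rightarrow> complex) \<Rightarrow> ('l \<Rightarrow>\<^sub>L 'l) \<Rightarrow> complex set" where
  "ess_spectrum M rep A =
     {z. \<not> (\<exists>B. complex_linear M rep B \<and>
           compact_operator (\<lambda>f. blinfun_apply B (cscale M rep z f - blinfun_apply A f) - f) \<and>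
           compact_operator (\<lambda>f. cscale M rep z (blinfun_apply B f) - blinfun_apply A (blinfun_apply B f) - f))}"

definition ess_spectral_radius :: "'a measure \<Rightarrow> ('l::banach \<Rightarrow> 'a \<Rightarrow> complex) \<Rightarrow> ('l \<Rightarrow>\<^sub>L 'l) \<Rightarrow> real" where
  "ess_spectral_radius M rep A = Sup (insert 0 (cmod ` ess_spectrum M rep A))"

text \<open>
  For bounded \<open>\<Sigma>\<close> all suprema below are over bounded sets of nonnegative reals; inserting \<open>0\<close> only
  matters for \<open>\<Sigma> = {}\<close>. The upper limit is taken in \<open>ereal\<close>, where it always exists, and is finite
  for bounded \<open>\<Sigma>\<close>.
\<close>

definition gen_ess_radius :: "'a measure \<Rightarrow> ('l::banach \<Rightarrow> 'a \<Rightarrow> complex) \<Rightarrow> ('l \<Rightarrow>\<^sub>L 'l) set \<Rightarrow> real" where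
  "gen_ess_radius M rep \<Sigma> =
     real_of_ereal (limsup (\<lambda>n. ereal
       (Sup (insert 0 (ess_spectral_radius M rep ` set_power \<Sigma> n)) powr (1 / real n))))"

definition joint_ess_radius :: "('l::banach \<Rightarrow>\<^sub>L 'l) set \<Rightarrow> real" where
  "joint_ess_radius \<Sigma> =
     lim (\<lambda>n. Sup (insert 0 (hausdorff_noncompactness ` set_power \<Sigma> n)) powr (1 / real n))"

end

theory Submission
  imports Defs
begin

text \<open>
  Let \<open>\<beta>\<close> be the Hausdorff measure of noncompactness. If \<open>T\<close> and \<open>P\<^sub>i\<close> are positive kernel operators
  with \<open>T f \<le> \<Sum>\<^sub>i t\<^sub>i P\<^sub>i f\<close> for \<open>f \<ge> 0\<close>, then \<open>\<beta> T \<le> \<Sum>\<^sub>i t\<^sub>i \<beta> P\<^sub>i\<close>: the operators \<open>P\<^sub>i\<close> map the unit ball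
  into an order interval plus a ball of radius slightly larger than \<open>\<beta> P\<^sub>i\<close>, hence \<open>T\<close> maps it into an
  order interval plus a ball of radius about \<open>\<delta> = \<Sum>\<^sub>i t\<^sub>i \<beta> P\<^sub>i\<close>, and order continuity of the norms of \<open>L\<close> and
  \<open>L\<^sup>*\<close> shows that \<open>T\<close> differs from the compact operator given by a truncated kernel by an operator of
  norm about \<open>\<delta>\<close>. So \<open>\<beta> T\<close> is the distance of \<open>T\<close> to the compact operators.

  A product \<open>T\<close> of weighted geometric means is dominated, by Hoelder's inequality and the inequality
  between weighted means, by \<open>\<Sum>\<^sub>i \<alpha>\<^sub>i t\<^sub>i P\<^sub>i\<close> for the column products \<open>P\<^sub>i\<close> and all positive \<open>t\<^sub>i\<close>
  whose geometric mean with weights \<open>\<alpha>\<^sub>i\<close> is \<open>1\<close>. Optimizing over \<open>t\<close> bounds \<open>\<beta> T\<close> by the geometric mean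
  of the \<open>\<beta> P\<^sub>i\<close>. The same bound for the essential spectral radius follows from Gelfand's formula in the
  Calkin algebra, where by the above \<open>\<beta>\<close> may replace the quotient norm.
\<close>

section \<open>Weighted means and growth rates\<close>

text \<open>A geometric mean of kernels is not linear in its factors, whereas \<open>\<beta>\<close>
  is only subadditive. Weighted arithmetic means bridge this gap: each is linear in the column
  products, and the geometric mean is their infimum. Domination alone says nothing about
  compactness: in general a positive operator below a compact one need not be compact. Being order
  bounded up to a small ball does pass to dominated operators, and order continuity of both norms
  converts it back into closeness to compact operators. This closeness has to hold in the operator
  norm, whose completeness provides the Neumann series behind inverses modulo compact operators. The
  two radii differ in kind. One is a limit of submultiplicative suprema, the other an upper limit of
  suprema that need not be submultiplicative. Both are treated as exponential growth rates. For the
  second inequality products of length n m must control all lengths: submultiplicativity achieves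
  this for \<open>\<beta>\<close>, powers of single products for the essential spectral
  radius.\<close>

lemma weighted_arith_geom_mean:
  fixes x \<alpha> :: "'b \<Rightarrow> real"
  assumes S: "finite S" "\<And>i. i \<in> S \<Longrightarrow> \<alpha> i > 0" "sum \<alpha> S = 1" and x: "\<And>i. i \<in> S \<Longrightarrow> x i \<ge> 0"
  shows "(\<Prod>i\<in>S. x i powr \<alpha> i) \<le> (\<Sum>i\<in>S. \<alpha> i * x i)"
\<comment> \<open>Jensen's inequality for \<open>exp\<close> is applied at the logarithms, so a
  vanishing factor is split off.\<close>
proof (cases "\<exists>i\<in>S. x i = 0")
  case True
  then have "(\<Prod>i\<in>S. x i powr \<alpha> i) = 0" using S by (intro prod_zero) auto
  moreover have "(\<Sum>i\<in>S. \<alpha> i * x i) \<ge> 0"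
    using S(2) x by (intro sum_nonneg mult_nonneg_nonneg) (auto simp: less_imp_le)
  ultimately show ?thesis by simp
next
  case False
  then have pos: "x i > 0" if "i \<in> S" for i using x that by force
  have ne: "S \<noteq> {}" using S by auto
  have "(\<Prod>i\<in>S. x i powr \<alpha> i) = exp (\<Sum>i\<in>S. \<alpha> i *\<^sub>R ln (x i))"
    unfolding exp_sum[OF S(1)]
  proof (intro prod.cong refl)
    show "x i powr \<alpha> i = exp (\<alpha> i *\<^sub>R ln (x i))" if "i \<in> S" for i
      using pos[OF that] by (simp add: powr_def)
  qed
  also have "\<dots> \<le> (\<Sum>i\<in>S. \<alpha> i * exp (ln (x i)))"
    using S ne by (intro convex_on_sum[OF _ _ exp_convex]) (auto intro: less_imp_le)
  also have "\<dots> = (\<Sum>i\<in>S. \<alpha> i * x i)" using pos by (intro sum.cong) auto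
  finally show ?thesis .
qed

text \<open>Scaling by t with geometric mean 1 leaves the left side unchanged. The right sides form
  a family of linear bounds, among which the later proofs optimize.\<close>

lemma weighted_arith_geom_mean_scaled:
  fixes x t \<alpha> :: "'b \<Rightarrow> real"
  assumes S: "finite S" "\<And>i. i \<in> S \<Longrightarrow> \<alpha> i > 0" "sum \<alpha> S = 1" and x: "\<And>i. i \<in> S \<Longrightarrow> x i \<ge> 0"
    and t: "\<And>i. i \<in> S \<Longrightarrow> t i > 0" "(\<Prod>i\<in>S. t i powr \<alpha> i) = 1"
  shows "(\<Prod>i\<in>S. x i powr \<alpha> i) \<le> (\<Sum>i\<in>S. \<alpha> i * t i * x i)"
proof -
  have "(\<Prod>i\<in>S. x i powr \<alpha> i) = (\<Prod>i\<in>S. t i powr \<alpha> i) * (\<Prod>i\<in>S. x i powr \<alpha> i)" using t by simp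
  also have "\<dots> = (\<Prod>i\<in>S. (t i * x i) powr \<alpha> i)"
    unfolding prod.distrib[symmetric] using x t by (intro prod.cong) (auto simp: powr_mult less_imp_le)
  also have "\<dots> \<le> (\<Sum>i\<in>S. \<alpha> i * (t i * x i))"
    using S x t by (intro weighted_arith_geom_mean) (auto simp: less_imp_le)
  finally show ?thesis by (simp add: mult.assoc)
qed

text \<open>It suffices to treat strict upper bounds c, which is the form in which growth rates
  supply estimates. Positivity of the exponents gives continuity of \<open>powr\<close> also at b i
  = 0.\<close>

lemma le_prod_powr_limit:
  fixes b \<alpha> :: "'b \<Rightarrow> real"
  assumes "\<And>i. i \<in> S \<Longrightarrow> \<alpha> i > 0" and b: "\<And>i. i \<in> S \<Longrightarrow> b i \<ge> 0"
    and le: "\<And>c. (\<And>i. i \<in> S \<Longrightarrow> c i > b i) \<Longrightarrow> X \<le> (\<Prod>i\<in>S. c i powr \<alpha> i)"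
  shows "X \<le> (\<Prod>i\<in>S. b i powr \<alpha> i)"
proof (rule tendsto_lowerbound)
  show "((\<lambda>e. \<Prod>i\<in>S. (b i + e) powr \<alpha> i) \<longlongrightarrow> (\<Prod>i\<in>S. b i powr \<alpha> i)) (at_right 0)"
  proof (intro tendsto_prod)
    fix i assume i: "i \<in> S"
    have "((\<lambda>e. (b i + e) powr \<alpha> i) \<longlongrightarrow> (b i + 0) powr \<alpha> i) (at_right 0)"
    proof (rule tendsto_powr')
      show "((\<lambda>e. b i + e) \<longlongrightarrow> b i + 0) (at_right 0)" by (intro tendsto_intros)
      show "b i + 0 \<noteq> 0 \<or> 0 < \<alpha> i \<and> (\<forall>\<^sub>F x in at_right 0. 0 \<le> b i + x)"
        using assms(1)[OF i] b[OF i] by (auto simp: eventually_at_right_field intro!: exI[of _ 1])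
    qed auto
    then show "((\<lambda>e. (b i + e) powr \<alpha> i) \<longlongrightarrow> b i powr \<alpha> i) (at_right 0)" by simp
  qed
  show "\<forall>\<^sub>F e in at_right 0. X \<le> (\<Prod>i\<in>S. (b i + e) powr \<alpha> i)"
    unfolding eventually_at_right_field by (rule exI[of _ 1]) (auto intro!: le)
qed simp

text \<open>The linear bounds are best when all t i * b i agree, which forces t i = P / b i with P
  the geometric mean. As some b i may vanish, this is done for strict upper bounds c in place of
  b.\<close>

lemma le_prod_powr_optimize:
  fixes b \<alpha> :: "'b \<Rightarrow> real"
  assumes S: "finite S" "\<And>i. i \<in> S \<Longrightarrow> \<alpha> i > 0" "sum \<alpha> S = 1" and b: "\<And>i. i \<in> S \<Longrightarrow> b i \<ge> 0"
    and le: "\<And>t. (\<And>i. i \<in> S \<Longrightarrow> t i > 0) \<Longrightarrow> (\<Prod>i\<in>S. t i powr \<alpha> i) = 1 \<Longrightarrow> X \<le> (\<Sum>i\<in>S. \<alpha> i * t i * b i)"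
  shows "X \<le> (\<Prod>i\<in>S. b i powr \<alpha> i)"
proof (rule le_prod_powr_limit[OF S(2) b])
  fix c assume c: "\<And>i. i \<in> S \<Longrightarrow> c i > b i"
  then have pos: "c i > 0" if "i \<in> S" for i using b that by force
  define P where "P = (\<Prod>i\<in>S. c i powr \<alpha> i)"
  have P: "P > 0" unfolding P_def using pos by (intro prod_pos) (auto simp: less_le)
  have "(\<Prod>i\<in>S. (P / c i) powr \<alpha> i) = (\<Prod>i\<in>S. P powr \<alpha> i / c i powr \<alpha> i)"
    using pos P by (intro prod.cong) (auto simp: powr_divide less_imp_le)
  also have "\<dots> = P powr (sum \<alpha> S) / P"
    unfolding prod_dividef P_def[symmetric] using P S(1) by (subst powr_sum) auto
  finally have 1: "(\<Prod>i\<in>S. (P / c i) powr \<alpha> i) = 1" using P S by simp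
  have "X \<le> (\<Sum>i\<in>S. \<alpha> i * (P / c i) * b i)" using le[OF _ 1] P pos by auto
  also have "\<dots> \<le> (\<Sum>i\<in>S. \<alpha> i * P)"
  proof (intro sum_mono)
    fix i assume i: "i \<in> S"
    have "P / c i * b i \<le> P" using c[OF i] pos[OF i] P by (simp add: field_simps)
    then have "\<alpha> i * (P / c i * b i) \<le> \<alpha> i * P"
      using S(2)[OF i] by (intro mult_left_mono) auto
    then show "\<alpha> i * (P / c i) * b i \<le> \<alpha> i * P" by (simp only: mult.assoc)
  qed
  also have "\<dots> = P" using S(3) by (simp flip: sum_distrib_right)
  finally show "X \<le> (\<Prod>i\<in>S. c i powr \<alpha> i)" unfolding P_def .
qed auto

text \<open>The infimum of all s > 0 with x n = O(s ^ n). Both radii are growth rates in this sense,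
  which replaces roots and limits by exponential bounds. Indices start at 1, since the 0-th power of
  a set of operators contains just the identity, in general no kernel operator.\<close>

definition growth_rate :: "(nat \<Rightarrow> real) \<Rightarrow> real \<Rightarrow> bool" where
  "growth_rate x r \<longleftrightarrow> 0 \<le> r \<and> (\<forall>s>r. \<exists>C. \<forall>n\<ge>1. x n \<le> C * s ^ n) \<and>
     (\<forall>s>0. \<forall>C. (\<forall>n\<ge>1. x n \<le> C * s ^ n) \<longrightarrow> r \<le> s)"

lemma growth_rateD:
  assumes "growth_rate x r"
  shows "0 \<le> r" "\<And>s. r < s \<Longrightarrow> \<exists>C\<ge>0. \<forall>n\<ge>1. x n \<le> C * s ^ n"
    "\<And>s C. 0 < s \<Longrightarrow> (\<And>n. n \<ge> 1 \<Longrightarrow> x n \<le> C * s ^ n) \<Longrightarrow> r \<le> s"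
proof -
  fix s assume s: "r < s"
  then obtain C where C: "\<forall>n\<ge>1. x n \<le> C * s ^ n" using assms unfolding growth_rate_def by blast
  have "0 < s" using s assms unfolding growth_rate_def by auto
  then have "x n \<le> max C 0 * s ^ n" if "n \<ge> 1" for n
    using C that by (meson max.cobounded1 mult_right_mono order_trans zero_le_power less_imp_le)
  then show "\<exists>C\<ge>0. \<forall>n\<ge>1. x n \<le> C * s ^ n" by (intro exI[of _ "max C 0"]) auto
next
  show "r \<le> s" if "0 < s" "\<And>n. n \<ge> 1 \<Longrightarrow> x n \<le> C * s ^ n" for s C
    using assms that unfolding growth_rate_def by blast
qed (use assms in \<open>simp add: growth_rate_def\<close>)

section \<open>Exponential bounds and n-th roots\<close>

lemma powr_inverse_nat_le_iff:
  fixes x s :: real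
  assumes "0 \<le> x" "0 \<le> s" "n \<ge> 1"
  shows "x powr (1 / real n) \<le> s \<longleftrightarrow> x \<le> s ^ n"
proof -
  have e: "(x powr (1 / real n)) ^ n = x"
    using assms by (cases "x = 0") (auto simp: powr_powr simp flip: powr_realpow)
  show ?thesis
    using power_mono_iff[of "x powr (1 / real n)" s n] assms e by simp
qed

lemma eventually_const_mult_power_le:
  fixes C s t :: real
  assumes "0 < s" "s < t" "C > 0"
  shows "\<forall>\<^sub>F n in sequentially. C * s ^ n \<le> t ^ n"
proof -
  have "(\<lambda>n. C * (s / t) ^ n) \<longlonglongrightarrow> C * 0"
    using assms by (intro tendsto_mult_left LIMSEQ_power_zero) auto
  then have "\<forall>\<^sub>F n in sequentially. C * (s / t) ^ n < 1"
    by (rule order_tendstoD) auto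
  then show ?thesis
    by eventually_elim (use assms in \<open>simp add: power_divide field_simps\<close>)
qed

lemma eventually_root_le:
  fixes x :: "nat \<Rightarrow> real"
  assumes x: "\<And>n. n \<ge> 1 \<Longrightarrow> 0 \<le> x n" and le: "\<And>n. n \<ge> 1 \<Longrightarrow> x n \<le> C * s ^ n" and s: "0 < s" "s < t"
  shows "\<forall>\<^sub>F n in sequentially. x n powr (1 / real n) \<le> t"
proof -
  have "\<forall>\<^sub>F n in sequentially. max C 1 * s ^ n \<le> t ^ n"
    using s by (intro eventually_const_mult_power_le) auto
  with eventually_ge_at_top[of 1] show ?thesis
  proof eventually_elim
    case (elim n)
    have "x n \<le> C * s ^ n" using le elim by auto
    also have "\<dots> \<le> max C 1 * s ^ n" using s by (intro mult_right_mono) auto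
    finally show ?case using elim x[of n] s by (subst powr_inverse_nat_le_iff) auto
  qed
qed

text \<open>The finitely many early terms are absorbed into the constant.\<close>

lemma growth_bound_of_eventually:
  fixes x :: "nat \<Rightarrow> real"
  assumes "\<forall>\<^sub>F n in sequentially. x n \<le> s ^ n" and s: "0 < s"
  shows "\<exists>C. \<forall>n. x n \<le> C * s ^ n"
proof -
  obtain N where N: "\<And>n. n \<ge> N \<Longrightarrow> x n \<le> s ^ n" using assms by (auto simp: eventually_sequentially)
  define C where "C = max 1 (Max ((\<lambda>n. x n / s ^ n) ` {..N}))"
  have "x n \<le> C * s ^ n" for n
  proof (cases "n \<le> N")
    case True
    then have "x n / s ^ n \<le> Max ((\<lambda>n. x n / s ^ n) ` {..N})" by (intro Max_ge) auto
    also have "\<dots> \<le> C" by (simp add: C_def)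
    finally show ?thesis using s by (simp add: field_simps)
  next
    case False
    then have "x n \<le> 1 * s ^ n" using N by simp
    also have "\<dots> \<le> C * s ^ n" using s by (intro mult_right_mono) (auto simp: C_def)
    finally show ?thesis .
  qed
  then show ?thesis by blast
qed

text \<open>The bound c ^ n keeps the upper limit in \<open>ereal\<close> finite, so that
  \<open>real_of_ereal\<close> returns its true value.\<close>

lemma growth_rate_limsup:
  fixes x :: "nat \<Rightarrow> real"
  assumes x: "\<And>n. n \<ge> 1 \<Longrightarrow> 0 \<le> x n" and le: "\<And>n. n \<ge> 1 \<Longrightarrow> x n \<le> c ^ n" and c: "0 < c"
  shows "growth_rate x (real_of_ereal (limsup (\<lambda>n. ereal (x n powr (1 / real n)))))"
proof -
  let ?l = "limsup (\<lambda>n. ereal (x n powr (1 / real n)))"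
  have upper: "?l \<le> ereal s" if s: "s > 0" and C: "\<And>n. n \<ge> 1 \<Longrightarrow> x n \<le> C * s ^ n" for s C
  proof (rule ereal_le_epsilon2)
    fix e :: real assume "0 < e"
    then have "\<forall>\<^sub>F n in sequentially. ereal (x n powr (1 / real n)) \<le> ereal s + ereal e"
      using eventually_root_le[OF x C s, of "s + e"] by simp
    then show "?l \<le> ereal s + ereal e" by (rule Limsup_bounded)
  qed
  have l0: "0 \<le> ?l" by (rule le_Limsup) auto
  have lc: "?l \<le> ereal c" using upper[OF c, of 1] le by simp
  then obtain r where r: "?l = ereal r" using l0 by (cases ?l) auto
  have "r \<ge> 0" using l0 r by simp
  moreover have "\<exists>C. \<forall>n\<ge>1. x n \<le> C * s ^ n" if s: "r < s" for s
  proof -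
    have "?l < ereal s" using r s by simp
    then have "\<forall>\<^sub>F n in sequentially. ereal (x n powr (1 / real n)) < ereal s" by (rule Limsup_lessD)
    with eventually_ge_at_top[of 1] have "\<forall>\<^sub>F n in sequentially. x n \<le> s ^ n"
    proof eventually_elim
      case (elim n)
      then have "x n powr (1 / real n) \<le> s" by simp
      then show ?case using elim x[of n] s \<open>r \<ge> 0\<close> by (subst (asm) powr_inverse_nat_le_iff) auto
    qed
    then show ?thesis using growth_bound_of_eventually[of x s] s \<open>r \<ge> 0\<close> by auto
  qed
  moreover have "r \<le> s" if "s > 0" "\<forall>n\<ge>1. x n \<le> C * s ^ n" for s C
    using upper[of s C] that r by auto
  ultimately show ?thesis unfolding growth_rate_def r by auto
qed

text \<open>A single index N decides: peeling off a block of length N costs a factor s ^ N, and the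
  remainders of length at most N determine the constant.\<close>

lemma submultiplicative_growth_bound:
  fixes x :: "nat \<Rightarrow> real"
  assumes x: "\<And>n. n \<ge> 1 \<Longrightarrow> 0 \<le> x n" and mult: "\<And>n k. n \<ge> 1 \<Longrightarrow> k \<ge> 1 \<Longrightarrow> x (n + k) \<le> x n * x k"
    and N: "N \<ge> 1" "x N \<le> s ^ N" and s: "0 < s"
  shows "\<exists>C. \<forall>n\<ge>1. x n \<le> C * s ^ n"
proof -
  define C where "C = Max ((\<lambda>n. x n / s ^ n) ` {1..N})"
  have C: "x n \<le> C * s ^ n" if "1 \<le> n" "n \<le> N" for n
  proof -
    have "x n / s ^ n \<le> C" unfolding C_def using that by (intro Max_ge) auto
    then show ?thesis using s by (simp add: field_simps)
  qed
  have "x n \<le> C * s ^ n" if "n \<ge> 1" for n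
    using that
  proof (induction n rule: less_induct)
    case (less n)
    show ?case
    proof (cases "n \<le> N")
      case False
      then have n: "n = (n - N) + N" "n - N \<ge> 1" by auto
      then have "x n \<le> x (n - N) * x N" using mult[of "n - N" N] N by simp
      also have "\<dots> \<le> (C * s ^ (n - N)) * s ^ N"
        using less.IH[of "n - N"] N n x[of "n - N"] x[of N]
        by (intro mult_mono) (auto intro: order_trans)
      also have "\<dots> = C * s ^ n" using n(1) by (metis mult.assoc power_add)
      finally show ?thesis .
    qed (use C less in auto)
  qed
  then show ?thesis by blast
qed

text \<open>Fekete's lemma: the roots converge to their infimum L, so \<open>lim\<close> denotes a
  genuine limit.\<close>

lemma growth_rate_submultiplicative:
  fixes x :: "nat \<Rightarrow> real"
  assumes x: "\<And>n. n \<ge> 1 \<Longrightarrow> 0 \<le> x n" and mult: "\<And>n k. n \<ge> 1 \<Longrightarrow> k \<ge> 1 \<Longrightarrow> x (n + k) \<le> x n * x k"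
  shows "growth_rate x (lim (\<lambda>n. x n powr (1 / real n)))"
proof -
  let ?X = "(\<lambda>n. x n powr (1 / real n)) ` {1..}"
  define L where "L = Inf ?X"
  have bdd: "bdd_below ?X" by (rule bdd_belowI[of _ 0]) auto
  have L0: "0 \<le> L" unfolding L_def by (rule cInf_greatest) auto
  have Lle: "L \<le> x n powr (1 / real n)" if "n \<ge> 1" for n
    unfolding L_def using that by (intro cInf_lower bdd) auto
  have bound: "\<exists>C. \<forall>n\<ge>1. x n \<le> C * s ^ n" if s: "L < s" for s
  proof -
    obtain N where N: "N \<ge> 1" "x N powr (1 / real N) < s"
      using s unfolding L_def by (subst (asm) cInf_less_iff[OF _ bdd]) auto
    have "x N \<le> s ^ N"
      using N x[of N] s L0 powr_inverse_nat_le_iff[of "x N" s N] by auto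
    then show ?thesis using submultiplicative_growth_bound[OF x mult] N s L0 by auto
  qed
  have "(\<lambda>n. x n powr (1 / real n)) \<longlonglongrightarrow> L"
  proof (rule order_tendstoI)
    fix a assume "a < L"
    then show "\<forall>\<^sub>F n in sequentially. a < x n powr (1 / real n)"
      using Lle by (intro eventually_sequentiallyI[of 1]) (auto intro: less_le_trans)
  next
    fix a assume a: "L < a"
    obtain s t where st: "L < s" "s < t" "t < a" using dense a by meson
    then obtain C where C: "\<forall>n\<ge>1. x n \<le> C * s ^ n" using bound by blast
    have "\<forall>\<^sub>F n in sequentially. x n powr (1 / real n) \<le> t"
      by (rule eventually_root_le[OF x]) (use C st L0 in auto)
    then show "\<forall>\<^sub>F n in sequentially. x n powr (1 / real n) < a"
      by eventually_elim (use st in auto)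
  qed
  then have lim: "lim (\<lambda>n. x n powr (1 / real n)) = L" by (rule limI)
  have "L \<le> s" if s: "s > 0" "\<forall>n\<ge>1. x n \<le> C * s ^ n" for s C
  proof (rule field_le_epsilon)
    fix e :: real assume e: "0 < e"
    have "\<forall>\<^sub>F n in sequentially. x n powr (1 / real n) \<le> s + e"
      by (rule eventually_root_le[OF x]) (use s e in auto)
    then obtain n where "n \<ge> 1" "x n powr (1 / real n) \<le> s + e"
      by (meson eventually_sequentially le_add1 le_add2)
    then show "L \<le> s + e" using Lle by fastforce
  qed
  then show ?thesis unfolding lim growth_rate_def using L0 bound by blast
qed

lemma cis_root_of_unity_power: "n \<ge> 1 \<Longrightarrow> cis (2 * pi * real k / real n) ^ n = 1"
  using cis_multiple_2pi[of "real k"] by (simp add: Complex.DeMoivre)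

section \<open>A spectral radius formula for seminorms\<close>

text \<open>The Calkin algebra by representatives: \<nu> becomes the measure of noncompactness, and
  elements stay operators instead of classes. Bounded operators are real-linear here, so complex
  scalars are ring elements c z that need not be central. Nothing is assumed about
  completeness.\<close>

locale seminormed_algebra =
  fixes \<nu> :: "'b::{ring,monoid_mult} \<Rightarrow> real" and c :: "complex \<Rightarrow> 'b"
  assumes nonneg: "0 \<le> \<nu> x"
    and triangle: "\<nu> (x + y) \<le> \<nu> x + \<nu> y"
    and minus: "\<nu> (- x) = \<nu> x"
    and mult: "\<nu> (x * y) \<le> \<nu> x * \<nu> y"
    and one: "\<nu> 1 \<le> 1"
    and scalar_add: "c (z + w) = c z + c w"
    and scalar_mult: "c (z * w) = c z * c w"
    and scalar_one: "c 1 = 1"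
    and scalar_bound: "\<nu> (c z * x) \<le> cmod z * \<nu> x"
begin

lemma scalar_zero: "c 0 = 0"
  using scalar_add[of 0 0] by simp

lemma scalar_diff: "c (z - w) = c z - c w"
  using scalar_add[of "z - w" w] by (simp add: algebra_simps)

lemma scalar_sum: "c (sum f A) = (\<Sum>i\<in>A. c (f i))"
  by (induction A rule: infinite_finite_induct) (auto simp: scalar_zero scalar_add)

lemma zero: "\<nu> 0 = 0"
  using scalar_bound[of 0 0] nonneg[of 0] by simp

lemma sum_le: "\<nu> (sum f A) \<le> (\<Sum>i\<in>A. \<nu> (f i))"
proof (induction A rule: infinite_finite_induct)
  case (insert i A)
  then show ?case using triangle[of "f i" "sum f A"] by simp
qed (auto simp: zero)

section \<open>Congruence modulo the null ideal of \<nu>\<close>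

definition congr (infix "\<doteq>" 50) where "x \<doteq> y \<longleftrightarrow> \<nu> (x - y) = 0"

lemma congr_refl: "x \<doteq> x"
  by (simp add: congr_def zero)

lemma congr_sym: "x \<doteq> y \<Longrightarrow> y \<doteq> x"
  using minus[of "x - y"] by (simp add: congr_def)

lemma congr_trans [trans]: "x \<doteq> y \<Longrightarrow> y \<doteq> z \<Longrightarrow> x \<doteq> z"
  using triangle[of "x - y" "y - z"] nonneg[of "x - z"] by (simp add: congr_def)

lemma congr_add: "x \<doteq> y \<Longrightarrow> x' \<doteq> y' \<Longrightarrow> x + x' \<doteq> y + y'"
  using triangle[of "x - y" "x' - y'"] nonneg[of "x + x' - (y + y')"]
  by (simp add: congr_def algebra_simps)

lemma congr_diff: "x \<doteq> y \<Longrightarrow> x' \<doteq> y' \<Longrightarrow> x - x' \<doteq> y - y'"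
  using triangle[of "x - y" "- (x' - y')"] minus[of "x' - y'"] nonneg[of "x - x' - (y - y')"]
  by (simp add: congr_def algebra_simps)

lemma congr_mult_left: "x \<doteq> y \<Longrightarrow> z * x \<doteq> z * y"
  using mult[of z "x - y"] nonneg[of "z * (x - y)"] by (simp add: congr_def algebra_simps)

lemma congr_mult_right: "x \<doteq> y \<Longrightarrow> x * z \<doteq> y * z"
  using mult[of "x - y" z] nonneg[of "(x - y) * z"] by (simp add: congr_def algebra_simps)

lemma congr_sum: "(\<And>i. i \<in> A \<Longrightarrow> f i \<doteq> g i) \<Longrightarrow> sum f A \<doteq> sum g A"
  by (induction A rule: infinite_finite_induct) (auto simp: congr_refl congr_add)

lemma congr_imp_eq: "x \<doteq> y \<Longrightarrow> \<nu> x = \<nu> y"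
  using triangle[of "x - y" y] triangle[of "y - x" x] minus[of "x - y"] by (simp add: congr_def)

lemma diff_le: "\<nu> (x - y) \<le> \<nu> x + \<nu> y"
  using triangle[of x "- y"] minus[of y] by simp

text \<open>For operators this singles out the complex-linear ones among the real-linear ones, see
  \<open>commuting_iff\<close>.\<close>

definition commuting where "commuting b \<longleftrightarrow> (\<forall>z. c z * b = b * c z)"

lemma commuting_left_commute: "commuting b \<Longrightarrow> b * (c z * y) = c z * (b * y)"
  by (metis commuting_def mult.assoc)

lemma commuting_mult: "commuting x \<Longrightarrow> commuting y \<Longrightarrow> commuting (x * y)"
  by (metis commuting_def mult.assoc)

lemma commuting_add: "commuting x \<Longrightarrow> commuting y \<Longrightarrow> commuting (x + y)"
  by (simp add: commuting_def algebra_simps)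

lemma commuting_diff: "commuting x \<Longrightarrow> commuting y \<Longrightarrow> commuting (x - y)"
  by (simp add: commuting_def algebra_simps)

lemma commuting_zero: "commuting 0"
  by (simp add: commuting_def)

lemma commuting_one: "commuting 1"
  by (simp add: commuting_def)

lemma commuting_power: "commuting x \<Longrightarrow> commuting (x ^ n)"
  by (induction n) (auto simp: commuting_one commuting_mult)

lemma commuting_scalar: "commuting (c z)"
  by (simp add: commuting_def flip: scalar_mult) (simp add: mult.commute)

lemma commuting_sum: "(\<And>i. i \<in> A \<Longrightarrow> commuting (f i)) \<Longrightarrow> commuting (sum f A)"
  by (induction A rule: infinite_finite_induct) (auto simp: commuting_zero commuting_add)

text \<open>The cofactor of c z - a in c (z ^ n) - a ^ n, see \<open>geometric_mult\<close>.\<close>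

definition geometric :: "complex \<Rightarrow> 'b \<Rightarrow> nat \<Rightarrow> 'b" where
  "geometric z a n = (\<Sum>j<n. c (z ^ (n - 1 - j)) * a ^ j)"

lemma geometric_Suc: "geometric z a (Suc n) = c z * geometric z a n + a ^ n"
proof -
  have "c (z ^ (n - j)) * a ^ j = c z * (c (z ^ (n - 1 - j)) * a ^ j)" if "j < n" for j
  proof -
    have "z ^ (n - j) = z * z ^ (n - 1 - j)"
      using that by (metis Suc_diff_Suc diff_Suc_eq_diff_pred power_Suc)
    then show ?thesis by (simp add: scalar_mult mult.assoc)
  qed
  then show ?thesis by (simp add: geometric_def sum_distrib_left scalar_one)
qed

lemma commuting_geometric: "commuting a \<Longrightarrow> commuting (geometric z a n)"
  unfolding geometric_def
  by (intro commuting_sum commuting_mult commuting_scalar commuting_power)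

lemma geometric_commute:
  assumes "commuting a"
  shows "a * geometric z a n = geometric z a n * a"
proof (induction n)
  case 0 then show ?case by (simp add: geometric_def)
next
  case (Suc n)
  have "a * (c z * geometric z a n) = c z * (a * geometric z a n)"
    using assms by (metis commuting_def mult.assoc)
  then show ?case
    using Suc by (simp add: geometric_Suc distrib_left distrib_right power_commutes mult.assoc)
qed

lemma geometric_mult:
  assumes a: "commuting a"
  shows "geometric z a n * (c z - a) = c (z ^ n) - a ^ n"
    and "(c z - a) * geometric z a n = c (z ^ n) - a ^ n"
proof -
  show 1: "geometric z a n * (c z - a) = c (z ^ n) - a ^ n"
  proof (induction n)
    case 0 then show ?case by (simp add: geometric_def scalar_one)
  next
    case (Suc n)
    have "geometric z a (Suc n) * (c z - a) = c z * (geometric z a n * (c z - a)) + a ^ n * (c z - a)"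
      by (simp add: geometric_Suc distrib_right mult.assoc)
    also have "\<dots> = c (z * z ^ n) - c z * a ^ n + (a ^ n * c z - a ^ n * a)"
      unfolding Suc by (simp add: right_diff_distrib scalar_mult)
    also have "a ^ n * c z = c z * a ^ n" using commuting_power[OF a] by (simp add: commuting_def)
    finally show ?case by (simp add: power_commutes)
  qed
  have "(c z - a) * geometric z a n = geometric z a n * (c z - a)"
    using commuting_geometric[OF a] geometric_commute[OF a]
    by (simp add: commuting_def left_diff_distrib right_diff_distrib)
  with 1 show "(c z - a) * geometric z a n = c (z ^ n) - a ^ n" by simp
qed

text \<open>Reduces invertibility of z - a modulo the null ideal to exact invertibility of z ^ n
  minus a perturbed n-th power. The cofactor yields a right inverse B and a left inverse D, and
  evaluating D (z - a) B in two ways shows that they are congruent, so B is two-sided.\<close>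

lemma inverse_mod_of_power:
  assumes a: "commuting a" and C: "commuting C" and K: "\<nu> K = 0"
    and inv: "(c (z ^ n) - (a ^ n - K)) * C = 1" "C * (c (z ^ n) - (a ^ n - K)) = 1"
  shows "\<exists>b. commuting b \<and> (c z - a) * b \<doteq> 1 \<and> b * (c z - a) \<doteq> 1"
proof -
  let ?S = "geometric z a n"
  define B where "B = ?S * C"
  define D where "D = C * ?S"
  have K0: "K \<doteq> 0" using K by (simp add: congr_def)
  have e: "c (z ^ n) - a ^ n = (c (z ^ n) - (a ^ n - K)) - K" by simp
  have "(c z - a) * B = (c (z ^ n) - a ^ n) * C"
    by (simp add: B_def geometric_mult[OF a] flip: mult.assoc)
  also have "\<dots> = 1 - K * C" unfolding e by (subst left_diff_distrib) (simp add: inv)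
  also have "\<dots> \<doteq> 1 - 0 * C" by (intro congr_diff congr_mult_right K0 congr_refl)
  finally have B: "(c z - a) * B \<doteq> 1" by simp
  have "D * (c z - a) = C * (c (z ^ n) - a ^ n)"
    by (simp add: D_def geometric_mult[OF a] mult.assoc)
  also have "\<dots> = 1 - C * K" unfolding e by (subst right_diff_distrib) (simp add: inv)
  also have "\<dots> \<doteq> 1 - C * 0" by (intro congr_diff congr_mult_left K0 congr_refl)
  finally have D: "D * (c z - a) \<doteq> 1" by simp
  have "B = 1 * B" by simp
  also have "\<dots> \<doteq> (D * (c z - a)) * B" by (intro congr_mult_right congr_sym[OF D])
  also have "\<dots> = D * ((c z - a) * B)" by (simp add: mult.assoc)
  also have "\<dots> \<doteq> D * 1" by (intro congr_mult_left B)
  finally have "B \<doteq> D" by simp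
  then have "B * (c z - a) \<doteq> 1" using congr_trans[OF congr_mult_right D] by blast
  moreover have "commuting B" unfolding B_def by (intro commuting_mult commuting_geometric a C)
  ultimately show ?thesis using B by blast
qed

text \<open>Orthogonality of the characters of the cyclic group: summing \<omega> k ^ (n - j) over k
  annihilates every term with 0 < j < n, and the scalar term j = 0 survives.\<close>

lemma geometric_root_of_unity_sum:
  assumes "n \<ge> 1"
  defines "\<omega> \<equiv> \<lambda>k. cis (2 * pi * real k / real n)"
  shows "(\<Sum>k<n. c (of_real t * \<omega> k) * geometric (of_real t * \<omega> k) a n) = c (of_nat n * of_real t ^ n)"
proof -
  have pow: "\<omega> k ^ j = cis (2 * pi * real j / real n) ^ k" for k j
    unfolding \<omega>_def Complex.DeMoivre by (simp add: mult_ac)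
  have sum0: "(\<Sum>k<n. \<omega> k ^ j) = 0" if j: "0 < j" "j < n" for j
  proof -
    let ?w = "cis (2 * pi * real j / real n)"
    have "?w \<noteq> 1"
    proof
      assume "?w = 1"
      then have "cos (2 * pi * real j / real n) = 1" by (metis cis.simps(1) one_complex.sel(1))
      then obtain i :: int where i: "2 * pi * real j / real n = of_int i * 2 * pi"
        using cos_one_2pi_int by blast
      then have "real j = of_int i * real n" using assms(1) by (auto simp: field_simps)
      then have "int j = i * int n"
        by (metis of_int_eq_iff of_int_mult of_int_of_nat_eq)
      then have "int n dvd int j" by simp
      then have "n dvd j" by simp
      then show False using j by (auto dest: nat_dvd_not_less)
    qed
    moreover have "?w ^ n = 1" by (rule cis_root_of_unity_power[OF assms(1)])
    ultimately show ?thesis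
      by (simp add: pow sum_gp_strict)
  qed
  have root1: "\<omega> k ^ n = 1" for k
    unfolding \<omega>_def by (rule cis_root_of_unity_power[OF assms(1)])
  have "(\<Sum>k<n. c (of_real t * \<omega> k) * geometric (of_real t * \<omega> k) a n)
      = (\<Sum>k<n. \<Sum>j<n. c ((of_real t * \<omega> k) ^ (n - j)) * a ^ j)"
  proof (intro sum.cong refl)
    fix k
    have "(of_real t * \<omega> k) * (of_real t * \<omega> k) ^ (n - 1 - j) = (of_real t * \<omega> k) ^ (n - j)" if "j < n" for j
      using that by (metis Suc_diff_Suc diff_Suc_eq_diff_pred power_Suc)
    then show "c (of_real t * \<omega> k) * geometric (of_real t * \<omega> k) a n
        = (\<Sum>j<n. c ((of_real t * \<omega> k) ^ (n - j)) * a ^ j)"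
      unfolding geometric_def sum_distrib_left
      by (intro sum.cong refl) (simp flip: mult.assoc scalar_mult)
  qed
  also have "\<dots> = (\<Sum>j<n. c (of_real t ^ (n - j) * (\<Sum>k<n. \<omega> k ^ (n - j))) * a ^ j)"
    by (subst sum.swap) (simp add: power_mult_distrib sum_distrib_left sum_distrib_right scalar_sum)
  also have "\<dots> = (\<Sum>j<n. if j = 0 then c (of_nat n * of_real t ^ n) else 0)"
    by (intro sum.cong refl) (auto simp: root1 sum0 scalar_zero mult.commute)
  also have "\<dots> = c (of_nat n * of_real t ^ n)" using assms(1) by simp
  finally show ?thesis .
qed

text \<open>
  Gelfand's formula without functionals (after Kametani and Rickart): the average \<open>f n t\<close> of the
  resolvent over the \<open>n\<close>-th roots of unity is the inverse of \<open>1 - (a / t)\<^sup>n\<close>, and it is Lipschitz in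
  \<open>t\<close> uniformly in \<open>n\<close>. If \<open>a / t\<close> has bounded powers, then \<open>f n (t + \<epsilon>)\<close> tends to \<open>1\<close>, so \<open>f n (t - \<epsilon>)\<close> stays
  close to \<open>1\<close> and \<open>a / (t - \<epsilon>)\<close> has bounded powers as well.
\<close>

theorem power_bound_of_resolvent:
  assumes a: "commuting a" and r: "0 \<le> r" "r < s"
    and inv: "\<And>z. r < cmod z \<Longrightarrow> \<exists>b. commuting b \<and> (c z - a) * b \<doteq> 1 \<and> b * (c z - a) \<doteq> 1"
  shows "\<exists>C. \<forall>n. \<nu> (a ^ n) \<le> C * s ^ n"
proof -
  obtain B where Bc: "\<And>z. r < cmod z \<Longrightarrow> commuting (B z)"
    and B1: "\<And>z. r < cmod z \<Longrightarrow> (c z - a) * B z \<doteq> 1" and B2: "\<And>z. r < cmod z \<Longrightarrow> B z * (c z - a) \<doteq> 1"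
    using inv by metis
  \<comment> \<open>The resolvent identity B z - B w = (w - z) B z B w holds modulo the null ideal,
    and \<nu> takes the same value at congruent elements.\<close>
  have resolvent: "\<nu> (B z - B w) \<le> cmod (z - w) * (\<nu> (B z) * \<nu> (B w))"
    if z: "r < cmod z" and w: "r < cmod w" for z w
  proof -
    have "B z - B w = B z * 1 - 1 * B w" by simp
    also have "\<dots> \<doteq> B z * ((c w - a) * B w) - (B z * (c z - a)) * B w"
      by (intro congr_diff congr_mult_left congr_mult_right congr_sym[OF B1[OF w]] congr_sym[OF B2[OF z]])
    also have "\<dots> = B z * c (w - z) * B w" by (simp add: algebra_simps scalar_diff)
    also have "B z * c (w - z) = c (w - z) * B z" using Bc[OF z] by (simp add: commuting_def)
    also have "\<dots> * B w = c (w - z) * (B z * B w)" by (simp add: mult.assoc)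
    finally have "\<nu> (B z - B w) = \<nu> (c (w - z) * (B z * B w))" by (rule congr_imp_eq)
    also have "\<dots> \<le> cmod (w - z) * \<nu> (B z * B w)" by (rule scalar_bound)
    also have "\<dots> \<le> cmod (w - z) * (\<nu> (B z) * \<nu> (B w))" by (intro mult_left_mono mult) auto
    finally show ?thesis by (simp add: norm_minus_commute)
  qed
  \<comment> \<open>The annulus between s and s2 contains the starting radius max s (\<nu> a) and
    leaves room 1 above it for the outward step by \<delta>.\<close>
  define s2 where "s2 = s + \<nu> a + 1"
  have s2: "s < s2" "0 < s" "0 < s2" using r nonneg[of a] by (auto simp: s2_def)
  let ?K = "cball 0 s2 - ball (0::complex) s"
  have K: "r < cmod z" if "z \<in> ?K" for z using that r by auto
  \<comment> \<open>On a disc of radius 1 / (2 (\<nu> (B z) + 1)) about z the resolvent estimate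
    absorbs half of \<nu> (B w), so \<nu> (B w) \<le> 2 \<nu> (B z). Compactness of the annulus
    makes the bound uniform.\<close>
  obtain M where M: "M \<ge> 1" "\<And>z. z \<in> ?K \<Longrightarrow> \<nu> (B z) \<le> M"
  proof -
    have "compact ?K" by (intro compact_diff) auto
    then obtain D where D: "D \<subseteq> ?K" "finite D" "?K \<subseteq> (\<Union>z\<in>D. ball z (1 / (2 * (\<nu> (B z) + 1))))"
    proof (rule compactE_image)
      show "?K \<subseteq> (\<Union>z\<in>?K. ball z (1 / (2 * (\<nu> (B z) + 1))))"
        using nonneg by (auto intro!: bexI simp: add_nonneg_pos)
    qed auto
    define M where "M = 1 + (\<Sum>z\<in>D. 2 * \<nu> (B z))"
    have "\<nu> (B w) \<le> M" if w: "w \<in> ?K" for w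
    proof -
      obtain z where z: "z \<in> D" "dist z w < 1 / (2 * (\<nu> (B z) + 1))" using D(3) w by auto
      have "cmod (w - z) * \<nu> (B z) \<le> 1 / (2 * (\<nu> (B z) + 1)) * (\<nu> (B z) + 1)"
        using z nonneg[of "B z"] by (intro mult_mono) (auto simp: dist_norm norm_minus_commute)
      also have "\<dots> = 1 / 2" using nonneg[of "B z"] by (simp add: field_simps)
      finally have "cmod (w - z) * \<nu> (B z) * \<nu> (B w) \<le> 1 / 2 * \<nu> (B w)" by (intro mult_right_mono nonneg)
      moreover have "\<nu> (B w - B z) \<le> cmod (w - z) * (\<nu> (B w) * \<nu> (B z))"
        using w z D(1) K by (intro resolvent) auto
      moreover have "\<nu> (B w) \<le> \<nu> (B w - B z) + \<nu> (B z)" using triangle[of "B w - B z" "B z"] by simp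
      ultimately have "\<nu> (B w) \<le> 2 * \<nu> (B z)" by (simp add: mult_ac)
      also have "\<dots> \<le> (\<Sum>z\<in>D. 2 * \<nu> (B z))"
        using z D nonneg by (intro member_le_sum) auto
      finally show ?thesis by (simp add: M_def)
    qed
    moreover have "M \<ge> 1" unfolding M_def using nonneg by (auto intro!: sum_nonneg)
    ultimately show ?thesis using that by blast
  qed
  define \<omega> where "\<omega> = (\<lambda>n k. cis (2 * pi * real k / real n))"
  define f where "f = (\<lambda>n t. c (1 / of_nat n) * (\<Sum>k<n. c (of_real t * \<omega> n k) * B (of_real t * \<omega> n k)))"
  have \<omega>: "cmod (\<omega> n k) = 1" for n k by (simp add: \<omega>_def)
  have inK: "of_real t * \<omega> n k \<in> ?K" if "s \<le> t" "t \<le> s2" for t n k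
    using that s2 by (auto simp: norm_mult \<omega>)
  have f_inv: "(c (of_real t ^ n) - a ^ n) * f n t \<doteq> c (of_real t ^ n)"
    if n: "n \<ge> 1" and t: "s \<le> t" "t \<le> s2" for n t
  proof -
    have root1: "\<omega> n k ^ n = 1" for k
      unfolding \<omega>_def by (rule cis_root_of_unity_power[OF n])
    have *: "(c (of_real t ^ n) - a ^ n) * (c z * B z) \<doteq> c z * geometric z a n"
      if z: "z = of_real t * \<omega> n k" for z k
    proof -
      have "z ^ n = of_real t ^ n" by (simp add: z power_mult_distrib root1)
      then have "(c (of_real t ^ n) - a ^ n) * (c z * B z) = geometric z a n * (c z - a) * (c z * B z)"
        using geometric_mult(1)[OF a, of z n] by simp
      also have "\<dots> = c z * (geometric z a n * ((c z - a) * B z))"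
      proof -
        have "commuting (geometric z a n * (c z - a))"
          by (intro commuting_mult commuting_geometric commuting_diff commuting_scalar a)
        then show ?thesis using commuting_left_commute by (metis (no_types) mult.assoc)
      qed
      also have "\<dots> \<doteq> c z * (geometric z a n * 1)"
        using inK[OF t] z by (intro congr_mult_left B1 K) auto
      finally show ?thesis by simp
    qed
    have "(c (of_real t ^ n) - a ^ n) * f n t
        = c (1 / of_nat n) * (\<Sum>k<n. (c (of_real t ^ n) - a ^ n) * (c (of_real t * \<omega> n k) * B (of_real t * \<omega> n k)))"
    proof -
      have "commuting (c (of_real t ^ n) - a ^ n)"
        by (intro commuting_diff commuting_scalar commuting_power a)
      then show ?thesis unfolding f_def sum_distrib_left[symmetric] by (rule commuting_left_commute)
    qed
    also have "\<dots> \<doteq> c (1 / of_nat n) * (\<Sum>k<n. c (of_real t * \<omega> n k) * geometric (of_real t * \<omega> n k) a n)"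
      by (intro congr_mult_left congr_sum) (rule *, rule refl)
    also have "\<dots> = c (1 / of_nat n) * c (of_nat n * of_real t ^ n)"
      unfolding \<omega>_def using geometric_root_of_unity_sum[OF n] by simp
    also have "\<dots> = c (of_real t ^ n)" using n by (simp flip: scalar_mult)
    finally show ?thesis .
  qed
  have avg: "\<nu> (c (1 / of_nat n) * (\<Sum>k<n. g k)) \<le> H" if "n \<ge> 1" "\<And>k. \<nu> (g k) \<le> H" for n g H
  proof -
    have "\<nu> (c (1 / of_nat n) * (\<Sum>k<n. g k)) \<le> 1 / real n * \<nu> (\<Sum>k<n. g k)"
      using scalar_bound[of "1 / of_nat n"] by (simp add: norm_divide)
    also have "\<dots> \<le> 1 / real n * (\<Sum>k<n. \<nu> (g k))" by (intro mult_left_mono sum_le) auto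
    also have "\<dots> \<le> 1 / real n * (\<Sum>k<n. H)" by (intro mult_left_mono sum_mono that) auto
    also have "\<dots> = H" using that by simp
    finally show ?thesis .
  qed
  \<comment> \<open>A Lipschitz constant of z B z on the annulus, by the product rule and the
    resolvent estimate.\<close>
  define \<eta> where "\<eta> = M + s2 * (M * M)"
  have \<eta>: "\<eta> > 0" using M s2 by (auto simp: \<eta>_def intro!: add_pos_nonneg)
  have f_bound: "\<nu> (f n t) \<le> s2 * M" if n: "n \<ge> 1" and t: "s \<le> t" "t \<le> s2" for n t
    unfolding f_def
  proof (rule avg[OF n])
    fix k
    have "\<nu> (c (of_real t * \<omega> n k) * B (of_real t * \<omega> n k)) \<le> t * \<nu> (B (of_real t * \<omega> n k))"
      using scalar_bound[of "of_real t * \<omega> n k"] t s2 by (simp add: norm_mult \<omega>)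
    also have "\<dots> \<le> s2 * M" using M inK[OF t] t s2 nonneg by (intro mult_mono) auto
    finally show "\<nu> (c (of_real t * \<omega> n k) * B (of_real t * \<omega> n k)) \<le> s2 * M" .
  qed
  have f_lip: "\<nu> (f n t - f n u) \<le> \<bar>t - u\<bar> * \<eta>"
    if n: "n \<ge> 1" and t: "s \<le> t" "t \<le> s2" and u: "s \<le> u" "u \<le> s2" for n t u
  proof -
    let ?z = "\<lambda>k. of_real t * \<omega> n k" and ?w = "\<lambda>k. of_real u * \<omega> n k"
    have "f n t - f n u = c (1 / of_nat n) * (\<Sum>k<n. c (?z k) * B (?z k) - c (?w k) * B (?w k))"
      by (simp add: f_def sum_subtractf right_diff_distrib)
    also have "\<nu> \<dots> \<le> \<bar>t - u\<bar> * \<eta>"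
    proof (rule avg[OF n])
      fix k
      have d: "cmod (?z k - ?w k) = \<bar>t - u\<bar>"
        by (simp add: norm_mult \<omega> flip: left_diff_distrib of_real_diff)
      have "c (?z k) * B (?z k) - c (?w k) * B (?w k)
          = c (?z k - ?w k) * B (?z k) + c (?w k) * (B (?z k) - B (?w k))"
        by (simp add: scalar_diff algebra_simps)
      also have "\<nu> \<dots> \<le> \<nu> (c (?z k - ?w k) * B (?z k)) + \<nu> (c (?w k) * (B (?z k) - B (?w k)))"
        by (rule triangle)
      also have "\<dots> \<le> cmod (?z k - ?w k) * \<nu> (B (?z k)) + cmod (?w k) * \<nu> (B (?z k) - B (?w k))"
        by (intro add_mono scalar_bound)
      also have "\<dots> \<le> \<bar>t - u\<bar> * M + s2 * (\<bar>t - u\<bar> * (M * M))"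
      proof (intro add_mono mult_mono)
        have "\<nu> (B (?z k) - B (?w k)) \<le> cmod (?z k - ?w k) * (\<nu> (B (?z k)) * \<nu> (B (?w k)))"
          by (rule resolvent[OF K[OF inK[OF t]] K[OF inK[OF u]]])
        also have "\<dots> \<le> \<bar>t - u\<bar> * (M * M)"
          unfolding d by (intro mult_left_mono mult_mono M inK t u nonneg) (use M in auto)
        finally show "\<nu> (B (?z k) - B (?w k)) \<le> \<bar>t - u\<bar> * (M * M)" .
      qed (use d M inK[OF t] u s2 nonneg in \<open>auto simp: norm_mult \<omega>\<close>)
      also have "\<dots> = \<bar>t - u\<bar> * \<eta>" by (simp add: \<eta>_def algebra_simps)
      finally show "\<nu> (c (?z k) * B (?z k) - c (?w k) * B (?w k)) \<le> \<bar>t - u\<bar> * \<eta>" .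
    qed
    finally show ?thesis .
  qed
  \<comment> \<open>x n t is (a / t) ^ n, and f n t is a right inverse of 1 - x n t modulo the null
    ideal.\<close>
  define x where "x = (\<lambda>n t. c (1 / of_real t ^ n) * a ^ n)"
  have x_f: "x n t * f n t \<doteq> f n t - 1" and x_le: "\<nu> (x n t) \<le> \<nu> (a ^ n) / t ^ n"
    and le_x: "\<nu> (a ^ n) \<le> t ^ n * \<nu> (x n t)"
    if n: "n \<ge> 1" and t: "s \<le> t" "t \<le> s2" for n t
  proof -
    have t0: "t \<noteq> 0" "t > 0" using t s2 by auto
    have e: "c (1 / of_real t ^ n) * c (of_real t ^ n) = 1" "c (of_real t ^ n) * c (1 / of_real t ^ n) = 1"
      using t0 by (simp_all add: scalar_one flip: scalar_mult)
    have "c (1 / of_real t ^ n) * ((c (of_real t ^ n) - a ^ n) * f n t) \<doteq> c (1 / of_real t ^ n) * c (of_real t ^ n)"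
      by (intro congr_mult_left f_inv n t)
    moreover have "c (1 / of_real t ^ n) * ((c (of_real t ^ n) - a ^ n) * f n t) = f n t - x n t * f n t"
      by (simp add: left_diff_distrib right_diff_distrib x_def e flip: mult.assoc)
    ultimately have "f n t - x n t * f n t \<doteq> 1" using e by simp
    then show "x n t * f n t \<doteq> f n t - 1"
      using congr_diff[OF congr_refl[of "f n t"]] by fastforce
    show "\<nu> (x n t) \<le> \<nu> (a ^ n) / t ^ n"
      using scalar_bound[of "1 / of_real t ^ n" "a ^ n"] t0 by (simp add: x_def norm_divide norm_power)
    have "a ^ n = c (of_real t ^ n) * x n t" by (simp add: x_def e flip: mult.assoc)
    then show "\<nu> (a ^ n) \<le> t ^ n * \<nu> (x n t)"
      using scalar_bound[of "of_real t ^ n" "x n t"] t0 by (simp add: norm_power)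
  qed
  define bdd where "bdd = (\<lambda>t. \<exists>C. \<forall>n. \<nu> (a ^ n) \<le> C * t ^ n)"
  \<comment> \<open>The points t - \<delta> and t + \<delta> differ by 2 \<delta>, which changes f
    by at most 1 / 4; another 1 / 4 is allowed for the distance of f from 1 at t + \<delta>.\<close>
  define \<delta> where "\<delta> = 1 / (8 * \<eta>)"
  have \<delta>: "\<delta> > 0" "2 * \<delta> * \<eta> = 1 / 4" using \<eta> by (auto simp: \<delta>_def)
  have step: "bdd (max s (t - \<delta>))" if t: "s \<le> t" "t + \<delta> \<le> s2" and b: "bdd t" for t
  proof -
    let ?u = "max s (t - \<delta>)" and ?v = "t + \<delta>"
    obtain C where C: "\<And>n. \<nu> (a ^ n) \<le> C * t ^ n" using b by (auto simp: bdd_def)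
    have C0: "C \<ge> 0" using C[of 0] nonneg[of 1] by simp
    have "(\<lambda>n. C * (s2 * M) * (t / ?v) ^ n) \<longlonglongrightarrow> C * (s2 * M) * 0"
      using t s2 \<delta> by (intro tendsto_mult_left LIMSEQ_power_zero) auto
    then have "\<forall>\<^sub>F n in sequentially. C * (s2 * M) * (t / ?v) ^ n < 1 / 4"
      by (rule order_tendstoD) auto
    with eventually_ge_at_top[of 1] have "\<forall>\<^sub>F n in sequentially. \<nu> (a ^ n) \<le> ?u ^ n"
    proof eventually_elim
      case (elim n)
      have v: "s \<le> ?v" "?v \<le> s2" and u: "s \<le> ?u" "?u \<le> s2" using t \<delta> by auto
      have "\<nu> (f n ?v - 1) = \<nu> (x n ?v * f n ?v)"
        by (rule congr_imp_eq[OF x_f[OF elim(1) v], symmetric])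
      also have "\<dots> \<le> \<nu> (x n ?v) * \<nu> (f n ?v)" by (rule mult)
      also have "\<dots> \<le> (C * t ^ n / ?v ^ n) * (s2 * M)"
        using x_le[OF elim(1) v] C[of n] v s2 f_bound[OF elim(1) v] C0 t nonneg
        by (intro mult_mono) (auto intro!: order_trans[OF x_le[OF elim(1) v]] divide_right_mono)
      also have "\<dots> < 1 / 4" using elim(2) by (simp add: power_divide mult_ac)
      finally have 1: "\<nu> (f n ?v - 1) < 1 / 4" .
      have "\<nu> (f n ?u - f n ?v) \<le> \<bar>?u - ?v\<bar> * \<eta>" by (rule f_lip[OF elim(1) u v])
      also have "\<dots> \<le> 2 * \<delta> * \<eta>" using \<eta> \<delta> t by (intro mult_right_mono) auto
      also have "\<dots> = 1 / 4" by (rule \<delta>)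
      finally have "\<nu> (f n ?u - f n ?v) \<le> 1 / 4" .
      then have 2: "\<nu> (f n ?u - 1) \<le> 1 / 2"
        using triangle[of "f n ?u - f n ?v" "f n ?v - 1"] 1 by simp
      \<comment> \<open>Since x f \<doteq> f - 1 has seminorm at most 1 / 2, writing x = x f - x (f
        - 1) gives \<nu> x \<le> 1 / 2 + \<nu> x / 2.\<close>
      have "\<nu> (x n ?u) \<le> \<nu> (x n ?u * f n ?u) + \<nu> (x n ?u * (f n ?u - 1))"
        using diff_le[of "x n ?u * f n ?u" "x n ?u * (f n ?u - 1)"] by (simp add: right_diff_distrib)
      also have "\<nu> (x n ?u * f n ?u) = \<nu> (f n ?u - 1)" by (rule congr_imp_eq[OF x_f[OF elim(1) u]])
      also have "\<nu> (x n ?u * (f n ?u - 1)) \<le> \<nu> (x n ?u) * (1 / 2)"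
        by (rule order_trans[OF mult mult_left_mono[OF 2 nonneg]])
      finally have "\<nu> (x n ?u) \<le> 1" using 2 by simp
      then show ?case
        using le_x[OF elim(1) u] u s2 mult_left_mono[of "\<nu> (x n ?u)" 1 "?u ^ n"] by (auto intro: order_trans)
    qed
    then show ?thesis unfolding bdd_def using s2 by (intro growth_bound_of_eventually) auto
  qed
  have start: "bdd (max s (\<nu> a))"
  proof -
    have "\<nu> (a ^ n) \<le> 1 * (max s (\<nu> a)) ^ n" for n
    proof (induction n)
      case (Suc n)
      have "\<nu> (a ^ Suc n) \<le> \<nu> a * \<nu> (a ^ n)" using mult by simp
      also have "\<dots> \<le> max s (\<nu> a) * (1 * (max s (\<nu> a)) ^ n)"
        using Suc nonneg s2 by (intro mult_mono) auto
      finally show ?case by simp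
    qed (use one in simp)
    then show ?thesis unfolding bdd_def by blast
  qed
  \<comment> \<open>Finitely many steps of the fixed length \<delta> lead from max s (\<nu> a) down
    to s.\<close>
  have "bdd (max s (\<nu> a - real k * \<delta>))" for k
  proof (induction k)
    case (Suc k)
    have "\<delta> \<le> 1" using M \<eta> s2 by (auto simp: \<delta>_def \<eta>_def field_simps intro!: add_increasing2)
    moreover have "0 \<le> real k * \<delta>" using \<delta> by simp
    ultimately have "max s (\<nu> a - real k * \<delta>) + \<delta> \<le> s2"
      using nonneg[of a] s2 unfolding s2_def by linarith
    then have "bdd (max s (max s (\<nu> a - real k * \<delta>) - \<delta>))"
      using Suc by (intro step) auto
    also have "max s (max s (\<nu> a - real k * \<delta>) - \<delta>) = max s (\<nu> a - real (Suc k) * \<delta>)"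
      using \<delta> by (auto simp: max_def algebra_simps)
    finally show ?case .
  qed (use start in simp)
  moreover obtain k where "\<nu> a - s \<le> real k * \<delta>"
    using \<delta>(1) by (metis reals_Archimedean3 less_imp_le)
  moreover from this have "max s (\<nu> a - real k * \<delta>) = s" by linarith
  ultimately have "bdd s" by metis
  then show ?thesis unfolding bdd_def .
qed

end

section \<open>The ring of bounded operators\<close>

abbreviation op_power :: "('l::real_normed_vector \<Rightarrow>\<^sub>L 'l) \<Rightarrow> nat \<Rightarrow> 'l \<Rightarrow>\<^sub>L 'l" where
  "op_power A n \<equiv> ((o\<^sub>L) A ^^ n) id_blinfun"

lemma blinfun_compose_id [simp]: "A o\<^sub>L id_blinfun = A" "id_blinfun o\<^sub>L A = A"
  by (auto intro: blinfun_eqI)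

lemma blinfun_compose_assoc: "(A o\<^sub>L B) o\<^sub>L C = A o\<^sub>L (B o\<^sub>L C)"
  by (auto intro: blinfun_eqI)

lemma op_power_add: "op_power A (m + n) = op_power A m o\<^sub>L op_power A n"
  by (induction m) (auto simp: blinfun_compose_assoc)

lemma op_power_mult: "op_power A (m * n) = op_power (op_power A m) n"
  by (induction n) (auto simp: op_power_add)

lemma op_power_shift: "op_power (A o\<^sub>L B) n o\<^sub>L A = A o\<^sub>L op_power (B o\<^sub>L A) n"
  by (induction n) (auto simp: blinfun_compose_assoc)

lemma norm_op_power: "norm (op_power A n) \<le> norm A ^ n"
proof (induction n)
  case 0 then show ?case using norm_blinfun_id_le by simp
next
  case (Suc n)
  have "norm (op_power A (Suc n)) \<le> norm A * norm (op_power A n)" by (simp add: norm_blinfun_compose)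
  also have "\<dots> \<le> norm A ^ Suc n" using Suc by (simp add: mult_left_mono)
  finally show ?case .
qed

text \<open>A copy of the bounded operators on which composition is the multiplication, so that the
  algebra above can be instantiated.\<close>

typedef (overloaded) ('l::real_normed_vector) endo = "UNIV :: ('l \<Rightarrow>\<^sub>L 'l) set"
  morphisms op_of endo_of ..

setup_lifting type_definition_endo

text \<open>The class \<open>ring_1\<close> would demand 0 \<noteq> 1, which fails on the zero
  space.\<close>

instantiation endo :: (real_normed_vector) "{ring, monoid_mult}"
begin
lift_definition zero_endo :: "'a endo" is 0 .
lift_definition plus_endo :: "'a endo \<Rightarrow> 'a endo \<Rightarrow> 'a endo" is "(+)" .
lift_definition minus_endo :: "'a endo \<Rightarrow> 'a endo \<Rightarrow> 'a endo" is "(-)" .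
lift_definition uminus_endo :: "'a endo \<Rightarrow> 'a endo" is uminus .
lift_definition times_endo :: "'a endo \<Rightarrow> 'a endo \<Rightarrow> 'a endo" is "(o\<^sub>L)" .
lift_definition one_endo :: "'a endo" is id_blinfun .
instance
  by standard (transfer; auto intro!: blinfun_eqI simp: blinfun.bilinear_simps)+
end

lemma op_of_simps:
  "op_of (x + y) = op_of x + op_of y" "op_of (x - y) = op_of x - op_of y" "op_of (- x) = - op_of x"
  "op_of (x * y) = op_of x o\<^sub>L op_of y" "op_of 1 = id_blinfun" "op_of 0 = 0" "op_of (endo_of A) = A"
  by (transfer; simp)+

lemma endo_of_op_of [simp]: "endo_of (op_of x) = x"
  by (rule op_of_inverse)

lemma op_of_power: "op_of (x ^ n) = op_power (op_of x) n"
  by (induction n) (auto simp: op_of_simps)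

lemma endo_eqI: "(\<And>f. op_of x f = op_of y f) \<Longrightarrow> x = y"
  by (metis blinfun_eqI endo_of_op_of)

section \<open>The measure of noncompactness\<close>

abbreviation \<beta> :: "('l::banach \<Rightarrow>\<^sub>L 'l) \<Rightarrow> real" where "\<beta> \<equiv> hausdorff_noncompactness"

lemma hausdorff_noncompactness_bdd_below:
  "bdd_below {\<delta>. \<delta> > 0 \<and> (\<exists>F. finite F \<and> blinfun_apply A ` cball 0 1 \<subseteq> (\<Union>f\<in>F. cball f \<delta>))}"
  by (rule bdd_belowI[of _ 0]) auto

lemma hausdorff_noncompactness_le:
  fixes A :: "'l::banach \<Rightarrow>\<^sub>L 'l"
  assumes "\<delta> > 0" "finite F" "\<And>x. norm x \<le> 1 \<Longrightarrow> \<exists>f\<in>F. norm (f - A x) \<le> \<delta>"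
  shows "\<beta> A \<le> \<delta>"
  unfolding hausdorff_noncompactness_def
  using assms by (intro cInf_lower hausdorff_noncompactness_bdd_below) (force simp: dist_norm)

lemma hausdorff_noncompactness_nonempty:
  fixes A :: "'l::banach \<Rightarrow>\<^sub>L 'l"
  shows "norm A + 1 \<in> {\<delta>. \<delta> > 0 \<and> (\<exists>F. finite F \<and> blinfun_apply A ` cball 0 1 \<subseteq> (\<Union>f\<in>F. cball f \<delta>))}"
proof -
  have "norm (A x) \<le> norm A + 1" if "norm x \<le> 1" for x
    using norm_blinfun[of A x] mult_left_mono[OF that, of "norm A"] by simp
  then show ?thesis by (auto intro!: exI[of _ "{0}"] add_nonneg_pos)
qed

lemma hausdorff_noncompactness_lessD:
  fixes A :: "'l::banach \<Rightarrow>\<^sub>L 'l"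
  assumes "\<beta> A < \<delta>"
  obtains F where "finite F" "\<And>x. norm x \<le> 1 \<Longrightarrow> \<exists>f\<in>F. norm (f - A x) \<le> \<delta>"
proof -
  obtain \<delta>' F where F: "\<delta>' < \<delta>" "finite F" "A ` cball 0 1 \<subseteq> (\<Union>f\<in>F. cball f \<delta>')"
    using assms hausdorff_noncompactness_nonempty[of A] hausdorff_noncompactness_bdd_below[of A]
    unfolding hausdorff_noncompactness_def by (subst (asm) cInf_less_iff) auto
  have "\<exists>f\<in>F. norm (f - A x) \<le> \<delta>" if "norm x \<le> 1" for x
    using F that by (force simp: dist_norm image_subset_iff)
  with F(2) show ?thesis using that by blast
qed

lemma hausdorff_noncompactness_nonneg: "0 \<le> \<beta> A"
  unfolding hausdorff_noncompactness_def
  using hausdorff_noncompactness_nonempty[of A] by (intro cInf_greatest) auto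

lemma hausdorff_noncompactness_le_norm: "\<beta> A \<le> norm A"
proof (rule field_le_epsilon)
  fix e :: real assume e: "e > 0"
  have "norm (A x) \<le> norm A + e" if "norm x \<le> 1" for x
    using norm_blinfun[of A x] mult_left_mono[OF that, of "norm A"] e by simp
  then show "\<beta> A \<le> norm A + e"
    using e by (intro hausdorff_noncompactness_le[of _ "{0}"]) (auto intro: add_nonneg_pos)
qed

lemma hausdorff_noncompactness_minus: "\<beta> (- A) = \<beta> A"
proof -
  have "\<beta> (- A) \<le> \<beta> A" for A :: "'l::banach \<Rightarrow>\<^sub>L 'l"
  proof (rule dense_ge)
    fix d assume d: "\<beta> A < d"
    then obtain F where F: "finite F" "\<And>x. norm x \<le> 1 \<Longrightarrow> \<exists>f\<in>F. norm (f - A x) \<le> d"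
      using hausdorff_noncompactness_lessD by blast
    have "\<exists>f\<in>uminus ` F. norm (f - (- A) x) \<le> d" if "norm x \<le> 1" for x
      using F(2)[OF that] by (auto simp: blinfun.bilinear_simps norm_minus_commute)
    then show "\<beta> (- A) \<le> d"
      using d F hausdorff_noncompactness_nonneg[of A]
      by (intro hausdorff_noncompactness_le[of _ "uminus ` F"]) auto
  qed
  from this[of A] this[of "- A"] show ?thesis by simp
qed

lemma hausdorff_noncompactness_triangle: "\<beta> (A + B) \<le> \<beta> A + \<beta> B"
proof (rule field_le_epsilon)
  fix e :: real assume e: "e > 0"
  obtain F where F: "finite F" "\<And>x. norm x \<le> 1 \<Longrightarrow> \<exists>f\<in>F. norm (f - A x) \<le> \<beta> A + e / 2"
    using hausdorff_noncompactness_lessD[of A "\<beta> A + e / 2"] e by auto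
  obtain G where G: "finite G" "\<And>x. norm x \<le> 1 \<Longrightarrow> \<exists>f\<in>G. norm (f - B x) \<le> \<beta> B + e / 2"
    using hausdorff_noncompactness_lessD[of B "\<beta> B + e / 2"] e by auto
  have *: "\<exists>h\<in>(\<lambda>(f, g). f + g) ` (F \<times> G). norm (h - (A + B) x) \<le> \<beta> A + \<beta> B + e"
    if x: "norm x \<le> 1" for x
  proof -
    obtain f g where fg: "f \<in> F" "g \<in> G" "norm (f - A x) \<le> \<beta> A + e / 2" "norm (g - B x) \<le> \<beta> B + e / 2"
      using F(2)[OF x] G(2)[OF x] by blast
    have "f + g - (A + B) x = (f - A x) + (g - B x)" by (simp add: blinfun.bilinear_simps)
    then have "norm (f + g - (A + B) x) = norm ((f - A x) + (g - B x))" by (rule arg_cong)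
    also have "\<dots> \<le> \<beta> A + \<beta> B + e"
      using fg norm_triangle_ineq[of "f - A x" "g - B x"] by linarith
    finally have "norm (f + g - (A + B) x) \<le> \<beta> A + \<beta> B + e" .
    then show ?thesis using fg by (intro bexI[of _ "f + g"]) auto
  qed
  show "\<beta> (A + B) \<le> \<beta> A + \<beta> B + e"
    using F(1) G(1) e hausdorff_noncompactness_nonneg[of A] hausdorff_noncompactness_nonneg[of B]
    by (intro hausdorff_noncompactness_le[OF _ _ *]) auto
qed

text \<open>The centres arise in two stages: B x lies near some g, and the error B x - g, rescaled
  to the unit ball, is mapped by A near some f. This leads to the centres A g + (\<beta> B + e)
  f.\<close>

lemma hausdorff_noncompactness_compose: "\<beta> (A o\<^sub>L B) \<le> \<beta> A * \<beta> B"
proof (rule tendsto_lowerbound)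
  show "((\<lambda>e. (\<beta> A + e) * (\<beta> B + e)) \<longlongrightarrow> \<beta> A * \<beta> B) (at_right 0)"
    by (auto intro!: tendsto_eq_intros)
  have "\<beta> (A o\<^sub>L B) \<le> (\<beta> A + e) * (\<beta> B + e)" if e: "e > 0" for e
  proof -
    obtain F where F: "finite F" "\<And>x. norm x \<le> 1 \<Longrightarrow> \<exists>f\<in>F. norm (f - A x) \<le> \<beta> A + e"
      using hausdorff_noncompactness_lessD[of A "\<beta> A + e"] e by auto
    obtain G where G: "finite G" "\<And>x. norm x \<le> 1 \<Longrightarrow> \<exists>f\<in>G. norm (f - B x) \<le> \<beta> B + e"
      using hausdorff_noncompactness_lessD[of B "\<beta> B + e"] e by auto
    have pos: "\<beta> A + e > 0" "\<beta> B + e > 0"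
      using e hausdorff_noncompactness_nonneg[of A] hausdorff_noncompactness_nonneg[of B] by auto
    have *: "\<exists>h\<in>(\<lambda>(f, g). A g + (\<beta> B + e) *\<^sub>R f) ` (F \<times> G). norm (h - (A o\<^sub>L B) x) \<le> (\<beta> A + e) * (\<beta> B + e)"
      if x: "norm x \<le> 1" for x
    proof -
      obtain g where g: "g \<in> G" "norm (g - B x) \<le> \<beta> B + e" using G x by blast
      define y where "y = (1 / (\<beta> B + e)) *\<^sub>R (B x - g)"
      have "norm y \<le> 1" using g pos by (simp add: y_def norm_minus_commute)
      then obtain f where f: "f \<in> F" "norm (f - A y) \<le> \<beta> A + e" using F by blast
      have "(\<beta> B + e) *\<^sub>R A y = A (B x) - A g"
        using pos by (simp add: y_def blinfun.bilinear_simps)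
      then have "A g + (\<beta> B + e) *\<^sub>R f - (A o\<^sub>L B) x = (\<beta> B + e) *\<^sub>R (f - A y)"
        by (simp add: scaleR_diff_right)
      then have "norm (A g + (\<beta> B + e) *\<^sub>R f - (A o\<^sub>L B) x) \<le> (\<beta> A + e) * (\<beta> B + e)"
        using f pos by (simp add: mult.commute)
      then show ?thesis using f g by (intro bexI[of _ "A g + (\<beta> B + e) *\<^sub>R f"]) auto
    qed
    show ?thesis using F(1) G(1) pos by (intro hausdorff_noncompactness_le[OF _ _ *]) auto
  qed
  then show "\<forall>\<^sub>F e in at_right 0. \<beta> (A o\<^sub>L B) \<le> (\<beta> A + e) * (\<beta> B + e)"
    unfolding eventually_at_right_field by (intro exI[of _ 1]) auto
qed simp

text \<open>In a Banach space a closed set is compact iff it is totally bounded. So the compact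
  operators are the null ideal of \<open>\<beta>\<close>, and \<open>congr\<close> becomes equality
  in the Calkin algebra.\<close>

lemma compact_operator_iff: "compact_operator (blinfun_apply K) \<longleftrightarrow> \<beta> K = 0"
proof
  assume "compact_operator (blinfun_apply K)"
  then have c: "compact (closure (K ` cball 0 1))" by (simp add: compact_operator_def)
  have "\<beta> K \<le> 0 + e" if e: "e > 0" for e
  proof -
    obtain F where F: "finite F" "closure (K ` cball 0 1) \<subseteq> (\<Union>x\<in>F. ball x e)"
      using c e unfolding compact_eq_totally_bounded by blast
    have "\<exists>f\<in>F. norm (f - K x) \<le> e" if "norm x \<le> 1" for x
    proof -
      have "K x \<in> closure (K ` cball 0 1)" using that closure_subset by force
      then show ?thesis using F(2) by (force simp: dist_norm)
    qed
    then show ?thesis using F e by (intro hausdorff_noncompactness_le) auto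
  qed
  then have "\<beta> K \<le> 0" by (rule field_le_epsilon)
  then show "\<beta> K = 0" using hausdorff_noncompactness_nonneg[of K] by simp
next
  assume K: "\<beta> K = 0"
  show "compact_operator (blinfun_apply K)"
    unfolding compact_operator_def compact_eq_totally_bounded
  proof (intro conjI allI impI)
    show "complete (closure (K ` cball 0 1))" by (simp add: complete_eq_closed)
    fix e :: real assume e: "e > 0"
    obtain F where F: "finite F" "\<And>x. norm x \<le> 1 \<Longrightarrow> \<exists>f\<in>F. norm (f - K x) \<le> e / 2"
      using hausdorff_noncompactness_lessD[of K "e / 2"] e K by auto
    have "closure (K ` cball 0 1) \<subseteq> (\<Union>x\<in>F. cball x (e / 2))"
      using F by (intro closure_minimal closed_UN) (auto simp: dist_norm)
    also have "\<dots> \<subseteq> (\<Union>x\<in>F. ball x e)" using e by (force simp: dist_norm)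
    finally show "\<exists>k. finite k \<and> closure (K ` cball 0 1) \<subseteq> (\<Union>x\<in>k. ball x e)" using F(1) by blast
  qed
qed

section \<open>The essential spectral radius\<close>

text \<open>The commutation property is what later transfers complex linearity from U to the
  inverse.\<close>

lemma neumann_series:
  fixes U :: "'l::banach endo"
  assumes U: "norm (op_of U) < 1"
  obtains C where "(1 - U) * C = 1" "C * (1 - U) = 1" "\<And>Z. Z * U = U * Z \<Longrightarrow> Z * C = C * Z"
proof -
  let ?S = "\<lambda>n. op_of (U ^ n)"
  have s: "summable ?S"
  proof (rule summable_comparison_test')
    show "summable (\<lambda>n. norm (op_of U) ^ n)" using U by (intro summable_geometric) auto
    show "norm (?S n) \<le> norm (op_of U) ^ n" if "n \<ge> 0" for n by (simp add: op_of_power norm_op_power)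
  qed
  define C where "C = endo_of (suminf ?S)"
  have left: "op_of Z o\<^sub>L op_of C = (\<Sum>n. op_of (Z * U ^ n))" for Z
    using bounded_linear.suminf[OF bounded_bilinear.bounded_linear_right[OF bounded_bilinear_blinfun_compose] s, of "op_of Z"]
    by (simp add: C_def op_of_simps)
  have right: "op_of C o\<^sub>L op_of Z = (\<Sum>n. op_of (U ^ n * Z))" for Z
    using bounded_linear.suminf[OF bounded_bilinear.bounded_linear_left[OF bounded_bilinear_blinfun_compose] s, of "op_of Z"]
    by (simp add: C_def op_of_simps)
  have shift: "(\<Sum>n. op_of (U ^ Suc n)) = op_of C - id_blinfun"
    using suminf_split_head[OF s] by (simp add: C_def op_of_simps)
  have "op_of (U * C) = op_of (C - 1)" using left[of U] shift by (simp add: op_of_simps)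
  then have 1: "U * C = C - 1" by (metis endo_of_op_of)
  have "op_of (C * U) = op_of (C - 1)" using right[of U] shift by (simp add: op_of_simps power_Suc2 del: power_Suc)
  then have 2: "C * U = C - 1" by (metis endo_of_op_of)
  have "Z * C = C * Z" if Z: "Z * U = U * Z" for Z
  proof -
    have "Z * U ^ n = U ^ n * Z" for n
      by (induction n) (auto simp: Z, metis Z mult.assoc)
    then have "op_of (Z * C) = op_of (C * Z)" using left[of Z] right[of Z] by (simp add: op_of_simps)
    then show ?thesis by (metis endo_of_op_of)
  qed
  then show ?thesis using that[of C] 1 2 by (simp add: left_diff_distrib right_diff_distrib)
qed

context banach_function_space begin

lemma rep_eqI: "AE x in M. rep f x = g x \<Longrightarrow> AE x in M. rep f' x = g x \<Longrightarrow> f = f'"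
  by (rule rep_inject) auto

lemma cscale_eqI: "AE x in M. rep g x = z * rep f x \<Longrightarrow> cscale M rep z f = g"
  by (rule rep_eqI[OF ae_rep_cscale])

lemma bounded_linear_cscale: "bounded_linear (cscale M rep z)"
proof (rule bounded_linear_intro)
  fix f g
  show "cscale M rep z (f + g) = cscale M rep z f + cscale M rep z g"
    by (rule cscale_eqI) (use rep_add[of "cscale M rep z f" "cscale M rep z g"] rep_add[of f g]
      ae_rep_cscale[of z f] ae_rep_cscale[of z g] in eventually_elim, simp add: algebra_simps)
  show "cscale M rep z (r *\<^sub>R f) = r *\<^sub>R cscale M rep z f" for r
    by (rule cscale_eqI) (use rep_scaleR[of r "cscale M rep z f"] rep_scaleR[of r f]
      ae_rep_cscale[of z f] in eventually_elim, simp add: algebra_simps)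
  show "norm (cscale M rep z f) \<le> norm f * cmod z" by (simp add: norm_cscale)
qed

definition scalar :: "complex \<Rightarrow> 'l endo" where "scalar z = endo_of (Blinfun (cscale M rep z))"

lemma op_of_scalar: "op_of (scalar z) f = cscale M rep z f"
  by (simp add: scalar_def op_of_simps bounded_linear_Blinfun_apply bounded_linear_cscale)

lemma norm_scalar_le: "norm (op_of (scalar z)) \<le> cmod z"
  by (rule norm_blinfun_bound) (auto simp: op_of_scalar norm_cscale)

sublocale calkin: seminormed_algebra "\<lambda>x. \<beta> (op_of x)" scalar
proof
  show "\<beta> (op_of 1) \<le> 1"
    unfolding op_of_simps by (rule order_trans[OF hausdorff_noncompactness_le_norm norm_blinfun_id_le])
  show "\<beta> (op_of (scalar z * x)) \<le> cmod z * \<beta> (op_of x)" for z x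
    using hausdorff_noncompactness_compose[of "op_of (scalar z)" "op_of x"]
      hausdorff_noncompactness_le_norm[of "op_of (scalar z)"] norm_scalar_le[of z] hausdorff_noncompactness_nonneg[of "op_of x"]
    by (simp add: op_of_simps) (meson mult_right_mono order_trans)
  show "scalar (z + w) = scalar z + scalar w" for z w
  proof (rule endo_eqI)
    fix f
    show "op_of (scalar (z + w)) f = op_of (scalar z + scalar w) f"
      unfolding op_of_simps op_of_scalar blinfun.bilinear_simps
      by (rule cscale_eqI) (use rep_add[of "cscale M rep z f" "cscale M rep w f"]
        ae_rep_cscale[of z f] ae_rep_cscale[of w f] in eventually_elim, simp add: algebra_simps)
  qed
  show "scalar (z * w) = scalar z * scalar w" for z w
  proof (rule endo_eqI)
    fix f
    show "op_of (scalar (z * w)) f = op_of (scalar z * scalar w) f"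
      unfolding op_of_simps op_of_scalar blinfun_apply_blinfun_compose
      by (rule cscale_eqI) (use ae_rep_cscale[of z "cscale M rep w f"] ae_rep_cscale[of w f]
        in eventually_elim, simp)
  qed
  show "scalar 1 = 1"
    by (rule endo_eqI) (simp add: op_of_simps op_of_scalar cscale_eqI)
qed (simp_all add: op_of_simps hausdorff_noncompactness_nonneg hausdorff_noncompactness_triangle
  hausdorff_noncompactness_minus hausdorff_noncompactness_compose)

lemma commuting_iff: "calkin.commuting x \<longleftrightarrow> complex_linear M rep (op_of x)"
proof -
  have "scalar z * x = x * scalar z \<longleftrightarrow> (\<forall>f. op_of x (cscale M rep z f) = cscale M rep z (op_of x f))" for z
    by (metis (no_types, lifting) blinfun_apply_blinfun_compose endo_eqI op_of_scalar op_of_simps(4))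
  then show ?thesis unfolding calkin.commuting_def complex_linear_def by auto
qed

text \<open>Moves the spectrum into the ring \<open>endo\<close>, where complex linearity is
  \<open>commuting\<close> and equality modulo compact operators is \<open>congr\<close>.\<close>

lemma not_in_ess_spectrum_iff:
  "z \<notin> ess_spectrum M rep A \<longleftrightarrow> (\<exists>b. calkin.commuting b \<and>
     calkin.congr ((scalar z - endo_of A) * b) 1 \<and> calkin.congr (b * (scalar z - endo_of A)) 1)"
proof -
  have 1: "calkin.congr (endo_of B * (scalar z - endo_of A)) 1 \<longleftrightarrow>
      compact_operator (\<lambda>f. B (cscale M rep z f - A f) - f)" for B
    unfolding calkin.congr_def compact_operator_iff[symmetric]
    by (rule arg_cong[where f = compact_operator])
      (simp add: fun_eq_iff op_of_simps blinfun.bilinear_simps op_of_scalar)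
  have 2: "calkin.congr ((scalar z - endo_of A) * endo_of B) 1 \<longleftrightarrow>
      compact_operator (\<lambda>f. cscale M rep z (B f) - A (B f) - f)" for B
    unfolding calkin.congr_def compact_operator_iff[symmetric]
    by (rule arg_cong[where f = compact_operator])
      (simp add: fun_eq_iff op_of_simps blinfun.bilinear_simps op_of_scalar)
  have "(\<exists>b. P b) \<longleftrightarrow> (\<exists>B. P (endo_of B))" for P :: "'l endo \<Rightarrow> bool" by (metis endo_of_op_of)
  then show ?thesis
    unfolding ess_spectrum_def by (auto simp: 1 2 commuting_iff op_of_simps)
qed

text \<open>Completeness of the operator norm admits a Neumann series: z ^ n - (A ^ n - K) is
  invertible exactly, and \<open>inverse_mod_of_power\<close> descends from the n-th power to z -
  A.\<close>

lemma not_in_ess_spectrum: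
  assumes A: "complex_linear M rep A" and K: "complex_linear M rep K" "\<beta> K = 0"
    and less: "norm (op_power A n - K) < cmod z ^ n"
  shows "z \<notin> ess_spectrum M rep A"
proof -
  let ?a = "endo_of A" and ?k = "endo_of K"
  have cA: "calkin.commuting ?a" and cK: "calkin.commuting ?k"
    using A K by (auto simp: commuting_iff op_of_simps)
  have z: "z ^ n \<noteq> 0"
  proof
    assume "z ^ n = 0"
    then have "cmod z ^ n = 0" by (metis norm_power norm_zero)
    with less norm_ge_zero[of "op_power A n - K"] show False by linarith
  qed
  define W where "W = ?a ^ n - ?k"
  have cW: "calkin.commuting W"
    unfolding W_def by (intro calkin.commuting_diff calkin.commuting_power cA cK)
  have nW: "norm (op_of W) < cmod z ^ n" using less by (simp add: W_def op_of_simps op_of_power)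
  let ?i = "scalar (1 / z ^ n)"
  have "1 / z ^ n * z ^ n = 1" "z ^ n * (1 / z ^ n) = 1" using z by (simp_all del: power_eq_0_iff)
  then have inv: "?i * scalar (z ^ n) = 1" "scalar (z ^ n) * ?i = 1"
    by (metis calkin.scalar_mult calkin.scalar_one)+
  have "norm (op_of (?i * W)) \<le> norm (op_of ?i) * norm (op_of W)"
    by (simp add: op_of_simps norm_blinfun_compose)
  also have "\<dots> \<le> cmod (1 / z ^ n) * norm (op_of W)" by (intro mult_right_mono norm_scalar_le) auto
  also have "\<dots> = norm (op_of W) / cmod z ^ n" by (simp add: norm_divide norm_power)
  also have "\<dots> < 1" using nW le_less_trans[OF norm_ge_zero nW] by (subst divide_less_eq_1_pos)
  finally obtain C where C: "(1 - ?i * W) * C = 1" "C * (1 - ?i * W) = 1"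
    "\<And>Z. Z * (?i * W) = ?i * W * Z \<Longrightarrow> Z * C = C * Z" by (rule neumann_series) auto
  have cC: "calkin.commuting C"
    unfolding calkin.commuting_def
    using calkin.commuting_mult[OF calkin.commuting_scalar cW] by (auto intro!: C(3) simp: calkin.commuting_def)
  have e: "scalar (z ^ n) - W = scalar (z ^ n) * (1 - ?i * W)"
    by (simp add: right_diff_distrib inv flip: mult.assoc)
  have e': "scalar (z ^ n) - W = (1 - ?i * W) * scalar (z ^ n)"
    using calkin.commuting_diff[OF calkin.commuting_one calkin.commuting_mult[OF calkin.commuting_scalar cW]] e
    by (metis calkin.commuting_def)
  show ?thesis
    unfolding not_in_ess_spectrum_iff
  proof (rule calkin.inverse_mod_of_power[OF cA, of "C * ?i" ?k z n])
    show "calkin.commuting (C * ?i)" by (intro calkin.commuting_mult cC calkin.commuting_scalar)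
    have "(scalar (z ^ n) - W) * (C * ?i) = scalar (z ^ n) * ((1 - ?i * W) * C) * ?i"
      unfolding e by (simp only: mult.assoc)
    then show "(scalar (z ^ n) - (?a ^ n - ?k)) * (C * ?i) = 1"
      unfolding W_def[symmetric] C(1) by (simp add: inv)
    have "(C * ?i) * (scalar (z ^ n) - W) = (C * (?i * scalar (z ^ n))) * (1 - ?i * W)"
      unfolding e by (simp only: mult.assoc)
    then show "(C * ?i) * (scalar (z ^ n) - (?a ^ n - ?k)) = 1"
      unfolding W_def[symmetric] inv(1) by (simp add: C(2))
  qed (use K in \<open>simp add: op_of_simps\<close>)
qed

lemma ess_spectrum_le_norm:
  assumes A: "complex_linear M rep A" and z: "z \<in> ess_spectrum M rep A"
  shows "cmod z \<le> norm A"
proof (rule ccontr)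
  assume "\<not> cmod z \<le> norm A"
  then have "z \<notin> ess_spectrum M rep A"
    using calkin.zero commuting_iff[of 0] calkin.commuting_zero
    by (intro not_in_ess_spectrum[OF A, of 0 1]) (auto simp: op_of_simps)
  with z show False by simp
qed

lemma ess_spectral_radius_nonneg:
  assumes "complex_linear M rep A"
  shows "0 \<le> ess_spectral_radius M rep A"
  unfolding ess_spectral_radius_def
  using ess_spectrum_le_norm[OF assms] by (intro cSup_upper bdd_aboveI[of _ "norm A"]) auto

lemma ess_spectral_radius_le:
  assumes "0 \<le> s" "\<And>z. z \<in> ess_spectrum M rep A \<Longrightarrow> cmod z \<le> s"
  shows "ess_spectral_radius M rep A \<le> s"
  unfolding ess_spectral_radius_def using assms by (intro cSup_least) auto

lemma ess_spectral_radius_le_norm: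
  assumes "complex_linear M rep A"
  shows "ess_spectral_radius M rep A \<le> norm A"
  using ess_spectrum_le_norm[OF assms] by (intro ess_spectral_radius_le) auto

text \<open>One half of Gelfand's formula in the Calkin algebra; the converse for positive kernel
  operators is \<open>ess_spectral_radius_le_of_power_bound\<close>.\<close>

lemma hausdorff_noncompactness_power_bound:
  assumes A: "complex_linear M rep A" and s: "ess_spectral_radius M rep A < s"
  shows "\<exists>C. \<forall>n. \<beta> (op_power A n) \<le> C * s ^ n"
proof -
  have "\<exists>C. \<forall>n. \<beta> (op_of (endo_of A ^ n)) \<le> C * s ^ n"
  proof (rule calkin.power_bound_of_resolvent[OF _ ess_spectral_radius_nonneg[OF A] s])
    show "calkin.commuting (endo_of A)" using A by (simp add: commuting_iff op_of_simps)
    fix z assume z: "ess_spectral_radius M rep A < cmod z"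
    have "z \<notin> ess_spectrum M rep A"
    proof
      assume "z \<in> ess_spectrum M rep A"
      then have "cmod z \<le> ess_spectral_radius M rep A"
        unfolding ess_spectral_radius_def using ess_spectrum_le_norm[OF A]
        by (intro cSup_upper bdd_aboveI[of _ "norm A"]) auto
      with z show False by simp
    qed
    then show "\<exists>b. calkin.commuting b \<and> calkin.congr ((scalar z - endo_of A) * b) 1 \<and> calkin.congr (b * (scalar z - endo_of A)) 1"
      by (simp add: not_in_ess_spectrum_iff)
  qed
  then show ?thesis by (simp add: op_of_power op_of_simps)
qed

end

section \<open>Sublinear functionals\<close>

definition sublinear :: "('v::real_vector \<Rightarrow> real) \<Rightarrow> bool" where
  "sublinear p \<longleftrightarrow> (\<forall>x y. p (x + y) \<le> p x + p y) \<and> (\<forall>c>0. \<forall>x. p (c *\<^sub>R x) \<le> c * p x)"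

lemma sublinearD:
  assumes "sublinear p"
  shows "p (x + y) \<le> p x + p y" "0 \<le> c \<Longrightarrow> p (c *\<^sub>R x) = c * p x" "p 0 = 0" "- p (- x) \<le> p x"
proof -
  show add: "p (x + y) \<le> p x + p y" for x y using assms by (simp add: sublinear_def)
  have le: "p (c *\<^sub>R x) \<le> c * p x" if "c > 0" for c x using assms that by (simp add: sublinear_def)
  show zero: "p 0 = 0" using add[of 0 0] le[of "1/2" 0] by simp
  show "p (c *\<^sub>R x) = c * p x" if "0 \<le> c"
  proof (cases "c = 0")
    case False
    then have "c > 0" using that by simp
    then show ?thesis using le[of c x] le[of "1 / c" "c *\<^sub>R x"] by (simp add: field_simps)
  qed (simp add: zero)
  show "- p (- x) \<le> p x" using add[of x "- x"] zero by simp
qed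

text \<open>A sublinear functional below p that is pushed down along - y: t = 1 gives tilt p y (- y)
  \<le> - p y. A linear minorant of it therefore agrees with p at y.\<close>

definition tilt :: "('v::real_vector \<Rightarrow> real) \<Rightarrow> 'v \<Rightarrow> 'v \<Rightarrow> real" where
  "tilt p y x = (INF t\<in>{0..}. p (x + t *\<^sub>R y) - t * p y)"

lemma tilt_le:
  assumes p: "sublinear p" and t: "t \<ge> 0"
  shows "tilt p y x \<le> p (x + t *\<^sub>R y) - t * p y"
proof -
  have "- p (- x) \<le> p (x + t *\<^sub>R y) - t * p y" if "t \<ge> 0" for t
    using sublinearD(1)[OF p, of "x + t *\<^sub>R y" "- x"] sublinearD(2)[OF p that, of y] by simp
  then show ?thesis
    unfolding tilt_def using t by (intro cINF_lower bdd_belowI[of _ "- p (- x)"]) auto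
qed

lemma tilt_greatest: "(\<And>t. t \<ge> 0 \<Longrightarrow> z \<le> p (x + t *\<^sub>R y) - t * p y) \<Longrightarrow> z \<le> tilt p y x"
  unfolding tilt_def by (intro cINF_greatest) auto

lemma sublinear_tilt:
  assumes p: "sublinear p"
  shows "sublinear (tilt p y)"
  unfolding sublinear_def
proof (intro conjI allI impI)
  fix x x'
  have *: "tilt p y (x + x') \<le> (p (x + t *\<^sub>R y) - t * p y) + (p (x' + t' *\<^sub>R y) - t' * p y)"
    if "t \<ge> 0" "t' \<ge> 0" for t t'
  proof -
    have "tilt p y (x + x') \<le> p (x + x' + (t + t') *\<^sub>R y) - (t + t') * p y"
      using that by (intro tilt_le p) auto
    also have "p (x + x' + (t + t') *\<^sub>R y) \<le> p (x + t *\<^sub>R y) + p (x' + t' *\<^sub>R y)"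
      using sublinearD(1)[OF p, of "x + t *\<^sub>R y" "x' + t' *\<^sub>R y"] by (simp add: algebra_simps)
    finally show ?thesis by (simp add: algebra_simps)
  qed
  have **: "tilt p y (x + x') - (p (x + t *\<^sub>R y) - t * p y) \<le> tilt p y x'" if "t \<ge> 0" for t
  proof (rule tilt_greatest)
    show "tilt p y (x + x') - (p (x + t *\<^sub>R y) - t * p y) \<le> p (x' + t' *\<^sub>R y) - t' * p y"
      if "t' \<ge> 0" for t' using *[OF \<open>t \<ge> 0\<close> that] by linarith
  qed
  have "tilt p y (x + x') - tilt p y x' \<le> tilt p y x"
  proof (rule tilt_greatest)
    show "tilt p y (x + x') - tilt p y x' \<le> p (x + t *\<^sub>R y) - t * p y" if "t \<ge> 0" for t
      using **[OF that] by linarith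
  qed
  then show "tilt p y (x + x') \<le> tilt p y x + tilt p y x'" by simp
next
  fix c :: real and x assume c: "c > 0"
  have "tilt p y (c *\<^sub>R x) / c \<le> p (x + t *\<^sub>R y) - t * p y" if "t \<ge> 0" for t
  proof -
    have "tilt p y (c *\<^sub>R x) \<le> p (c *\<^sub>R x + (c * t) *\<^sub>R y) - (c * t) * p y"
      using that c by (intro tilt_le p) auto
    also have "p (c *\<^sub>R x + (c * t) *\<^sub>R y) = c * p (x + t *\<^sub>R y)"
      using sublinearD(2)[OF p, of c "x + t *\<^sub>R y"] c by (simp add: algebra_simps)
    finally show ?thesis using c by (simp add: field_simps)
  qed
  then have "tilt p y (c *\<^sub>R x) / c \<le> tilt p y x" by (rule tilt_greatest)
  then show "tilt p y (c *\<^sub>R x) \<le> c * tilt p y x" using c by (simp add: field_simps)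
qed

text \<open>Subadditivity of the infimum uses the chain: in q x + q' y the smaller of q and q'
  bounds both terms from below. The lower bound - p (- x) keeps the infimum finite.\<close>

lemma sublinear_chain_Inf:
  assumes C: "C \<noteq> {}" "\<And>q. q \<in> C \<Longrightarrow> sublinear q \<and> q \<le> p" "\<And>q q'. q \<in> C \<Longrightarrow> q' \<in> C \<Longrightarrow> q \<le> q' \<or> q' \<le> q"
  shows "sublinear (\<lambda>x. INF q\<in>C. q x)" "\<And>q x. q \<in> C \<Longrightarrow> (INF q\<in>C. q x) \<le> q x"
proof -
  have "- p (- x) \<le> q x" if "q \<in> C" for q x
    using C(2)[OF that] sublinearD(4)[of q x] by (auto simp: le_fun_def) (meson neg_le_iff_le order_trans)
  then have bdd: "bdd_below ((\<lambda>q. q x) ` C)" for x by (intro bdd_belowI[of _ "- p (- x)"]) auto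
  show lower: "(INF q\<in>C. q x) \<le> q x" if "q \<in> C" for q x by (intro cINF_lower bdd that)
  show "sublinear (\<lambda>x. INF q\<in>C. q x)"
    unfolding sublinear_def
  proof (intro conjI allI impI)
    fix x y
    have ***: "(INF q\<in>C. q (x + y)) \<le> q x + q' y" if q: "q \<in> C" "q' \<in> C" for q q'
    proof -
      have *: "(INF q\<in>C. q (x + y)) \<le> q'' x + q'' y" if "q'' \<in> C" for q''
        using lower[OF that, of "x + y"] C(2)[OF that] sublinearD(1)[of q'' x y] by simp
      show ?thesis
        using C(3)[OF q] *[OF q(1)] *[OF q(2)] by (auto simp: le_fun_def) (meson add_left_mono add_right_mono order_trans)+
    qed
    have **: "(INF q\<in>C. q (x + y)) - q x \<le> (INF q\<in>C. q y)" if "q \<in> C" for q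
    proof (rule cINF_greatest[OF C(1)])
      show "(INF q\<in>C. q (x + y)) - q x \<le> q' y" if "q' \<in> C" for q'
        using ***[OF \<open>q \<in> C\<close> that] by linarith
    qed
    have "(INF q\<in>C. q (x + y)) - (INF q\<in>C. q y) \<le> (INF q\<in>C. q x)"
    proof (rule cINF_greatest[OF C(1)])
      show "(INF q\<in>C. q (x + y)) - (INF q\<in>C. q y) \<le> q x" if "q \<in> C" for q
        using **[OF that] by linarith
    qed
    then show "(INF q\<in>C. q (x + y)) \<le> (INF q\<in>C. q x) + (INF q\<in>C. q y)" by simp
  next
    fix c :: real and x assume c: "c > 0"
    have "(INF q\<in>C. q (c *\<^sub>R x)) / c \<le> q x" if "q \<in> C" for q
      using lower[OF that, of "c *\<^sub>R x"] C(2)[OF that] sublinearD(2)[of q c x] c by (simp add: field_simps)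
    then have "(INF q\<in>C. q (c *\<^sub>R x)) / c \<le> (INF q\<in>C. q x)" using C(1) by (intro cINF_greatest)
    then show "(INF q\<in>C. q (c *\<^sub>R x)) \<le> c * (INF q\<in>C. q x)" using c by (simp add: field_simps)
  qed
qed

text \<open>
  Hahn--Banach: a minimal sublinear functional \<open>q\<close> satisfies \<open>q = tilt q y\<close> for every \<open>y\<close>, which gives
  \<open>q x \<le> q (x + y) - q y\<close>.
\<close>

lemma ex_linear_minorant:
  fixes p :: "'v::real_vector \<Rightarrow> real"
  assumes p: "sublinear p"
  obtains \<phi> where "linear \<phi>" "\<And>x. \<phi> x \<le> p x" "\<phi> u = p u"
proof -
  \<comment> \<open>Starting below \<open>tilt p u\<close> instead of p forces the value p u at
    u.\<close>
  let ?p = "tilt p u"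
  define A where "A = {q. sublinear q \<and> q \<le> ?p}"
  let ?P = "\<lambda>q q' :: 'v \<Rightarrow> real. q' \<le> q"
  have "\<exists>m\<in>A. \<forall>a\<in>A. ?P m a \<longrightarrow> a = m"
  proof (rule predicate_Zorn)
    show "partial_order_on A (relation_of ?P A)"
      by (rule partial_order_on_relation_ofI) auto
    fix C assume C: "C \<in> Chains (relation_of ?P A)"
    show "\<exists>u\<in>A. \<forall>a\<in>C. u \<le> a"
    proof (cases "C = {}")
      case True
      then show ?thesis using sublinear_tilt[OF p, of u] by (auto simp: A_def)
    next
      case False
      have CA: "q \<in> A" if "q \<in> C" for q
        using C that unfolding Chains_def relation_of_def by blast
      have chain: "q \<le> q' \<or> q' \<le> q" if "q \<in> C" "q' \<in> C" for q q'
        using C that unfolding Chains_def relation_of_def by blast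
      note inf = sublinear_chain_Inf[OF False _ chain, of ?p]
      have "sublinear (\<lambda>x. INF q\<in>C. q x)" using inf(1) CA by (auto simp: A_def)
      moreover have lower: "(\<lambda>x. INF q\<in>C. q x) \<le> q" if "q \<in> C" for q
        using inf(2) CA that by (auto simp: A_def le_fun_def)
      moreover obtain q where "q \<in> C" using False by blast
      ultimately show ?thesis using CA[of q] unfolding A_def by (blast intro: order_trans)
    qed
  qed
  then obtain q where q: "sublinear q" "q \<le> ?p" and min: "\<And>q'. sublinear q' \<Longrightarrow> q' \<le> ?p \<Longrightarrow> q' \<le> q \<Longrightarrow> q' = q"
    unfolding A_def by blast
  have add: "q (x + y) = q x + q y" for x y
  proof -
    have "tilt q y \<le> q" using tilt_le[OF q(1), of 0] by (auto simp: le_fun_def)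
    then have "tilt q y = q" using q by (intro min sublinear_tilt) auto
    then have "q x \<le> q (x + y) - q y" using tilt_le[OF q(1), of 1 y x] by simp
    then show ?thesis using sublinearD(1)[OF q(1), of x y] by simp
  qed
  have minus: "q (- x) = - q x" for x using add[of x "- x"] sublinearD(3)[OF q(1)] by simp
  have "q (c *\<^sub>R x) = c *\<^sub>R q x" for c x
    using sublinearD(2)[OF q(1), of c x] sublinearD(2)[OF q(1), of "- c" x] minus[of "c *\<^sub>R x"]
    by (cases "c \<ge> 0") auto
  then have "linear q" using add by (intro linearI) auto
  moreover have le: "q x \<le> p x" for x
    using q(2) tilt_le[OF p, of 0 u x] by (auto simp: le_fun_def intro: order_trans)
  moreover have "q u = p u"
  proof -
    have "q (- u) \<le> ?p (- u)" using q(2) by (simp add: le_fun_def)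
    also have "\<dots> \<le> - p u" using tilt_le[OF p, of 1 u "- u"] sublinearD(3)[OF p] by simp
    finally show ?thesis using minus[of u] le[of u] by simp
  qed
  ultimately show ?thesis using that by blast
qed

section \<open>Order structure of a Banach function space\<close>

text \<open>A supremum argument for a finite measure equivalent to M: a countable union of sets of
  nearly maximal measure is maximal up to null sets.\<close>

lemma (in sigma_finite_measure) exhaustion:
  assumes S: "\<S> \<subseteq> sets M" "\<S> \<noteq> {}" and UN: "\<And>A. range A \<subseteq> \<S> \<Longrightarrow> (\<Union>n::nat. A n) \<in> \<S>"
  obtains E where "E \<in> \<S>" "\<And>F. F \<in> \<S> \<Longrightarrow> F - E \<in> null_sets M"
proof -
  obtain h :: "'a \<Rightarrow> real" where h [measurable]: "h \<in> borel_measurable M" "\<And>x. h x > 0" "integrable M h"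
    using obtain_positive_integrable_function by metis
  define N where "N = density M h"
  interpret N: finite_measure N
    using h by (intro finite_measureI) (auto simp: N_def emeasure_density nn_integral_eq_integral less_imp_le
      cong: nn_integral_cong_simp)
  have sets_N [simp]: "sets N = sets M" by (simp add: N_def)
  let ?s = "SUP A\<in>\<S>. measure N A"
  have bdd: "bdd_above (measure N ` \<S>)" by (intro bdd_aboveI[of _ "measure N (space N)"]) (auto intro: N.bounded_measure)
  have "\<exists>A\<in>\<S>. ?s - 1 / Suc n < measure N A" for n
  proof (rule ccontr)
    assume "\<not> ?thesis"
    then have "?s \<le> ?s - 1 / Suc n" using S by (intro cSUP_least) (auto simp: not_less)
    then show False by (simp add: field_simps)
  qed
  then obtain A where A: "\<And>n. A n \<in> \<S>" "\<And>n. ?s - 1 / Suc n < measure N (A n)" by metis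
  define E where "E = (\<Union>n. A n)"
  have E: "E \<in> \<S>" unfolding E_def using A by (intro UN) auto
  have "F - E \<in> null_sets M" if F: "F \<in> \<S>" for F
  proof -
    have [measurable]: "F \<in> sets M" "E \<in> sets M" using F E S by auto
    have "F \<union> E = (\<Union>n::nat. if n = 0 then F else E)" by (auto split: if_splits)
    also have "\<dots> \<in> \<S>" using F E by (intro UN) auto
    finally have "measure N (F \<union> E) \<le> ?s" by (intro cSUP_upper bdd)
    also have "?s \<le> measure N E"
    proof (rule LIMSEQ_le_const2)
      show "(\<lambda>n. ?s - 1 / Suc n) \<longlonglongrightarrow> ?s" using tendsto_diff[OF tendsto_const LIMSEQ_inverse_real_of_nat] by (simp add: inverse_eq_divide)
      have "?s - 1 / Suc n \<le> measure N E" for n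
        using less_imp_le[OF A(2)[of n]] N.finite_measure_mono[of "A n" E] \<open>E \<in> sets M\<close>
        by (auto simp: E_def intro: order_trans)
      then show "\<exists>N'. \<forall>n\<ge>N'. ?s - 1 / Suc n \<le> measure N E" by blast
    qed
    finally have "measure N (F - E) \<le> 0"
      using N.finite_measure_Union[of "F - E" E] by (simp add: Un_commute Int_commute[of "F - E"])
    then have "emeasure N (F - E) = 0"
      by (simp add: N.emeasure_eq_measure measure_le_0_iff)
    then have "AE x in M. ennreal (h x) * indicator (F - E) x = 0"
      unfolding N_def by (subst (asm) emeasure_density) (auto simp: nn_integral_0_iff_AE)
    then have "AE x in M. x \<notin> F - E"
    proof eventually_elim
      case (elim x)
      then show ?case using h(2)[of x] by (auto simp: indicator_def ennreal_eq_0_iff split: if_splits)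
    qed
    then show ?thesis by (subst AE_iff_null_sets) auto
  qed
  with E show ?thesis using that by blast
qed

context banach_function_space begin

section \<open>Moduli, restrictions and pointwise bounds\<close>

declare rep_measurable [measurable]

text \<open>Realizes a function as an element of L. It is meaningful once the function is dominated
  by such an element, which is how solidity enters.\<close>

definition emb :: "('a \<Rightarrow> complex) \<Rightarrow> 'l" where "emb g = (SOME h. AE x in M. rep h x = g x)"

lemma rep_emb:
  assumes "g \<in> borel_measurable M" "AE x in M. cmod (g x) \<le> cmod (rep f x)"
  shows "AE x in M. rep (emb g) x = g x"
  unfolding emb_def by (rule someI_ex) (use solid[OF assms] in blast)

lemma rep_zero: "AE x in M. rep 0 x = 0"
  using rep_scaleR[of 0 0] by simp

lemma rep_minus: "AE x in M. rep (- f) x = - rep f x"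
  using rep_scaleR[of "-1" f] by simp

lemma rep_diff: "AE x in M. rep (f - g) x = rep f x - rep g x"
  using rep_add[of f "- g"] rep_minus[of g] by eventually_elim simp

lemma rep_sum: "AE x in M. rep (sum F I) x = (\<Sum>i\<in>I. rep (F i) x)"
proof (induction I rule: infinite_finite_induct)
  case (insert i I)
  then show ?case using rep_add[of "F i" "sum F I"] by (auto elim: AE_mp)
qed (use rep_zero in auto)

lemma eq_zero_iff: "f = 0 \<longleftrightarrow> (AE x in M. rep f x = 0)"
proof
  assume f: "AE x in M. rep f x = 0"
  show "f = 0" by (rule rep_inject) (use rep_zero f in eventually_elim, simp)
qed (use rep_zero in simp)

definition modulus :: "'l \<Rightarrow> 'l" where "modulus f = emb (\<lambda>x. of_real (cmod (rep f x)))"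

lemma rep_modulus: "AE x in M. rep (modulus f) x = of_real (cmod (rep f x))"
  unfolding modulus_def by (rule rep_emb[where f = f]) auto

lemma norm_modulus [simp]: "norm (modulus f) = norm f"
  by (intro antisym norm_le; use rep_modulus[of f] in eventually_elim) auto

lemma nonneg_Reals_iff_cmod: "z \<in> \<real>\<^sub>\<ge>\<^sub>0 \<longleftrightarrow> z = of_real (cmod z)"
  by (metis norm_ge_zero norm_of_real nonneg_Reals_cases nonneg_Reals_of_real_iff abs_of_nonneg)

lemma nonneg_iff: "f \<in> fun_nonneg M rep \<longleftrightarrow> (AE x in M. rep f x = of_real (cmod (rep f x)))"
  by (simp add: fun_nonneg_def nonneg_Reals_iff_cmod)

lemma modulus_nonneg: "modulus f \<in> fun_nonneg M rep"
  unfolding nonneg_iff using rep_modulus[of f] by eventually_elim simp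

definition restr :: "'a set \<Rightarrow> 'l \<Rightarrow> 'l" where "restr E f = emb (\<lambda>x. indicator E x * rep f x)"

lemma rep_restr: "E \<in> sets M \<Longrightarrow> AE x in M. rep (restr E f) x = indicator E x * rep f x"
  unfolding restr_def by (rule rep_emb[where f = f]) (auto simp: norm_mult indicator_def)

text \<open>The deficit max 0 (v - Re f) is eventually dominated by F k - f, so its norm is 0. Norm
  limits thus preserve lower bounds without passing to an a.e. convergent subsequence.\<close>

lemma lower_bound_tendsto:
  assumes F: "F \<longlonglongrightarrow> f" and [measurable]: "v \<in> borel_measurable M"
    and le: "\<forall>\<^sub>F k in sequentially. AE x in M. v x \<le> Re (rep (F k) x)"
  shows "AE x in M. v x \<le> Re (rep f x)"
proof -
  define n where "n x = complex_of_real (max 0 (v x - Re (rep f x)))" for x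
  have [measurable]: "n \<in> borel_measurable M" unfolding n_def by measurable
  have n_le: "AE x in M. cmod (n x) \<le> cmod (rep (F k - f) x)" if "AE x in M. v x \<le> Re (rep (F k) x)" for k
    using that rep_diff[of "F k" f]
  proof eventually_elim
    case (elim x)
    have "Re (rep (F k - f) x) \<le> cmod (rep (F k - f) x)" by (rule complex_Re_le_cmod)
    then show ?case using elim by (auto simp: n_def)
  qed
  obtain k where "AE x in M. v x \<le> Re (rep (F k) x)" using le by (auto simp: eventually_sequentially)
  then have rep_n: "AE x in M. rep (emb n) x = n x" by (intro rep_emb[OF _ n_le]) auto
  have "norm (emb n) \<le> 0"
  proof (rule tendsto_lowerbound)
    show "(\<lambda>k. norm (F k - f)) \<longlonglongrightarrow> 0" using F by (simp add: LIM_zero_iff tendsto_norm_zero)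
    show "\<forall>\<^sub>F k in sequentially. norm (emb n) \<le> norm (F k - f)"
      using le
    proof eventually_elim
      case (elim k)
      show ?case by (rule norm_le) (use rep_n n_le[OF elim] in eventually_elim, simp)
    qed
  qed simp
  then have "AE x in M. rep (emb n) x = 0" by (simp flip: eq_zero_iff)
  with rep_n show ?thesis
  proof eventually_elim
    case (elim x)
    then have "n x = 0" by simp
    then show ?case by (simp add: n_def)
  qed
qed

text \<open>The factors a n make the series of moduli absolutely convergent, and its sum lies above
  each a n |F n|.\<close>

lemma ex_majorant_series:
  fixes F :: "nat \<Rightarrow> 'l"
  shows "\<exists>g. \<forall>n. AE x in M. rep (F n) x \<noteq> 0 \<longrightarrow> rep g x \<noteq> 0"
proof -
  define a where "a n = (1/2) ^ n / (1 + norm (F n))" for n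
  have a: "a n > 0" for n unfolding a_def by (intro divide_pos_pos add_pos_nonneg) auto
  have "summable (\<lambda>n. a n *\<^sub>R modulus (F n))"
  proof (rule summable_comparison_test')
    show "summable (\<lambda>n. (1/2) ^ n :: real)" by (rule summable_geometric) auto
    show "norm (a n *\<^sub>R modulus (F n)) \<le> (1/2) ^ n" if "n \<ge> 0" for n
    proof -
      have "0 < 1 + norm (F n)" using norm_ge_zero[of "F n"] by linarith
      then have "norm (F n) / (1 + norm (F n)) \<le> 1" by simp
      then have "(1/2) ^ n * (norm (F n) / (1 + norm (F n))) \<le> (1/2) ^ n * 1"
        by (intro mult_left_mono) auto
      then show ?thesis using a[of n] by (simp add: a_def)
    qed
  qed
  then have lim: "(\<lambda>N. \<Sum>n<N. a n *\<^sub>R modulus (F n)) \<longlonglongrightarrow> (\<Sum>n. a n *\<^sub>R modulus (F n))"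
    by (rule summable_LIMSEQ)
  have "AE x in M. rep (F n) x \<noteq> 0 \<longrightarrow> rep (\<Sum>n. a n *\<^sub>R modulus (F n)) x \<noteq> 0" for n
  proof -
    have "AE x in M. a n * cmod (rep (F n) x) \<le> Re (rep (\<Sum>n. a n *\<^sub>R modulus (F n)) x)"
    proof (rule lower_bound_tendsto[OF lim])
      show "\<forall>\<^sub>F N in sequentially. AE x in M. a n * cmod (rep (F n) x) \<le> Re (rep (\<Sum>n<N. a n *\<^sub>R modulus (F n)) x)"
        using eventually_gt_at_top[of n]
      proof eventually_elim
        case (elim N)
        have "AE x in M. \<forall>i\<in>{..<N}. rep (a i *\<^sub>R modulus (F i)) x = of_real (a i * cmod (rep (F i) x))"
        proof (rule AE_finite_allI)
          show "AE x in M. rep (a i *\<^sub>R modulus (F i)) x = of_real (a i * cmod (rep (F i) x))" for i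
            using rep_scaleR[of "a i" "modulus (F i)"] rep_modulus[of "F i"] by eventually_elim simp
        qed simp
        with rep_sum[of "\<lambda>n. a n *\<^sub>R modulus (F n)" "{..<N}"] show ?case
        proof eventually_elim
          case (elim x)
          then have "Re (rep (\<Sum>n<N. a n *\<^sub>R modulus (F n)) x) = (\<Sum>i<N. a i * cmod (rep (F i) x))" by simp
          then show ?case using \<open>n < N\<close> a by (auto intro!: member_le_sum simp: less_imp_le)
        qed
      qed
    qed measurable
    then show ?thesis
    proof eventually_elim
      case (elim x)
      show ?case
      proof
        assume "rep (F n) x \<noteq> 0"
        then have "0 < a n * cmod (rep (F n) x)" using a by simp
        with elim show "rep (\<Sum>n. a n *\<^sub>R modulus (F n)) x \<noteq> 0" by auto
      qed
    qed
  qed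
  then show ?thesis by blast
qed

text \<open>Sets on which some element of L vanishes nowhere, up to null sets, are closed under
  countable unions, so there is an essentially largest one; by the carrier condition its complement
  is null. Changing \<gamma> on a null set makes it positive everywhere.\<close>

lemma ex_weak_unit:
  obtains g \<gamma> where "\<gamma> \<in> borel_measurable M" "\<And>x. \<gamma> x > (0::real)" "AE x in M. rep g x = of_real (\<gamma> x)"
proof -
  let ?S = "{S \<in> sets M. \<exists>f. AE x in M. x \<in> S \<longrightarrow> rep f x \<noteq> 0}"
  obtain E where E: "E \<in> ?S" "\<And>F. F \<in> ?S \<Longrightarrow> F - E \<in> null_sets M"
  proof (rule exhaustion)
    show "?S \<noteq> {}" by (auto intro!: exI[of _ "{}"])
    fix A :: "nat \<Rightarrow> 'a set" assume A: "range A \<subseteq> ?S"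
    then have "\<exists>f. AE x in M. x \<in> A n \<longrightarrow> rep f x \<noteq> 0" for n by (auto simp: image_subset_iff)
    then obtain F where F: "\<And>n. AE x in M. x \<in> A n \<longrightarrow> rep (F n) x \<noteq> 0" by metis
    obtain g where g: "\<And>n. AE x in M. rep (F n) x \<noteq> 0 \<longrightarrow> rep g x \<noteq> 0"
      using ex_majorant_series by blast
    have "AE x in M. x \<in> A n \<longrightarrow> rep g x \<noteq> 0" for n
      using F[of n] g[of n] by eventually_elim auto
    then have "AE x in M. \<forall>n. x \<in> A n \<longrightarrow> rep g x \<noteq> 0"
      unfolding AE_all_countable by simp
    then have "AE x in M. x \<in> (\<Union>n. A n) \<longrightarrow> rep g x \<noteq> 0" by eventually_elim auto
    then show "(\<Union>n. A n) \<in> ?S" using A by auto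
  qed auto
  then obtain f where f: "AE x in M. x \<in> E \<longrightarrow> rep f x \<noteq> 0" by auto
  have [measurable]: "E \<in> sets M" using E by auto
  have "AE x in M. x \<in> space M - E \<longrightarrow> rep f' x = 0" for f'
  proof -
    let ?F = "{x \<in> space M. rep f' x \<noteq> 0}"
    have "?F - E \<in> null_sets M" by (rule E(2)) auto
    then have "AE x in M. x \<notin> ?F - E" by (rule AE_not_in)
    then show ?thesis by eventually_elim auto
  qed
  then have "emeasure M (space M - E) = 0" by (intro carrier) auto
  then have "space M - E \<in> null_sets M" by auto
  from AE_not_in[OF this] AE_space have "AE x in M. x \<in> E" by eventually_elim auto
  with f have f0: "AE x in M. rep f x \<noteq> 0" by eventually_elim auto
  define \<gamma> where "\<gamma> x = (if rep f x = 0 then 1 else cmod (rep f x))" for x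
  show ?thesis
  proof (rule that[of \<gamma> "modulus f"])
    show "\<gamma> \<in> borel_measurable M" unfolding \<gamma>_def by measurable
    show "\<gamma> x > 0" for x by (simp add: \<gamma>_def)
    show "AE x in M. rep (modulus f) x = of_real (\<gamma> x)"
      using rep_modulus[of f] f0 by eventually_elim (simp add: \<gamma>_def)
  qed
qed

text \<open>Order continuity speaks about decreasing sequences; the suprema H n of the tails of |F
  k| form one, and it lies above |F n|.\<close>

lemma dominated_convergence_norm:
  assumes oc: "order_continuous_norm (fun_nonneg M rep)"
    and le: "\<And>n. AE x in M. cmod (rep (F n) x) \<le> cmod (rep u x)"
    and lim: "AE x in M. (\<lambda>n. rep (F n) x) \<longlonglongrightarrow> 0"
  shows "(\<lambda>n. norm (F n)) \<longlonglongrightarrow> 0"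
proof -
  \<comment> \<open>Capping by |u| keeps every supremum bounded, although the domination holds only
    almost everywhere.\<close>
  define H where "H n x = (SUP k\<in>{n..}. min (cmod (rep (F k) x)) (cmod (rep u x)))" for n x
  have bdd: "bdd_above ((\<lambda>k. min (cmod (rep (F k) x)) (cmod (rep u x))) ` K)" for x K
    by (intro bdd_aboveI[of _ "cmod (rep u x)"]) auto
  have [measurable]: "H n \<in> borel_measurable M" for n
    unfolding H_def by (intro borel_measurable_cSUP bdd) auto
  have H_upper: "min (cmod (rep (F k) x)) (cmod (rep u x)) \<le> H n x" if "n \<le> k" for n k x
    unfolding H_def using that by (intro cSUP_upper bdd) auto
  have H0: "0 \<le> H n x" for n x
    using H_upper[of n n x] by (meson min.boundedI norm_ge_zero order_refl order_trans)
  have Hu: "H n x \<le> cmod (rep u x)" for n x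
    unfolding H_def by (intro cSUP_least) auto
  have Hdec: "H (Suc n) x \<le> H n x" for n x
    unfolding H_def by (intro cSUP_subset_mono bdd) auto
  have Hlim: "AE x in M. (\<lambda>n. H n x) \<longlonglongrightarrow> 0"
    using lim
  proof eventually_elim
    case (elim x)
    show ?case
    proof (rule LIMSEQ_I)
      fix e :: real assume e: "0 < e"
      obtain N where N: "\<And>n. n \<ge> N \<Longrightarrow> cmod (rep (F n) x) < e / 2"
        using LIMSEQ_D[OF elim, of "e / 2"] e by auto
      have N': "min (cmod (rep (F n) x)) (cmod (rep u x)) \<le> e / 2" if "n \<ge> N" for n
        using N[OF that] by linarith
      have "H n x \<le> e / 2" if "n \<ge> N" for n
        unfolding H_def using that by (intro cSUP_least N') auto
      then show "\<exists>N. \<forall>n\<ge>N. norm (H n x - 0) < e"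
        using H0 e by (intro exI[of _ N]) force
    qed
  qed
  define G where "G n = emb (\<lambda>x. of_real (H n x))" for n
  have rep_G: "AE x in M. rep (G n) x = of_real (H n x)" for n
    unfolding G_def by (rule rep_emb[where f = u]) (use H0 Hu in auto)
  have "(\<forall>n. G n \<in> fun_nonneg M rep) \<and> (\<forall>n. G n - G (Suc n) \<in> fun_nonneg M rep) \<and>
        (\<forall>g. (\<forall>n. G n - g \<in> fun_nonneg M rep) \<longrightarrow> 0 - g \<in> fun_nonneg M rep)"
  proof (intro conjI allI impI)
    show "G n \<in> fun_nonneg M rep" for n
      unfolding fun_nonneg_def mem_Collect_eq using rep_G[of n]
      by eventually_elim (simp add: H0)
    show "G n - G (Suc n) \<in> fun_nonneg M rep" for n
      unfolding fun_nonneg_def mem_Collect_eq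
      using rep_G[of n] rep_G[of "Suc n"] rep_diff[of "G n" "G (Suc n)"]
      by eventually_elim (simp add: Hdec complex_nonneg_Reals_iff)
    fix g assume "\<forall>n. G n - g \<in> fun_nonneg M rep"
    then have "AE x in M. \<forall>n. rep (G n - g) x \<in> \<real>\<^sub>\<ge>\<^sub>0"
      unfolding AE_all_countable fun_nonneg_def by auto
    moreover have "AE x in M. \<forall>n. rep (G n) x = of_real (H n x)"
      unfolding AE_all_countable using rep_G by auto
    moreover have "AE x in M. \<forall>n. rep (G n - g) x = rep (G n) x - rep g x"
      unfolding AE_all_countable using rep_diff by auto
    moreover note Hlim rep_minus[of g]
    ultimately show "0 - g \<in> fun_nonneg M rep"
      unfolding fun_nonneg_def mem_Collect_eq diff_0
    proof eventually_elim
      case (elim x)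
      then have *: "Re (rep g x) \<le> H n x" "Im (rep g x) = 0" for n
        by (simp_all add: complex_nonneg_Reals_iff)
      have "Re (rep g x) \<le> 0" by (rule LIMSEQ_le_const[OF elim(4)]) (use * in auto)
      then show ?case using elim * by (simp add: complex_nonneg_Reals_iff)
    qed
  qed
  then have G0: "(\<lambda>n. norm (G n)) \<longlonglongrightarrow> 0" using oc unfolding order_continuous_norm_def by blast
  have "norm (F n) \<le> norm (G n)" for n
  proof (rule norm_le)
    show "AE x in M. cmod (rep (F n) x) \<le> cmod (rep (G n) x)"
      using le[of n] rep_G[of n]
    proof eventually_elim
      case (elim x)
      then show ?case using H_upper[of n n x] H0[of n x] by simp
    qed
  qed
  then show ?thesis by (intro tendsto_sandwich[OF _ _ tendsto_const G0]) auto
qed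

section \<open>Positive functionals\<close>

definition positive_part :: "'l \<Rightarrow> 'l" where
  "positive_part f = emb (\<lambda>x. of_real (max 0 (Re (rep f x))))"

lemma rep_positive_part: "AE x in M. rep (positive_part f) x = of_real (max 0 (Re (rep f x)))"
  unfolding positive_part_def
proof (rule rep_emb[where f = f])
  show "AE x in M. cmod (of_real (max 0 (Re (rep f x)))) \<le> cmod (rep f x)"
    using complex_Re_le_cmod by (intro AE_I2) (auto simp: max_def)
qed measurable

lemma sublinear_norm_positive_part: "sublinear (\<lambda>f. norm (positive_part f))"
  unfolding sublinear_def
proof (intro conjI allI impI)
  fix f g
  have "norm (positive_part (f + g)) \<le> norm (positive_part f + positive_part g)"
  proof (rule norm_le)
    show "AE x in M. cmod (rep (positive_part (f + g)) x) \<le> cmod (rep (positive_part f + positive_part g) x)"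
      using rep_positive_part[of "f + g"] rep_positive_part[of f] rep_positive_part[of g]
        rep_add[of f g] rep_add[of "positive_part f" "positive_part g"]
    proof eventually_elim
      case (elim x)
      then show ?case by (simp add: max_def flip: of_real_add)
    qed
  qed
  also have "\<dots> \<le> norm (positive_part f) + norm (positive_part g)" by (rule norm_triangle_ineq)
  finally show "norm (positive_part (f + g)) \<le> norm (positive_part f) + norm (positive_part g)" .
next
  fix c :: real and f assume c: "c > 0"
  have "norm (positive_part (c *\<^sub>R f)) \<le> norm (c *\<^sub>R positive_part f)"
  proof (rule norm_le)
    show "AE x in M. cmod (rep (positive_part (c *\<^sub>R f)) x) \<le> cmod (rep (c *\<^sub>R positive_part f) x)"
      using rep_positive_part[of "c *\<^sub>R f"] rep_positive_part[of f] rep_scaleR[of c f] rep_scaleR[of c "positive_part f"]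
    proof eventually_elim
      case (elim x)
      then show ?case using c by (simp add: max_def norm_mult zero_le_mult_iff)
    qed
  qed
  then show "norm (positive_part (c *\<^sub>R f)) \<le> c * norm (positive_part f)" using c by simp
qed

text \<open>Hahn-Banach with the norm of the positive part as majorant: it vanishes at - f for
  nonnegative f, so \<phi> (- f) \<le> 0.\<close>

lemma ex_positive_functional:
  assumes u: "u \<in> fun_nonneg M rep"
  obtains \<phi> :: "'l \<Rightarrow> real" where "linear \<phi>" "\<phi> u = norm u" "\<And>f. f \<in> fun_nonneg M rep \<Longrightarrow> 0 \<le> \<phi> f"
    "\<And>f. \<phi> f \<le> norm f"
proof -
  have pp: "norm (positive_part f) \<le> norm f" for f
  proof (rule norm_le)
    show "AE x in M. cmod (rep (positive_part f) x) \<le> cmod (rep f x)"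
      using rep_positive_part[of f] by eventually_elim (auto simp: max_def complex_Re_le_cmod)
  qed
  obtain \<phi> where \<phi>: "linear \<phi>" "\<And>f. \<phi> f \<le> norm (positive_part f)" "\<phi> u = norm (positive_part u)"
    using ex_linear_minorant[OF sublinear_norm_positive_part] by metis
  have "norm u \<le> norm (positive_part u)"
  proof (rule norm_le)
    show "AE x in M. cmod (rep u x) \<le> cmod (rep (positive_part u) x)"
      using rep_positive_part[of u] u[unfolded fun_nonneg_def mem_Collect_eq]
      by eventually_elim (auto simp: max_def complex_nonneg_Reals_iff cmod_eq_Re)
  qed
  with \<phi>(3) pp[of u] have "\<phi> u = norm u" by simp
  moreover have "0 \<le> \<phi> f" if f: "f \<in> fun_nonneg M rep" for f
  proof -
    have "positive_part (- f) = 0"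
      unfolding eq_zero_iff
      using rep_positive_part[of "- f"] rep_minus[of f] f[unfolded fun_nonneg_def mem_Collect_eq]
      by eventually_elim (simp add: complex_nonneg_Reals_iff)
    then show ?thesis using \<phi>(2)[of "- f"] linear_neg[OF \<phi>(1)] by simp
  qed
  moreover have "\<phi> f \<le> norm f" for f using \<phi>(2)[of f] pp[of f] by simp
  ultimately show ?thesis using that \<phi>(1) by blast
qed

lemma restr_nonneg:
  assumes "E \<in> sets M" "f \<in> fun_nonneg M rep"
  shows "restr E f \<in> fun_nonneg M rep"
  unfolding fun_nonneg_def mem_Collect_eq
  using rep_restr[OF assms(1), of f] assms(2)[unfolded fun_nonneg_def mem_Collect_eq]
  by eventually_elim (auto simp: indicator_def)

lemma restr_Un:
  assumes [measurable]: "A \<in> sets M" "B \<in> sets M" and "A \<inter> B = {}"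
  shows "restr (A \<union> B) f = restr A f + restr B f"
proof (rule rep_inject)
  have "A \<union> B \<in> sets M" by measurable
  from rep_restr[OF this, of f] rep_restr[OF assms(1), of f] rep_restr[OF assms(2), of f] rep_add[of "restr A f" "restr B f"]
  show "AE x in M. rep (restr (A \<union> B) f) x = rep (restr A f + restr B f) x"
    by eventually_elim (use assms(3) in \<open>auto simp: indicator_def\<close>)
qed

end

context banach_function_space begin

text \<open>Order continuity makes \<open>G \<mapsto> \<phi> (1\<^sub>G u)\<close> a measure for a positive functional \<open>\<phi>\<close>, and a weight is
  obtained from its Radon--Nikodym density.\<close>

lemma ex_local_weight:
  assumes oc: "order_continuous_norm (fun_nonneg M rep)"
    and E: "E \<in> sets M" "E \<notin> null_sets M"
  obtains w :: "'a \<Rightarrow> real" where "w \<in> borel_measurable M" "\<And>x. 0 \<le> w x"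
    "\<And>f. (\<integral>\<^sup>+x. ennreal (cmod (rep f x) * w x) \<partial>M) \<le> ennreal (norm f)"
    "\<not> (AE x in M. x \<in> E \<longrightarrow> w x = 0)"
proof -
  note [measurable] = E(1)
  obtain g \<gamma> where g: "\<gamma> \<in> borel_measurable M" "\<And>x. \<gamma> x > (0::real)" "AE x in M. rep g x = of_real (\<gamma> x)"
    using ex_weak_unit by blast
  define u where "u = restr E g"
  have rep_u: "AE x in M. rep u x = of_real (indicator E x * \<gamma> x)"
    using rep_restr[OF E(1), of g] g(3) unfolding u_def by eventually_elim (simp add: indicator_def)
  have u: "u \<in> fun_nonneg M rep"
    unfolding fun_nonneg_def mem_Collect_eq using rep_u
    by eventually_elim (use g(2) in \<open>auto simp: indicator_def less_imp_le\<close>)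
  have "u \<noteq> 0"
  proof
    assume "u = 0"
    then have "AE x in M. rep u x = 0" by (simp add: rep_zero)
    with rep_u have "AE x in M. x \<notin> E"
    proof eventually_elim
      case (elim x)
      then show ?case using g(2)[of x] by (auto simp: indicator_def)
    qed
    then show False using E by (simp add: AE_iff_null_sets)
  qed
  obtain \<phi> where \<phi>: "linear \<phi>" "\<phi> u = norm u" "\<And>f. f \<in> fun_nonneg M rep \<Longrightarrow> 0 \<le> \<phi> f" "\<And>f. \<phi> f \<le> norm f"
    using ex_positive_functional[OF u] by metis
  define \<nu> where "\<nu> G = \<phi> (restr G u)" for G
  have \<nu>0: "0 \<le> \<nu> G" if "G \<in> sets M" for G unfolding \<nu>_def by (intro \<phi> restr_nonneg u that)
  have add: "\<nu> (A \<union> B) = \<nu> A + \<nu> B" if "A \<in> sets M" "B \<in> sets M" "A \<inter> B = {}" for A B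
    unfolding \<nu>_def restr_Un[OF that] linear_add[OF \<phi>(1)] ..
  have empty: "\<nu> {} = 0" using add[of "{}" "{}"] by simp
  have sums: "(\<lambda>i. \<nu> (A i)) sums \<nu> (\<Union>i. A i)" if A: "range A \<subseteq> sets M" "disjoint_family A" for A :: "nat \<Rightarrow> 'a set"
  proof -
    have [measurable]: "A i \<in> sets M" for i using A(1) by auto
    have part: "\<nu> (\<Union>i<n. A i) = (\<Sum>i<n. \<nu> (A i))" for n
    proof (induction n)
      case (Suc n)
      have "A i \<inter> A n = {}" if "i < n" for i using A(2) that by (intro disjoint_family_onD) auto
      then have "(\<Union>i<n. A i) \<inter> A n = {}" by blast
      then show ?case using Suc add[of "\<Union>i<n. A i" "A n"] by (simp add: lessThan_Suc Un_commute)
    qed (simp add: empty)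
    \<comment> \<open>The tails decrease to the empty set, so order continuity sends the norms of
      the restrictions of u to 0. This turns finite into countable additivity.\<close>
    define T where "T n = (\<Union>i. A i) - (\<Union>i<n. A i)" for n
    have T [measurable]: "T n \<in> sets M" for n unfolding T_def by measurable
    have split: "\<nu> (\<Union>i. A i) = (\<Sum>i<n. \<nu> (A i)) + \<nu> (T n)" for n
    proof -
      have "(\<Union>i. A i) = (\<Union>i<n. A i) \<union> T n" by (auto simp: T_def)
      moreover have "(\<Union>i<n. A i) \<inter> T n = {}" by (auto simp: T_def)
      ultimately show ?thesis using add[of "\<Union>i<n. A i" "T n"] part by simp
    qed
    have "(\<lambda>n. norm (restr (T n) u)) \<longlonglongrightarrow> 0"
    proof (rule dominated_convergence_norm[OF oc])
      show "AE x in M. cmod (rep (restr (T n) u) x) \<le> cmod (rep u x)" for n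
        using rep_restr[OF T, of n u] by eventually_elim (auto simp: indicator_def norm_mult)
      have "AE x in M. \<forall>n. rep (restr (T n) u) x = indicator (T n) x * rep u x"
        unfolding AE_all_countable using rep_restr[OF T] by simp
      then show "AE x in M. (\<lambda>n. rep (restr (T n) u) x) \<longlonglongrightarrow> 0"
      proof eventually_elim
        case (elim x)
        have "\<exists>N. \<forall>n\<ge>N. x \<notin> T n"
        proof (cases "x \<in> (\<Union>i. A i)")
          case True
          then obtain i where "x \<in> A i" by blast
          then show ?thesis by (intro exI[of _ "Suc i"]) (auto simp: T_def)
        qed (auto simp: T_def)
        then obtain N where "\<And>n. n \<ge> N \<Longrightarrow> x \<notin> T n" by blast
        then have "\<forall>\<^sub>F n in sequentially. rep (restr (T n) u) x = 0"
          using elim by (intro eventually_sequentiallyI[of N]) simp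
        then show ?case by (rule tendsto_eventually)
      qed
    qed
    moreover have "norm (\<nu> (T n)) \<le> norm (restr (T n) u)" for n
      using \<nu>0[OF T, of n] \<phi>(4)[of "restr (T n) u"] by (simp add: \<nu>_def)
    ultimately have "(\<lambda>n. \<nu> (T n)) \<longlonglongrightarrow> 0"
      by (rule Lim_null_comparison[OF always_eventually[OF allI], rotated])
    then have "(\<lambda>n. \<nu> (\<Union>i. A i) - \<nu> (T n)) \<longlonglongrightarrow> \<nu> (\<Union>i. A i) - 0" by (intro tendsto_diff tendsto_const)
    moreover have "(\<lambda>n. \<nu> (\<Union>i. A i) - \<nu> (T n)) = (\<lambda>n. \<Sum>i<n. \<nu> (A i))"
      using split by (auto simp: fun_eq_iff algebra_simps)
    ultimately show ?thesis by (simp add: sums_def)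
  qed
  define N where "N = measure_of (space M) (sets M) (\<lambda>G. ennreal (\<nu> G))"
  have sets_N [simp, measurable_cong]: "sets N = sets M" and space_N [simp]: "space N = space M"
    by (simp_all add: N_def)
  have emeasure_N: "emeasure N G = ennreal (\<nu> G)" if "G \<in> sets M" for G
    unfolding N_def
  proof (rule emeasure_measure_of_sigma[OF sets.sigma_algebra_axioms _ _ that])
    show "positive (sets M) (\<lambda>G. ennreal (\<nu> G))" by (simp add: positive_def empty)
    show "countably_additive (sets M) (\<lambda>G. ennreal (\<nu> G))"
    proof (rule countably_additiveI)
      fix A :: "nat \<Rightarrow> 'a set" assume A: "range A \<subseteq> sets M" "disjoint_family A" "(\<Union>i. A i) \<in> sets M"
      show "(\<Sum>i. ennreal (\<nu> (A i))) = ennreal (\<nu> (\<Union>i. A i))"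
        using A by (intro suminf_ennreal_eq sums \<nu>0) auto
    qed
  qed
  have "absolutely_continuous M N"
    unfolding absolutely_continuous_def
  proof
    fix G assume G: "G \<in> null_sets M"
    then have Gs [measurable]: "G \<in> sets M" by auto
    have "restr G u = 0"
      unfolding eq_zero_iff using rep_restr[OF Gs, of u] AE_not_in[OF G] by eventually_elim simp
    then show "G \<in> null_sets N" by (auto simp: null_sets_def emeasure_N \<nu>_def linear_0[OF \<phi>(1)])
  qed
  then obtain d where d [measurable]: "d \<in> borel_measurable M" and N: "density M d = N"
    using Radon_Nikodym[of N] by auto
  have restr_E: "restr (space M) u = u"
    by (rule rep_inject) (use rep_restr[OF sets.top, of u] AE_space in eventually_elim, simp)
  have "restr E u = u"
    by (rule rep_inject) (use rep_restr[OF E(1), of u] rep_u in eventually_elim, auto simp: indicator_def)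
  then have NE: "emeasure N E = ennreal (norm u)" by (simp add: emeasure_N \<nu>_def \<phi>)
  have "(\<integral>\<^sup>+x. d x \<partial>M) = emeasure (density M d) (space M)"
    by (subst emeasure_density) (auto intro!: nn_integral_cong)
  also have "\<dots> = ennreal (norm u)" unfolding N by (simp add: emeasure_N \<nu>_def restr_E \<phi>)
  finally have d_fin: "AE x in M. d x \<noteq> \<infinity>" by (intro nn_integral_PInf_AE) auto
  \<comment> \<open>d is the density of \<nu>, which measures multiples of u; dividing it by |u|
    gives a weight to be paired with |f|.\<close>
  define w where "w x = (if rep u x = 0 then 0 else enn2real (d x) / cmod (rep u x))" for x
  have w [measurable]: "w \<in> borel_measurable M" unfolding w_def by measurable
  have w0: "0 \<le> w x" for x by (simp add: w_def)
  have int: "(\<integral>\<^sup>+x. ennreal (cmod (rep f x) * w x) \<partial>M) \<le> ennreal (norm f)" for f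
  proof -
    define F where "F x = ennreal (if rep u x = 0 then 0 else cmod (rep f x) / cmod (rep u x))" for x
    have [measurable]: "F \<in> borel_measurable M" unfolding F_def by measurable
    have "(\<integral>\<^sup>+x. ennreal (cmod (rep f x) * w x) \<partial>M) = (\<integral>\<^sup>+x. d x * F x \<partial>M)"
    proof (rule nn_integral_cong_AE)
      show "AE x in M. ennreal (cmod (rep f x) * w x) = d x * F x"
        using d_fin
      proof eventually_elim
        case (elim x)
        then have "d x = ennreal (enn2real (d x))" by (simp add: less_top)
        show ?case
        proof (cases "rep u x = 0")
          case False
          then have "cmod (rep f x) * w x = enn2real (d x) * (cmod (rep f x) / cmod (rep u x))"
            by (simp add: w_def)
          then have "ennreal (cmod (rep f x) * w x) = ennreal (enn2real (d x)) * F x"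
            by (simp only: F_def False if_False) (intro ennreal_mult, auto)
          then show ?thesis using \<open>d x = ennreal (enn2real (d x))\<close> by simp
        qed (simp add: w_def F_def)
      qed
    qed
    also have "\<dots> = (\<integral>\<^sup>+x. F x \<partial>N)" unfolding N[symmetric] by (subst nn_integral_density) auto
    also have "\<dots> \<le> ennreal (norm f)"
    proof -
      have "F \<in> borel_measurable N" by measurable
      then obtain s where s: "\<And>i. simple_function N (s i)" "incseq s" "\<And>i x. s i x < top" "\<And>x. (SUP i. s i x) = F x"
        using borel_measurable_implies_simple_function_sequence' by blast
      have "(\<integral>\<^sup>+x. s i x \<partial>N) \<le> ennreal (norm f)" for i
      proof -
        define V where "V y = s i -` {y} \<inter> space M" for y
        have V [measurable]: "V y \<in> sets M" for y
          using simple_functionD(2)[OF s(1)[of i], of "{y}"] by (simp add: V_def)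
        have fin: "finite (s i ` space M)" using simple_functionD(1)[OF s(1)[of i]] by simp
        \<comment> \<open>For a simple function s i below |f| / |u| the integral is the value of
          \<phi> at the element h = s i u, and |h| \<le> |f|.\<close>
        define h where "h = (\<Sum>y\<in>s i ` space M. enn2real y *\<^sub>R restr (V y) u)"
        have top: "y < top" if "y \<in> s i ` space M" for y using that s(3) by auto
        have "(\<integral>\<^sup>+x. s i x \<partial>N) = (\<Sum>y\<in>s i ` space M. y * emeasure N (V y))"
          by (simp add: nn_integral_eq_simple_integral[OF s(1)] simple_integral_def V_def)
        also have "\<dots> = (\<Sum>y\<in>s i ` space M. ennreal (enn2real y * \<nu> (V y)))"
          using top by (intro sum.cong refl) (simp add: emeasure_N ennreal_mult'' \<nu>0)
        also have "\<dots> = ennreal (\<Sum>y\<in>s i ` space M. enn2real y * \<nu> (V y))"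
          by (intro sum_ennreal) (simp add: \<nu>0)
        also have "(\<Sum>y\<in>s i ` space M. enn2real y * \<nu> (V y)) = \<phi> h"
          by (simp add: h_def \<nu>_def linear_sum[OF \<phi>(1)] linear_scale[OF \<phi>(1)])
        also have "\<phi> h \<le> norm h" by (rule \<phi>)
        also have "norm h \<le> norm f"
        proof (rule norm_le)
          have "AE x in M. \<forall>y\<in>s i ` space M. rep (enn2real y *\<^sub>R restr (V y) u) x = of_real (enn2real y) * (indicator (V y) x * rep u x)"
          proof (rule AE_finite_allI[OF fin])
            show "AE x in M. rep (enn2real y *\<^sub>R restr (V y) u) x = of_real (enn2real y) * (indicator (V y) x * rep u x)" for y
              using rep_scaleR[of "enn2real y" "restr (V y) u"] rep_restr[OF V, of y u] by eventually_elim simp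
          qed
          then show "AE x in M. cmod (rep h x) \<le> cmod (rep f x)"
            using rep_sum[of "\<lambda>y. enn2real y *\<^sub>R restr (V y) u" "s i ` space M"] AE_space unfolding h_def
          proof eventually_elim
            case (elim x)
            have "rep (\<Sum>y\<in>s i ` space M. enn2real y *\<^sub>R restr (V y) u) x
                = (\<Sum>y\<in>s i ` space M. if y = s i x then of_real (enn2real y) * rep u x else 0)"
              unfolding elim(2) using elim(1,3) by (intro sum.cong refl) (auto simp: V_def indicator_def)
            also have "\<dots> = of_real (enn2real (s i x)) * rep u x" using fin elim(3) by simp
            finally have e: "cmod (rep (\<Sum>y\<in>s i ` space M. enn2real y *\<^sub>R restr (V y) u) x) = enn2real (s i x) * cmod (rep u x)"
              by (simp add: norm_mult)
            have "s i x \<le> F x" unfolding s(4)[symmetric] by (rule SUP_upper) simp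
            then have "enn2real (s i x) \<le> (if rep u x = 0 then 0 else cmod (rep f x) / cmod (rep u x))"
              unfolding F_def by (intro enn2real_leI) auto
            then have "enn2real (s i x) * cmod (rep u x) \<le> cmod (rep f x)"
              by (auto simp: field_simps split: if_splits)
            with e show ?case by simp
          qed
        qed
        finally show ?thesis by (simp add: ennreal_leI)
      qed
      then have "(SUP i. \<integral>\<^sup>+x. s i x \<partial>N) \<le> ennreal (norm f)" by (rule SUP_least)
      also have "(SUP i. \<integral>\<^sup>+x. s i x \<partial>N) = (\<integral>\<^sup>+x. (SUP i. s i x) \<partial>N)"
        using s by (intro nn_integral_monotone_convergence_SUP[symmetric] borel_measurable_simple_function) auto
      finally show ?thesis by (simp add: s(4))
    qed
    finally show ?thesis .
  qed
  \<comment> \<open>Otherwise d vanishes on E, against \<nu> E = \<phi> u = norm u > 0.\<close>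
  have "\<not> (AE x in M. x \<in> E \<longrightarrow> w x = 0)"
  proof
    assume "AE x in M. x \<in> E \<longrightarrow> w x = 0"
    then have "AE x in M. d x * indicator E x = 0"
      using d_fin rep_u
    proof eventually_elim
      case (elim x)
      show ?case
      proof (cases "x \<in> E")
        case True
        then have "rep u x \<noteq> 0" using elim g(2)[of x] by auto
        then have "enn2real (d x) = 0" using elim True by (simp add: w_def)
        then show ?thesis using elim by (simp add: enn2real_eq_0_iff)
      qed simp
    qed
    then have "emeasure N E = 0"
      unfolding N[symmetric] by (subst emeasure_density) (auto simp: nn_integral_0_iff_AE)
    then show False using NE \<open>u \<noteq> 0\<close> by simp
  qed
  then show ?thesis using that[OF w w0 int] by blast
qed

text \<open>The sets carrying a positive admissible weight are exhausted; a remainder of positive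
  measure would carry a further local weight. The cap at 1 in W makes series of weights
  converge.\<close>

lemma ex_weight:
  assumes oc: "order_continuous_norm (fun_nonneg M rep)"
  obtains w :: "'a \<Rightarrow> real" where "w \<in> borel_measurable M" "\<And>x. 0 < w x"
    "\<And>f. (\<integral>\<^sup>+x. ennreal (cmod (rep f x) * w x) \<partial>M) \<le> ennreal (norm f)"
proof -
  define W where "W w \<longleftrightarrow> w \<in> borel_measurable M \<and> (\<forall>x. 0 \<le> w x \<and> w x \<le> (1::real)) \<and>
    (\<forall>f. (\<integral>\<^sup>+x. ennreal (cmod (rep f x) * w x) \<partial>M) \<le> ennreal (norm f))" for w
  let ?S = "{S \<in> sets M. \<exists>w. W w \<and> (AE x in M. x \<in> S \<longrightarrow> w x > 0)}"
  obtain E where E: "E \<in> ?S" "\<And>F. F \<in> ?S \<Longrightarrow> F - E \<in> null_sets M"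
  proof (rule exhaustion)
    have "W (\<lambda>x. 0)" by (simp add: W_def)
    then show "?S \<noteq> {}" by (auto intro!: exI[of _ "{}"])
    fix A :: "nat \<Rightarrow> 'a set" assume A: "range A \<subseteq> ?S"
    then have "\<exists>w. W w \<and> (AE x in M. x \<in> A n \<longrightarrow> w x > 0)" for n by (auto simp: image_subset_iff)
    then obtain w where w: "\<And>n. W (w n)" "\<And>n. AE x in M. x \<in> A n \<longrightarrow> w n x > 0" by metis
    have wm [measurable]: "w n \<in> borel_measurable M" and w01: "0 \<le> w n x" "w n x \<le> 1"
      and wi: "(\<integral>\<^sup>+x. ennreal (cmod (rep f x) * w n x) \<partial>M) \<le> ennreal (norm f)" for n x f
      using w(1)[of n] by (auto simp: W_def)
    \<comment> \<open>The dyadic factors sum to 1, so v satisfies the same bound as each w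
      n.\<close>
    define v where "v x = (\<Sum>n. (1/2) ^ Suc n * w n x)" for x
    have half: "(\<lambda>n. (1/2) ^ Suc n :: real) sums 1" by (rule power_half_series)
    have sm: "summable (\<lambda>n. (1/2) ^ Suc n * w n x)" for x
      using w01 by (intro summable_comparison_test'[OF sums_summable[OF half]]) (auto simp: mult_left_le)
    have "v x \<le> 1" for x
      unfolding v_def using w01 by (intro sums_le[OF _ summable_sums[OF sm] half]) (simp add: mult_left_le)
    moreover have "0 \<le> v x" for x unfolding v_def using w01 by (intro suminf_nonneg sm) auto
    moreover have "v \<in> borel_measurable M" unfolding v_def by measurable
    moreover have "(\<integral>\<^sup>+x. ennreal (cmod (rep f x) * v x) \<partial>M) \<le> ennreal (norm f)" for f
    proof -
      have "ennreal (cmod (rep f x) * v x) = (\<Sum>n. ennreal ((1/2) ^ Suc n) * ennreal (cmod (rep f x) * w n x))" for x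
      proof -
        have "(\<lambda>n. cmod (rep f x) * ((1/2) ^ Suc n * w n x)) sums (cmod (rep f x) * v x)"
          unfolding v_def by (intro sums_mult summable_sums sm)
        then have "(\<Sum>n. ennreal (cmod (rep f x) * ((1/2) ^ Suc n * w n x))) = ennreal (cmod (rep f x) * v x)"
          using w01 by (intro suminf_ennreal_eq) auto
        moreover have "ennreal (cmod (rep f x) * ((1/2) ^ Suc n * w n x)) = ennreal ((1/2) ^ Suc n) * ennreal (cmod (rep f x) * w n x)" for n
          using w01 by (simp add: mult_ac flip: ennreal_mult)
        ultimately show ?thesis by simp
      qed
      then have "(\<integral>\<^sup>+x. ennreal (cmod (rep f x) * v x) \<partial>M)
          = (\<Sum>n. ennreal ((1/2) ^ Suc n) * (\<integral>\<^sup>+x. ennreal (cmod (rep f x) * w n x) \<partial>M))"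
        by (simp add: nn_integral_suminf nn_integral_cmult)
      also have "\<dots> \<le> (\<Sum>n. ennreal ((1/2) ^ Suc n) * ennreal (norm f))"
        by (intro suminf_le mult_left_mono wi) auto
      also have "\<dots> = (\<Sum>n. ennreal ((1/2) ^ Suc n * norm f))"
        by (intro arg_cong[where f = suminf] ext ennreal_mult[symmetric]) auto
      also have "\<dots> = ennreal (1 * norm f)"
        by (intro suminf_ennreal_eq sums_mult2 half) auto
      finally show ?thesis by simp
    qed
    ultimately have "W v" by (simp add: W_def)
    moreover have "AE x in M. x \<in> (\<Union>n. A n) \<longrightarrow> v x > 0"
    proof -
      have "AE x in M. \<forall>n. x \<in> A n \<longrightarrow> w n x > 0" unfolding AE_all_countable using w(2) by simp
      then show ?thesis
      proof eventually_elim
        case (elim x)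
        show ?case
        proof
          assume "x \<in> (\<Union>n. A n)"
          then obtain n where "w n x > 0" using elim by blast
          then show "v x > 0" unfolding v_def using w01 by (intro suminf_pos2[OF sm, of _ n]) auto
        qed
      qed
    qed
    ultimately show "(\<Union>n. A n) \<in> ?S" using A by auto
  qed auto
  then obtain w where W: "W w" and pos: "AE x in M. x \<in> E \<longrightarrow> w x > 0" by auto
  have [measurable]: "w \<in> borel_measurable M" using W by (simp add: W_def)
  have [measurable]: "E \<in> sets M" using E by auto
  have "space M - E \<in> null_sets M"
  proof (rule ccontr)
    assume "space M - E \<notin> null_sets M"
    then obtain v where v [measurable]: "v \<in> borel_measurable M" and v0: "\<And>x. 0 \<le> v x"
      and int: "\<And>f. (\<integral>\<^sup>+x. ennreal (cmod (rep f x) * v x) \<partial>M) \<le> ennreal (norm f)"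
      and ne: "\<not> (AE x in M. x \<in> space M - E \<longrightarrow> v x = 0)"
      using ex_local_weight[OF oc, of "space M - E"] by auto
    have "(\<integral>\<^sup>+x. ennreal (cmod (rep f x) * min (v x) 1) \<partial>M) \<le> ennreal (norm f)" for f
      by (rule order_trans[OF nn_integral_mono int]) (auto intro!: ennreal_leI mult_left_mono)
    then have "W (\<lambda>x. min (v x) 1)" using v0 by (auto simp: W_def)
    then have "{x \<in> space M. v x > 0} \<in> ?S" by (auto intro!: exI[of _ "\<lambda>x. min (v x) 1"])
    then have "{x \<in> space M. v x > 0} - E \<in> null_sets M" by (rule E(2))
    from AE_not_in[OF this] have "AE x in M. x \<in> space M - E \<longrightarrow> v x = 0"
      by eventually_elim (use v0 in \<open>force simp: less_le\<close>)
    with ne show False ..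
  qed
  from AE_not_in[OF this] AE_space have "AE x in M. x \<in> E" by eventually_elim auto
  with pos have pos': "AE x in M. w x > 0" by eventually_elim auto
  define w' where "w' x = (if w x > 0 then w x else 1)" for x
  show ?thesis
  proof (rule that[of w'])
    show "w' \<in> borel_measurable M" unfolding w'_def by measurable
    show "0 < w' x" for x by (simp add: w'_def)
    fix f
    have "(\<integral>\<^sup>+x. ennreal (cmod (rep f x) * w' x) \<partial>M) = (\<integral>\<^sup>+x. ennreal (cmod (rep f x) * w x) \<partial>M)"
      by (rule nn_integral_cong_AE) (use pos' in eventually_elim, simp add: w'_def)
    then show "(\<integral>\<^sup>+x. ennreal (cmod (rep f x) * w' x) \<partial>M) \<le> ennreal (norm f)"
      using W by (simp add: W_def)
  qed
qed

end

section \<open>Kernel operators\<close>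

text \<open>The difference N' - N is a finite additive set function on the algebra, continuous at
  the empty set because N' is. Its Caratheodory extension L is a measure, and N + L = N' on the
  generated \<sigma>-algebra by uniqueness.\<close>

lemma emeasure_le_of_generating_algebra:
  assumes ring: "ring_of_sets \<Omega> \<A>" and \<Omega>: "\<Omega> \<in> \<A>"
    and N: "finite_measure N" "sets N = sigma_sets \<Omega> \<A>"
    and N': "finite_measure N'" "sets N' = sigma_sets \<Omega> \<A>"
    and le: "\<And>G. G \<in> \<A> \<Longrightarrow> emeasure N G \<le> emeasure N' G"
    and G: "G \<in> sets N"
  shows "emeasure N G \<le> emeasure N' G"
proof -
  interpret ring: ring_of_sets \<Omega> \<A> by (rule ring)
  interpret N: finite_measure N by (rule N)
  interpret N': finite_measure N' by (rule N')
  have sub: "\<A> \<subseteq> Pow \<Omega>" by (rule ring.space_closed)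
  have in_N: "X \<in> sets N" "X \<in> sets N'" if "X \<in> \<A>" for X
    using that by (auto simp: N(2) N'(2))
  have space: "space N = \<Omega>" "space N' = \<Omega>"
    using N(2) N'(2) sub by (metis sets_measure_of sets_eq_imp_space_eq space_measure_of)+
  define f where "f X = emeasure N' X - emeasure N X" for X
  have add_f: "emeasure N X + f X = emeasure N' X" if "X \<in> \<A>" for X
    unfolding f_def using le[OF that] by (rule add_diff_inverse_ennreal)
  have "\<exists>\<mu>. (\<forall>X\<in>\<A>. \<mu> X = f X) \<and> measure_space \<Omega> (sigma_sets \<Omega> \<A>) \<mu>"
  proof (rule ring.caratheodory_empty_continuous)
    show "positive \<A> f" by (simp add: positive_def f_def)
    show "additive \<A> f"
      unfolding additive_def
    proof (intro ballI impI)
      fix X Y assume XY: "X \<in> \<A>" "Y \<in> \<A>" "X \<inter> Y = {}"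
      have 1: "emeasure N (X \<union> Y) = emeasure N X + emeasure N Y"
        using XY in_N by (intro plus_emeasure[symmetric]) auto
      have "emeasure N' (X \<union> Y) = emeasure N' X + emeasure N' Y"
        using XY in_N by (intro plus_emeasure[symmetric]) auto
      also have "\<dots> = (emeasure N X + f X) + (emeasure N Y + f Y)" using XY by (simp add: add_f)
      also have "\<dots> = (f X + f Y) + emeasure N (X \<union> Y)" by (simp add: 1 ac_simps)
      finally show "f (X \<union> Y) = f X + f Y" unfolding f_def[of "X \<union> Y"] by (simp add: ennreal_add_diff_cancel_right)
    qed
    show "f X \<noteq> \<infinity>" for X by (simp add: f_def ennreal_minus_eq_top)
    fix A :: "nat \<Rightarrow> 'a set" assume A: "range A \<subseteq> \<A>" "decseq A" "(\<Inter>i. A i) = {}"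
    have "(\<lambda>i. emeasure N' (A i)) \<longlonglongrightarrow> emeasure N' (\<Inter>i. A i)"
      using A in_N by (intro Lim_emeasure_decseq) auto
    then have *: "(\<lambda>i. emeasure N' (A i)) \<longlonglongrightarrow> 0" using A by simp
    show "(\<lambda>i. f (A i)) \<longlonglongrightarrow> 0"
      by (rule tendsto_sandwich[OF _ _ tendsto_const *]) (auto simp: f_def diff_le_self_ennreal)
  qed
  then obtain \<mu> where \<mu>: "\<And>X. X \<in> \<A> \<Longrightarrow> \<mu> X = f X" and ms: "measure_space \<Omega> (sigma_sets \<Omega> \<A>) \<mu>" by blast
  define L where "L = measure_of \<Omega> (sigma_sets \<Omega> \<A>) \<mu>"
  have sets_L: "sets L = sets N" "space L = \<Omega>"
    using sigma_sets_into_sp[OF sub]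
    by (auto simp: L_def N(2) sets_measure_of_conv space_measure_of_conv sigma_sets_sigma_sets_eq[OF sub])
  have emeasure_L: "emeasure L X = \<mu> X" if "X \<in> sets N" for X
    unfolding L_def using ms that by (intro emeasure_measure_of_sigma) (auto simp: measure_space_def N(2))
  define S where "S = measure_of \<Omega> (sets N) (\<lambda>X. emeasure N X + emeasure L X)"
  have sets_S: "sets S = sets N" unfolding S_def using space by (metis sets.sigma_sets_eq sets_measure_of sets.space_closed)
  have emeasure_S: "emeasure S X = emeasure N X + emeasure L X" if "X \<in> sets N" for X
    unfolding S_def
  proof (rule emeasure_measure_of_sigma[OF _ _ _ that])
    show "sigma_algebra \<Omega> (sets N)" using sets.sigma_algebra_axioms[of N] by (simp add: space)
    show "positive (sets N) (\<lambda>X. emeasure N X + emeasure L X)" by (simp add: positive_def)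
    show "countably_additive (sets N) (\<lambda>X. emeasure N X + emeasure L X)"
    proof (rule countably_additiveI)
      fix A :: "nat \<Rightarrow> 'a set" assume A: "range A \<subseteq> sets N" "disjoint_family A"
      show "(\<Sum>i. emeasure N (A i) + emeasure L (A i)) = emeasure N (\<Union>i. A i) + emeasure L (\<Union>i. A i)"
        using A by (subst suminf_add[symmetric]) (auto simp: suminf_emeasure sets_L)
    qed
  qed
  have "S = N'"
  proof (rule measure_eqI_generator_eq)
    show "Int_stable \<A>" by (auto simp: Int_stable_def)
    show "emeasure S X = emeasure N' X" if "X \<in> \<A>" for X
      using that in_N by (simp add: emeasure_S emeasure_L \<mu> add_f)
    show "range (\<lambda>_::nat. \<Omega>) \<subseteq> \<A>" using \<Omega> by auto
    show "emeasure S \<Omega> \<noteq> \<infinity>" for i :: nat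
      using in_N[OF \<Omega>] by (simp add: emeasure_S emeasure_L \<mu> add_f \<Omega>)
  qed (use sub in \<open>auto simp: sets_S N(2) N'(2)\<close>)
  then show ?thesis using emeasure_S[OF G] by (metis le_iff_add)
qed

text \<open>\<open>ennreal\<close> sends negative reals to 0, so these are the integrals of the
  negative and the positive part.\<close>

lemma nn_integral_negative_part_le:
  assumes "integrable M u" "0 \<le> (\<integral>x. u x \<partial>M)"
  shows "(\<integral>\<^sup>+x. ennreal (- u x) \<partial>M) \<le> (\<integral>\<^sup>+x. ennreal (u x) \<partial>M)"
proof -
  have fin: "(\<integral>\<^sup>+x. ennreal (- u x) \<partial>M) < \<infinity>" "(\<integral>\<^sup>+x. ennreal (u x) \<partial>M) < \<infinity>"
    using assms(1) by (auto simp: real_integrable_def less_top)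
  have "enn2real (\<integral>\<^sup>+x. ennreal (- u x) \<partial>M) \<le> enn2real (\<integral>\<^sup>+x. ennreal (u x) \<partial>M)"
    using assms by (simp add: real_lebesgue_integral_def)
  then show ?thesis using fin by (metis ennreal_enn2real ennreal_leI infinity_ennreal_def)
qed

context banach_function_space begin

section \<open>Calculus of operators with kernels\<close>

sublocale pair: pair_sigma_finite M M ..

lemma has_kernel_measurable: "has_kernel M rep A a \<Longrightarrow> a \<in> borel_measurable (M \<Otimes>\<^sub>M M)"
  by (simp add: has_kernel_def)

lemma has_kernelD:
  assumes "has_kernel M rep A a"
  shows "AE x in M. integrable M (\<lambda>y. a (x, y) * rep f y) \<and> rep (A f) x = (\<integral>y. a (x, y) * rep f y \<partial>M)"
  using assms by (simp add: has_kernel_def)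

lemma has_kernel_cong_AE:
  assumes A: "has_kernel M rep A a" and [measurable]: "b \<in> borel_measurable (M \<Otimes>\<^sub>M M)"
    and eq: "AE p in M \<Otimes>\<^sub>M M. a p = b p"
  shows "has_kernel M rep A b"
  unfolding has_kernel_def
proof (intro conjI allI)
  note [measurable] = has_kernel_measurable[OF A]
  fix f
  show "AE x in M. integrable M (\<lambda>y. b (x, y) * rep f y) \<and> rep (A f) x = (\<integral>y. b (x, y) * rep f y \<partial>M)"
    using has_kernelD[OF A, of f] pair.AE_pair[OF eq] AE_space
  proof eventually_elim
    case (elim x)
    have 1: "AE y in M. a (x, y) * rep f y = b (x, y) * rep f y"
      using elim(2) by eventually_elim simp
    have "integrable M (\<lambda>y. a (x, y) * rep f y) \<longleftrightarrow> integrable M (\<lambda>y. b (x, y) * rep f y)"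
      by (rule integrable_cong_AE[OF _ _ 1]) (use elim(3) in measurable)
    moreover have "(\<integral>y. a (x, y) * rep f y \<partial>M) = (\<integral>y. b (x, y) * rep f y \<partial>M)"
      by (rule integral_cong_AE[OF _ _ 1]) (use elim(3) in measurable)
    ultimately show ?case using elim(1) by simp
  qed
qed measurable

lemma has_kernel_operator_unique:
  assumes "has_kernel M rep A a" "has_kernel M rep B a"
  shows "A = B"
proof (rule blinfun_eqI, rule rep_inject)
  show "AE x in M. rep (A f) x = rep (B f) x" for f
    using has_kernelD[OF assms(1), of f] has_kernelD[OF assms(2), of f] by eventually_elim simp
qed

lemma has_kernel_complex_linear:
  assumes A: "has_kernel M rep A a"
  shows "complex_linear M rep A"
  unfolding complex_linear_def
proof (intro allI)
  note [measurable] = has_kernel_measurable[OF A]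
  fix c f
  have "AE x in M. rep (A (cscale M rep c f)) x = c * rep (A f) x"
    using has_kernelD[OF A, of "cscale M rep c f"] has_kernelD[OF A, of f] AE_space
  proof eventually_elim
    case (elim x)
    have "(\<integral>y. a (x, y) * rep (cscale M rep c f) y \<partial>M) = (\<integral>y. c * (a (x, y) * rep f y) \<partial>M)"
      by (rule integral_cong_AE) (use elim(3) ae_rep_cscale[of c f] in \<open>measurable, auto elim!: AE_mp simp: mult_ac\<close>)
    then show ?case using elim by simp
  qed
  then show "A (cscale M rep c f) = cscale M rep c (A f)" by (rule cscale_eqI[symmetric])
qed

lemma has_kernel_add:
  assumes A: "has_kernel M rep A a" and B: "has_kernel M rep B b"
  shows "has_kernel M rep (A + B) (\<lambda>p. a p + b p)"
  unfolding has_kernel_def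
proof (intro conjI allI)
  show "(\<lambda>p. a p + b p) \<in> borel_measurable (M \<Otimes>\<^sub>M M)"
    by (intro borel_measurable_add has_kernel_measurable[OF A] has_kernel_measurable[OF B])
  fix f
  show "AE x in M. integrable M (\<lambda>y. (a (x, y) + b (x, y)) * rep f y) \<and>
      rep ((A + B) f) x = (\<integral>y. (a (x, y) + b (x, y)) * rep f y \<partial>M)"
    using has_kernelD[OF A, of f] has_kernelD[OF B, of f] rep_add[of "A f" "B f"]
    by eventually_elim (simp add: distrib_right blinfun.bilinear_simps)
qed

lemma has_kernel_scaleR:
  assumes A: "has_kernel M rep A a"
  shows "has_kernel M rep (c *\<^sub>R A) (\<lambda>p. of_real c * a p)"
  unfolding has_kernel_def
proof (intro conjI allI)
  show "(\<lambda>p. of_real c * a p) \<in> borel_measurable (M \<Otimes>\<^sub>M M)"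
    using has_kernel_measurable[OF A] by measurable
  fix f
  show "AE x in M. integrable M (\<lambda>y. (of_real c * a (x, y)) * rep f y) \<and>
      rep ((c *\<^sub>R A) f) x = (\<integral>y. (of_real c * a (x, y)) * rep f y \<partial>M)"
    using has_kernelD[OF A, of f] rep_scaleR[of c "A f"]
    by eventually_elim (simp add: mult.assoc blinfun.bilinear_simps)
qed

lemma has_kernel_diff:
  assumes A: "has_kernel M rep A a" and B: "has_kernel M rep B b"
  shows "has_kernel M rep (A - B) (\<lambda>p. a p - b p)"
  using has_kernel_add[OF A has_kernel_scaleR[OF B, of "-1"]] by simp

lemma has_kernel_zero: "has_kernel M rep 0 (\<lambda>p. 0)"
  unfolding has_kernel_def by (auto intro: rep_zero)

text \<open>Working form of \<open>positive_kernel_operator\<close> with a real kernel that is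
  nonnegative everywhere; \<open>positive_kernel_operator_iff\<close> relates the two.\<close>

definition nn_kernel :: "('l \<Rightarrow>\<^sub>L 'l) \<Rightarrow> ('a \<times> 'a \<Rightarrow> real) \<Rightarrow> bool" where
  "nn_kernel A k \<longleftrightarrow> k \<in> borel_measurable (M \<Otimes>\<^sub>M M) \<and> (\<forall>p. 0 \<le> k p) \<and> has_kernel M rep A (\<lambda>p. of_real (k p))"

lemma nn_kernelD:
  assumes "nn_kernel A k"
  shows "k \<in> borel_measurable (M \<Otimes>\<^sub>M M)" "0 \<le> k p" "has_kernel M rep A (\<lambda>p. of_real (k p))"
  using assms unfolding nn_kernel_def by blast+

lemma nn_kernel_modulus:
  assumes A: "nn_kernel A k"
  shows "AE x in M. integrable M (\<lambda>y. k (x, y) * cmod (rep f y)) \<and>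
    rep (A (modulus f)) x = of_real (\<integral>y. k (x, y) * cmod (rep f y) \<partial>M)"
  using has_kernelD[OF nn_kernelD(3)[OF A], of "modulus f"] AE_space
proof eventually_elim
  case (elim x)
  note [measurable] = nn_kernelD(1)[OF A]
  have 1: "AE y in M. of_real (k (x, y)) * rep (modulus f) y = complex_of_real (k (x, y) * cmod (rep f y))"
    using rep_modulus[of f] by eventually_elim simp
  have "integrable M (\<lambda>y. of_real (k (x, y)) * rep (modulus f) y) \<longleftrightarrow> integrable M (\<lambda>y. complex_of_real (k (x, y) * cmod (rep f y)))"
    by (rule integrable_cong_AE[OF _ _ 1]) (use elim(2) in measurable)
  moreover have "(\<integral>y. of_real (k (x, y)) * rep (modulus f) y \<partial>M) = (\<integral>y. complex_of_real (k (x, y) * cmod (rep f y)) \<partial>M)"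
    by (rule integral_cong_AE[OF _ _ 1]) (use elim(2) in measurable)
  ultimately show ?case using elim(1) by (simp only: complex_of_real_integrable_eq integral_complex_of_real)
qed

text \<open>The integral of h (x, y) f y is bounded by A |f| at x, so solidity yields both an
  element of L and the norm estimate.\<close>

lemma ex_dominated_kernel_operator:
  assumes A: "nn_kernel A k" and h [measurable]: "h \<in> borel_measurable (M \<Otimes>\<^sub>M M)"
    and le: "AE p in M \<Otimes>\<^sub>M M. cmod (h p) \<le> k p"
  obtains H where "has_kernel M rep H h" "norm H \<le> norm A"
proof -
  note [measurable] = nn_kernelD(1)[OF A]
  define H where "H f = emb (\<lambda>x. \<integral>y. h (x, y) * rep f y \<partial>M)" for f
  have pointwise: "AE x in M. integrable M (\<lambda>y. h (x, y) * rep f y) \<and>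
      cmod (\<integral>y. h (x, y) * rep f y \<partial>M) \<le> cmod (rep (A (modulus f)) x)" for f
    using nn_kernel_modulus[OF A, of f] pair.AE_pair[OF le] AE_space
  proof eventually_elim
    case (elim x)
    have b: "AE y in M. norm (h (x, y) * rep f y) \<le> norm (k (x, y) * cmod (rep f y))"
      using elim(2) by eventually_elim (auto simp: norm_mult abs_mult nn_kernelD(2)[OF A] intro!: mult_right_mono)
    have i: "integrable M (\<lambda>y. h (x, y) * rep f y)"
      by (rule Bochner_Integration.integrable_bound[OF conjunct1[OF elim(1)] _ b]) (use elim(3) in measurable)
    have "cmod (\<integral>y. h (x, y) * rep f y \<partial>M) \<le> (\<integral>y. norm (h (x, y) * rep f y) \<partial>M)"
      by (rule integral_norm_bound)
    also have "\<dots> \<le> (\<integral>y. k (x, y) * cmod (rep f y) \<partial>M)"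
      using i elim b by (intro integral_mono_AE) (auto simp: nn_kernelD(2)[OF A] elim!: AE_mp)
    also have "\<dots> \<le> cmod (rep (A (modulus f)) x)" using elim by simp
    finally show ?case using i by simp
  qed
  have rep_H: "AE x in M. rep (H f) x = (\<integral>y. h (x, y) * rep f y \<partial>M)" for f
    unfolding H_def by (rule rep_emb[where f = "A (modulus f)"]) (use pointwise[of f] in \<open>measurable, auto elim!: AE_mp\<close>)
  have norm_H: "norm (H f) \<le> norm A * norm f" for f
  proof -
    have "norm (H f) \<le> norm (A (modulus f))"
      by (rule norm_le) (use rep_H[of f] pointwise[of f] in eventually_elim, simp)
    also have "\<dots> \<le> norm A * norm f" using norm_blinfun[of A "modulus f"] by simp
    finally show ?thesis .
  qed
  have bl: "bounded_linear H"
  proof (rule bounded_linear_intro)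
    fix f g
    show "H (f + g) = H f + H g"
    proof (rule rep_inject)
      show "AE x in M. rep (H (f + g)) x = rep (H f + H g) x"
        using rep_H[of f] rep_H[of g] rep_H[of "f + g"] rep_add[of "H f" "H g"] pointwise[of f] pointwise[of g] AE_space
      proof eventually_elim
        case (elim x)
        have "(\<integral>y. h (x, y) * rep (f + g) y \<partial>M) = (\<integral>y. h (x, y) * rep f y + h (x, y) * rep g y \<partial>M)"
          by (rule integral_cong_AE) (use elim(7) rep_add[of f g] in \<open>measurable, auto elim!: AE_mp simp: distrib_left\<close>)
        then show ?case using elim by simp
      qed
    qed
    show "H (r *\<^sub>R f) = r *\<^sub>R H f" for r
    proof (rule rep_inject)
      show "AE x in M. rep (H (r *\<^sub>R f)) x = rep (r *\<^sub>R H f) x"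
        using rep_H[of f] rep_H[of "r *\<^sub>R f"] rep_scaleR[of r "H f"] AE_space
      proof eventually_elim
        case (elim x)
        have "(\<integral>y. h (x, y) * rep (r *\<^sub>R f) y \<partial>M) = (\<integral>y. of_real r * (h (x, y) * rep f y) \<partial>M)"
          by (rule integral_cong_AE) (use elim(4) rep_scaleR[of r f] in \<open>measurable, auto elim!: AE_mp simp: mult_ac\<close>)
        then show ?case using elim by simp
      qed
    qed
    show "norm (H f) \<le> norm f * norm A" using norm_H[of f] by (simp add: mult.commute)
  qed
  have "has_kernel M rep (Blinfun H) h"
    unfolding has_kernel_def bounded_linear_Blinfun_apply[OF bl]
  proof (intro conjI allI)
    show "AE x in M. integrable M (\<lambda>y. h (x, y) * rep f y) \<and> rep (H f) x = (\<integral>y. h (x, y) * rep f y \<partial>M)" for f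
      using pointwise[of f] rep_H[of f] by eventually_elim simp
  qed (rule h)
  moreover have "norm (Blinfun H) \<le> norm A"
    by (rule norm_blinfun_bound) (auto simp: bounded_linear_Blinfun_apply[OF bl] norm_H)
  ultimately show ?thesis using that by blast
qed

lemma ex_dominated_nn_kernel:
  assumes "nn_kernel A k" "h \<in> borel_measurable (M \<Otimes>\<^sub>M M)" "\<And>p. 0 \<le> h p"
    "AE p in M \<Otimes>\<^sub>M M. h p \<le> k p"
  obtains H where "nn_kernel H h" "norm H \<le> norm A"
proof -
  have "AE p in M \<Otimes>\<^sub>M M. cmod (of_real (h p)) \<le> k p" using assms by simp
  then obtain H where "has_kernel M rep H (\<lambda>p. of_real (h p))" "norm H \<le> norm A"
    using ex_dominated_kernel_operator[OF assms(1), of "\<lambda>p. of_real (h p)"] assms(2) by auto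
  then show ?thesis using that assms by (auto simp: nn_kernel_def)
qed

text \<open>Fubini in (y, z) for almost every fixed x; absolute integrability holds because B |f|
  lies in L and A applies to it.\<close>

lemma nn_kernel_compose:
  assumes A: "nn_kernel A a" and B: "nn_kernel B b"
  shows "nn_kernel (A o\<^sub>L B) (\<lambda>p. \<integral>y. a (fst p, y) * b (y, snd p) \<partial>M)"
proof -
  note [measurable] = nn_kernelD(1)[OF A] nn_kernelD(1)[OF B]
  let ?c = "\<lambda>p. \<integral>y. a (fst p, y) * b (y, snd p) \<partial>M"
  have c [measurable]: "?c \<in> borel_measurable (M \<Otimes>\<^sub>M M)" by measurable
  have "AE x in M. integrable M (\<lambda>z. of_real (?c (x, z)) * rep f z) \<and>
      rep ((A o\<^sub>L B) f) x = (\<integral>z. of_real (?c (x, z)) * rep f z \<partial>M)" for f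
    using has_kernelD[OF nn_kernelD(3)[OF A], of "B f"] has_kernelD[OF nn_kernelD(3)[OF A], of "B (modulus f)"] AE_space
  proof eventually_elim
    case (elim x)
    define F where "F p = complex_of_real (a (x, fst p) * b p) * rep f (snd p)" for p
    have F [measurable]: "F \<in> borel_measurable (M \<Otimes>\<^sub>M M)" unfolding F_def using elim(3) by measurable
    have int: "integrable (M \<Otimes>\<^sub>M M) F"
    proof (rule pair.Fubini_integrable[OF F])
      show "AE y in M. integrable M (\<lambda>z. F (y, z))"
        using has_kernelD[OF nn_kernelD(3)[OF B], of f]
        by eventually_elim (simp add: F_def mult.assoc)
      have 1: "AE y in M. of_real (a (x, y)) * rep (B (modulus f)) y = complex_of_real (\<integral>z. norm (F (y, z)) \<partial>M)"
        using nn_kernel_modulus[OF B, of f]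
        by eventually_elim (simp add: F_def norm_mult nn_kernelD(2)[OF A] nn_kernelD(2)[OF B] mult.assoc)
      have "integrable M (\<lambda>y. of_real (a (x, y)) * rep (B (modulus f)) y) \<longleftrightarrow> integrable M (\<lambda>y. complex_of_real (\<integral>z. norm (F (y, z)) \<partial>M))"
        by (rule integrable_cong_AE[OF _ _ 1]) (use elim(3) in measurable)
      then show "integrable M (\<lambda>y. \<integral>z. norm (F (y, z)) \<partial>M)"
        using elim(2) by (simp only: complex_of_real_integrable_eq)
    qed
    then have int': "integrable (M \<Otimes>\<^sub>M M) (\<lambda>(y, z). F (y, z))" by simp
    \<comment> \<open>This also holds where the kernel integral diverges: both sides are then 0 by
      the default value of the Bochner integral.\<close>
    have inner: "(\<integral>y. F (y, z) \<partial>M) = of_real (?c (x, z)) * rep f z" for z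
      by (simp add: F_def flip: integral_complex_of_real)
    have "rep (A (B f)) x = (\<integral>y. of_real (a (x, y)) * rep (B f) y \<partial>M)" using elim(1) by simp
    also have "\<dots> = (\<integral>y. (\<integral>z. F (y, z) \<partial>M) \<partial>M)"
    proof (rule integral_cong_AE)
      show "AE y in M. of_real (a (x, y)) * rep (B f) y = (\<integral>z. F (y, z) \<partial>M)"
        using has_kernelD[OF nn_kernelD(3)[OF B], of f]
        by eventually_elim (simp add: F_def mult.assoc)
    qed (use elim(3) in measurable)
    also have "\<dots> = (\<integral>z. (\<integral>y. F (y, z) \<partial>M) \<partial>M)"
      by (rule pair.Fubini_integral[OF int', symmetric])
    finally have "rep (A (B f)) x = (\<integral>z. of_real (?c (x, z)) * rep f z \<partial>M)" by (simp only: inner)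
    moreover have "integrable M (\<lambda>z. of_real (?c (x, z)) * rep f z)"
      using pair.integrable_snd[OF int'] by (simp only: inner)
    ultimately show ?case by simp
  qed
  then show ?thesis
    using c by (auto simp: nn_kernel_def has_kernel_def nn_kernelD(2)[OF A] nn_kernelD(2)[OF B] intro!: integral_nonneg_AE)
qed

text \<open>
  The sets \<open>{(x, y). y \<in> E (p x)}\<close> with \<open>p\<close> measurable and \<open>nat\<close>-valued form an algebra generating
  \<open>M \<Otimes>\<^sub>M M\<close>. On such sets the sign condition can be used for almost every \<open>x\<close>, because only
  countably many sets \<open>E i\<close> are involved.
\<close>

lemma kernel_nonneg_AE:
  assumes k [measurable]: "k \<in> borel_measurable (M \<Otimes>\<^sub>M M)"
    and pos: "\<And>f. AE x in M. integrable M (\<lambda>y. k (x, y) * cmod (rep f y)) \<and> 0 \<le> (\<integral>y. k (x, y) * cmod (rep f y) \<partial>M)"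
  shows "AE p in M \<Otimes>\<^sub>M M. 0 \<le> (k p :: real)"
proof -
  obtain g \<gamma> where \<gamma> [measurable]: "\<gamma> \<in> borel_measurable M" and \<gamma>0: "\<And>x. \<gamma> x > (0::real)"
    and g: "AE x in M. rep g x = of_real (\<gamma> x)"
    using ex_weak_unit by blast
  obtain h :: "'a \<Rightarrow> real" where h [measurable]: "h \<in> borel_measurable M" "\<And>x. h x > 0" "integrable M h"
    using obtain_positive_integrable_function by metis
  have pos_E: "AE x in M. integrable M (\<lambda>y. k (x, y) * (indicator E y * \<gamma> y)) \<and> 0 \<le> (\<integral>y. k (x, y) * (indicator E y * \<gamma> y) \<partial>M)"
    if E [measurable]: "E \<in> sets M" for E
    using pos[of "restr E g"] AE_space
  proof eventually_elim
    case (elim x)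
    have 1: "AE y in M. k (x, y) * cmod (rep (restr E g) y) = k (x, y) * (indicator E y * \<gamma> y)"
      using rep_restr[OF E, of g] g
      by eventually_elim (use \<gamma>0 in \<open>auto simp: norm_mult indicator_def less_imp_le\<close>)
    have "integrable M (\<lambda>y. k (x, y) * cmod (rep (restr E g) y)) \<longleftrightarrow> integrable M (\<lambda>y. k (x, y) * (indicator E y * \<gamma> y))"
      by (rule integrable_cong_AE[OF _ _ 1]) (use elim(2) in measurable)
    moreover have "(\<integral>y. k (x, y) * cmod (rep (restr E g) y) \<partial>M) = (\<integral>y. k (x, y) * (indicator E y * \<gamma> y) \<partial>M)"
      by (rule integral_cong_AE[OF _ _ 1]) (use elim(2) in measurable)
    ultimately show ?case using elim(1) by simp
  qed
  define q where "q x = (\<integral>\<^sup>+y. ennreal (\<bar>k (x, y)\<bar> * \<gamma> y) \<partial>M)" for x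
  have [measurable]: "q \<in> borel_measurable M" unfolding q_def by measurable
  have q_fin: "AE x in M. q x < \<infinity>"
    using pos_E[OF sets.top] AE_space
  proof eventually_elim
    case (elim x)
    have "integrable M (\<lambda>y. norm (k (x, y) * (indicator (space M) y * \<gamma> y)))" using elim by (intro integrable_norm) auto
    then have "(\<integral>\<^sup>+y. ennreal (norm (k (x, y) * (indicator (space M) y * \<gamma> y))) \<partial>M) < \<infinity>"
      by (simp add: real_integrable_def less_top)
    also have "(\<integral>\<^sup>+y. ennreal (norm (k (x, y) * (indicator (space M) y * \<gamma> y))) \<partial>M) = q x"
      unfolding q_def by (intro nn_integral_cong) (simp add: abs_mult less_imp_le[OF \<gamma>0])
    finally show ?case .
  qed
  \<comment> \<open>Chosen so that v q \<le> h wherever q is finite; hence |k| v \<gamma> is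
    integrable on the product.\<close>
  define v where "v x = h x / (1 + enn2real (q x))" for x
  have v0: "v x > 0" for x unfolding v_def using h(2)[of x] by (intro divide_pos_pos add_pos_nonneg) auto
  have [measurable]: "v \<in> borel_measurable M" unfolding v_def by measurable
  \<comment> \<open>As \<open>ennreal\<close> truncates at 0, N 1 and N (-1) have the positive and
    the negative part of k as densities, up to the positive factor v \<gamma>.\<close>
  define N where "N s = density (M \<Otimes>\<^sub>M M) (\<lambda>p. ennreal (s * k p * (v (fst p) * \<gamma> (snd p))))" for s :: real
  have sets_N: "sets (N s) = sets (M \<Otimes>\<^sub>M M)" for s by (simp add: N_def)
  have em: "emeasure (N s) G = (\<integral>\<^sup>+x. ennreal (v x) * (\<integral>\<^sup>+y. ennreal (s * (k (x, y) * (indicator G (x, y) * \<gamma> y))) \<partial>M) \<partial>M)"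
    if G [measurable]: "G \<in> sets (M \<Otimes>\<^sub>M M)" for G s
  proof -
    have "emeasure (N s) G = (\<integral>\<^sup>+x. \<integral>\<^sup>+y. ennreal (s * k (x, y) * (v x * \<gamma> y)) * indicator G (x, y) \<partial>M \<partial>M)"
      unfolding N_def by (subst emeasure_density) (auto simp: nn_integral_fst[symmetric])
    also have "\<dots> = (\<integral>\<^sup>+x. \<integral>\<^sup>+y. ennreal (v x) * ennreal (s * (k (x, y) * (indicator G (x, y) * \<gamma> y))) \<partial>M \<partial>M)"
      by (intro nn_integral_cong) (auto simp: indicator_def less_imp_le[OF v0] mult_ac simp flip: ennreal_mult')
    also have "\<dots> = (\<integral>\<^sup>+x. ennreal (v x) * (\<integral>\<^sup>+y. ennreal (s * (k (x, y) * (indicator G (x, y) * \<gamma> y))) \<partial>M) \<partial>M)"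
      by (intro nn_integral_cong nn_integral_cmult) measurable
    finally show ?thesis .
  qed
  have fin: "finite_measure (N s)" if s: "\<bar>s\<bar> = 1" for s
  proof (rule finite_measureI)
    have "emeasure (N s) (space (N s)) = emeasure (N s) (space (M \<Otimes>\<^sub>M M))" by (simp add: N_def)
    also have "\<dots> \<le> (\<integral>\<^sup>+x. ennreal (h x) \<partial>M)"
      unfolding em[OF sets.top]
    proof (rule nn_integral_mono_AE)
      show "AE x in M. ennreal (v x) * (\<integral>\<^sup>+y. ennreal (s * (k (x, y) * (indicator (space (M \<Otimes>\<^sub>M M)) (x, y) * \<gamma> y))) \<partial>M) \<le> ennreal (h x)"
        using q_fin
      proof eventually_elim
        case (elim x)
        have "(\<integral>\<^sup>+y. ennreal (s * (k (x, y) * (indicator (space (M \<Otimes>\<^sub>M M)) (x, y) * \<gamma> y))) \<partial>M) \<le> q x"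
          unfolding q_def
        proof (intro nn_integral_mono ennreal_leI)
          fix y
          have "s * (k (x, y) * (indicator (space (M \<Otimes>\<^sub>M M)) (x, y) * \<gamma> y)) \<le> \<bar>s * (k (x, y) * (indicator (space (M \<Otimes>\<^sub>M M)) (x, y) * \<gamma> y))\<bar>" by simp
          also have "\<dots> \<le> \<bar>k (x, y)\<bar> * \<gamma> y" using s \<gamma>0[of y] by (simp add: abs_mult indicator_def)
          finally show "s * (k (x, y) * (indicator (space (M \<Otimes>\<^sub>M M)) (x, y) * \<gamma> y)) \<le> \<bar>k (x, y)\<bar> * \<gamma> y" .
        qed
        also have "q x = ennreal (enn2real (q x))" using elim by (simp add: less_top)
        finally have "ennreal (v x) * (\<integral>\<^sup>+y. ennreal (s * (k (x, y) * (indicator (space (M \<Otimes>\<^sub>M M)) (x, y) * \<gamma> y))) \<partial>M)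
            \<le> ennreal (v x) * ennreal (enn2real (q x))" by (rule mult_left_mono) simp
        also have "\<dots> = ennreal (v x * enn2real (q x))" using v0[of x] by (simp add: ennreal_mult less_imp_le)
        also have "\<dots> \<le> ennreal (h x)"
        proof (rule ennreal_leI)
          have "0 < 1 + enn2real (q x)" by (intro add_pos_nonneg) auto
          then show "v x * enn2real (q x) \<le> h x" using h(2)[of x] by (simp add: v_def field_simps)
        qed
        finally show ?case .
      qed
    qed
    also have "\<dots> < \<infinity>" using h by (subst nn_integral_eq_integral) (auto simp: less_imp_le)
    finally show "emeasure (N s) (space (N s)) \<noteq> \<infinity>" by simp
  qed
  define \<Omega> where "\<Omega> = space M \<times> space M"
  define \<A> where "\<A> = {G. \<exists>p E. p \<in> measurable M (count_space (UNIV :: nat set)) \<and> (\<forall>i. E i \<in> sets M) \<and>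
    G = {z \<in> \<Omega>. snd z \<in> E (p (fst z))}}"
  have AI: "{z \<in> \<Omega>. snd z \<in> E (p (fst z))} \<in> \<A>"
    if "p \<in> measurable M (count_space (UNIV :: nat set))" "\<And>i. E i \<in> sets M" for p E
    using that unfolding \<A>_def by blast
  \<comment> \<open>Boolean operations act fibre by fibre; \<open>prod_encode\<close> merges the two
    countable labels of x into one.\<close>
  have binop: "{z \<in> \<Omega>. op (z \<in> G) (z \<in> G')} \<in> \<A>"
    if G: "G \<in> \<A>" "G' \<in> \<A>" and op: "\<And>A B. A \<in> sets M \<Longrightarrow> B \<in> sets M \<Longrightarrow> {y \<in> space M. op (y \<in> A) (y \<in> B)} \<in> sets M" for G G' op
  proof -
    obtain p E p' E' where p [measurable]: "p \<in> measurable M (count_space (UNIV :: nat set))"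
      "p' \<in> measurable M (count_space (UNIV :: nat set))" and E: "\<And>i. E i \<in> sets M" "\<And>i. E' i \<in> sets M"
      and GE: "G = {z \<in> \<Omega>. snd z \<in> E (p (fst z))}" "G' = {z \<in> \<Omega>. snd z \<in> E' (p' (fst z))}"
      using G unfolding \<A>_def by blast
    let ?p = "\<lambda>x. prod_encode (p x, p' x)"
    let ?E = "\<lambda>i. {y \<in> space M. op (y \<in> E (fst (prod_decode i))) (y \<in> E' (snd (prod_decode i)))}"
    have "{z \<in> \<Omega>. snd z \<in> ?E (?p (fst z))} \<in> \<A>"
    proof (rule AI)
      have "?p -` {i} \<inter> space M = (p -` {fst (prod_decode i)} \<inter> space M) \<inter> (p' -` {snd (prod_decode i)} \<inter> space M)" for i
        by (auto simp: prod_encode_inverse)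
      then show "?p \<in> measurable M (count_space UNIV)"
        by (subst measurable_count_space_eq2_countable) auto
      show "?E i \<in> sets M" for i by (intro op E)
    qed
    also have "{z \<in> \<Omega>. snd z \<in> ?E (?p (fst z))} = {z \<in> \<Omega>. op (z \<in> G) (z \<in> G')}"
      by (auto simp: GE \<Omega>_def)
    finally show ?thesis .
  qed
  have rect: "A \<times> B \<in> \<A>" if [measurable]: "A \<in> sets M" "B \<in> sets M" for A B
  proof -
    have "{z \<in> \<Omega>. snd z \<in> (if (if fst z \<in> A then 1 else 0 :: nat) = 1 then B else {})} \<in> \<A>"
      by (rule AI[where E = "\<lambda>i. if i = 1 then B else {}" and p = "\<lambda>x. if x \<in> A then 1 else 0"]) (measurable, auto)
    also have "{z \<in> \<Omega>. snd z \<in> (if (if fst z \<in> A then 1 else 0 :: nat) = 1 then B else {})} = A \<times> B"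
      using sets.sets_into_space[OF that(1)] sets.sets_into_space[OF that(2)] by (auto simp: \<Omega>_def split: if_splits)
    finally show ?thesis .
  qed
  have A_sets: "G \<in> sets (M \<Otimes>\<^sub>M M)" if GA: "G \<in> \<A>" for G
  proof -
    obtain p E where p [measurable]: "p \<in> measurable M (count_space (UNIV :: nat set))" and E [measurable]: "\<And>i. E i \<in> sets M"
      and G: "G = {z \<in> \<Omega>. snd z \<in> E (p (fst z))}"
      using GA unfolding \<A>_def by blast
    have "G = (\<Union>i. (p -` {i} \<inter> space M) \<times> E i)"
      using sets.sets_into_space[OF E] by (auto simp: G \<Omega>_def)
    also have "\<dots> \<in> sets (M \<Otimes>\<^sub>M M)" by measurable
    finally show ?thesis .
  qed
  have sub: "\<A> \<subseteq> Pow \<Omega>" unfolding \<A>_def by blast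
  have ring: "ring_of_sets \<Omega> \<A>"
    unfolding ring_of_sets_iff
  proof (intro conjI ballI)
    show "{} \<in> \<A>" using rect[of "{}" "{}"] by simp
    fix G G' assume G: "G \<in> \<A>" "G' \<in> \<A>"
    have "{z \<in> \<Omega>. z \<in> G \<or> z \<in> G'} \<in> \<A>"
    proof (rule binop[OF G])
      show "{y \<in> space M. y \<in> A \<or> y \<in> B} \<in> sets M" if [measurable]: "A \<in> sets M" "B \<in> sets M" for A B
        by measurable
    qed
    moreover have "{z \<in> \<Omega>. z \<in> G \<or> z \<in> G'} = G \<union> G'" using G sub by blast
    ultimately show "G \<union> G' \<in> \<A>" by simp
    have "{z \<in> \<Omega>. z \<in> G \<and> \<not> z \<in> G'} \<in> \<A>"
    proof (rule binop[OF G])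
      show "{y \<in> space M. y \<in> A \<and> \<not> y \<in> B} \<in> sets M" if [measurable]: "A \<in> sets M" "B \<in> sets M" for A B
        by measurable
    qed
    moreover have "{z \<in> \<Omega>. z \<in> G \<and> \<not> z \<in> G'} = G - G'" using G sub by blast
    ultimately show "G - G' \<in> \<A>" by simp
  qed (rule sub)
  have gen: "sets (M \<Otimes>\<^sub>M M) = sigma_sets \<Omega> \<A>"
  proof
    show "sets (M \<Otimes>\<^sub>M M) \<subseteq> sigma_sets \<Omega> \<A>"
      unfolding sets_pair_measure \<Omega>_def[symmetric] using rect by (intro sigma_sets_mono') auto
    show "sigma_sets \<Omega> \<A> \<subseteq> sets (M \<Otimes>\<^sub>M M)"
      using sets.sigma_sets_subset[of \<A> "M \<Otimes>\<^sub>M M"] A_sets by (auto simp: space_pair_measure \<Omega>_def)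
  qed
  \<comment> \<open>On the set where k < 0 the measure N 1 vanishes, hence so does N (-1), whose
    density is positive there. So the set is null.\<close>
  have "{p \<in> space (M \<Otimes>\<^sub>M M). k p < 0} \<in> sets (N (-1))" unfolding sets_N by measurable
  then have "emeasure (N (-1)) {p \<in> space (M \<Otimes>\<^sub>M M). k p < 0} \<le> emeasure (N 1) {p \<in> space (M \<Otimes>\<^sub>M M). k p < 0}"
  proof (rule emeasure_le_of_generating_algebra[OF ring _ fin _ fin, rotated -1])
    show "\<Omega> \<in> \<A>" unfolding \<Omega>_def by (rule rect) auto
    fix G assume "G \<in> \<A>"
    then obtain p E where p [measurable]: "p \<in> measurable M (count_space (UNIV :: nat set))" and E [measurable]: "\<And>i. E i \<in> sets M"
      and G: "G = {z \<in> \<Omega>. snd z \<in> E (p (fst z))}"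
      unfolding \<A>_def by blast
    have *: "AE x in M. \<forall>i. integrable M (\<lambda>y. k (x, y) * (indicator (E i) y * \<gamma> y)) \<and> 0 \<le> (\<integral>y. k (x, y) * (indicator (E i) y * \<gamma> y) \<partial>M)"
      unfolding AE_all_countable using pos_E[OF E] by simp
    have "AE x in M. ennreal (v x) * (\<integral>\<^sup>+y. ennreal (- 1 * (k (x, y) * (indicator G (x, y) * \<gamma> y))) \<partial>M)
        \<le> ennreal (v x) * (\<integral>\<^sup>+y. ennreal (1 * (k (x, y) * (indicator G (x, y) * \<gamma> y))) \<partial>M)"
      using * AE_space
    proof eventually_elim
      case (elim x)
      let ?u = "\<lambda>y. k (x, y) * (indicator (E (p x)) y * \<gamma> y)"
      have ind: "indicator G (x, y) = (indicator (E (p x)) y :: real)" if "y \<in> space M" for y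
        using elim(2) that by (auto simp: G \<Omega>_def indicator_def)
      have "(\<integral>\<^sup>+y. ennreal (- ?u y) \<partial>M) \<le> (\<integral>\<^sup>+y. ennreal (?u y) \<partial>M)"
        using elim(1) by (intro nn_integral_negative_part_le) auto
      also have "(\<integral>\<^sup>+y. ennreal (- ?u y) \<partial>M) = (\<integral>\<^sup>+y. ennreal (- 1 * (k (x, y) * (indicator G (x, y) * \<gamma> y))) \<partial>M)"
        by (intro nn_integral_cong) (simp add: ind)
      also have "(\<integral>\<^sup>+y. ennreal (?u y) \<partial>M) = (\<integral>\<^sup>+y. ennreal (1 * (k (x, y) * (indicator G (x, y) * \<gamma> y))) \<partial>M)"
        by (intro nn_integral_cong) (simp add: ind)
      finally show ?case by (rule mult_left_mono) simp
    qed
    then show "emeasure (N (-1)) G \<le> emeasure (N 1) G"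
      unfolding em[OF A_sets[OF \<open>G \<in> \<A>\<close>]] by (rule nn_integral_mono_AE)
  qed (simp_all add: sets_N gen)
  also have "emeasure (N 1) {p \<in> space (M \<Otimes>\<^sub>M M). k p < 0} = 0"
    unfolding N_def
    by (subst emeasure_density) (auto simp: nn_integral_0_iff_AE indicator_def ennreal_neg mult_nonpos_nonneg less_imp_le v0 \<gamma>0 intro!: AE_I2)
  finally have "emeasure (N (-1)) {p \<in> space (M \<Otimes>\<^sub>M M). k p < 0} = 0" by simp
  then have "AE p in M \<Otimes>\<^sub>M M. ennreal (- 1 * k p * (v (fst p) * \<gamma> (snd p))) * indicator {p \<in> space (M \<Otimes>\<^sub>M M). k p < 0} p = 0"
    unfolding N_def by (subst (asm) emeasure_density) (auto simp: nn_integral_0_iff_AE)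
  with AE_space show ?thesis
  proof eventually_elim
    case (elim p)
    show ?case
    proof (rule ccontr)
      assume "\<not> 0 \<le> k p"
      then have "0 < (- k p) * (v (fst p) * \<gamma> (snd p))"
        using v0 \<gamma>0 by (intro mult_pos_pos) (simp_all add: not_le)
      moreover have "ennreal ((- k p) * (v (fst p) * \<gamma> (snd p))) = 0"
        using elim \<open>\<not> 0 \<le> k p\<close> by (simp add: indicator_def)
      ultimately show False by (simp add: ennreal_eq_0_iff)
    qed
  qed
qed

section \<open>Uniqueness and positivity of kernels\<close>

lemma has_kernel_Re_integrable:
  assumes A: "has_kernel M rep A a"
  shows "AE x in M. integrable M (\<lambda>y. Re (a (x, y)) * cmod (rep f y)) \<and> integrable M (\<lambda>y. Im (a (x, y)) * cmod (rep f y)) \<and>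
    rep (A (modulus f)) x = Complex (\<integral>y. Re (a (x, y)) * cmod (rep f y) \<partial>M) (\<integral>y. Im (a (x, y)) * cmod (rep f y) \<partial>M)"
  using has_kernelD[OF A, of "modulus f"] AE_space
proof eventually_elim
  case (elim x)
  note [measurable] = has_kernel_measurable[OF A]
  have 1: "AE y in M. a (x, y) * rep (modulus f) y = a (x, y) * of_real (cmod (rep f y))"
    using rep_modulus[of f] by eventually_elim simp
  have "integrable M (\<lambda>y. a (x, y) * rep (modulus f) y) \<longleftrightarrow> integrable M (\<lambda>y. a (x, y) * of_real (cmod (rep f y)))"
    by (rule integrable_cong_AE[OF _ _ 1]) (use elim(2) in measurable)
  then have int: "integrable M (\<lambda>y. a (x, y) * of_real (cmod (rep f y)))" using elim(1) by simp
  have "(\<integral>y. a (x, y) * rep (modulus f) y \<partial>M) = (\<integral>y. a (x, y) * of_real (cmod (rep f y)) \<partial>M)"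
    by (rule integral_cong_AE[OF _ _ 1]) (use elim(2) in measurable)
  then have "rep (A (modulus f)) x = (\<integral>y. a (x, y) * of_real (cmod (rep f y)) \<partial>M)" using elim(1) by simp
  then show ?case
    using integrable_Re[OF int] integrable_Im[OF int] integral_Re[OF int] integral_Im[OF int]
    by (simp add: complex_eq_iff)
qed

text \<open>Two kernels of A differ by a kernel of 0, and \<open>kernel_nonneg_AE\<close> with both
  signs makes its real and imaginary parts vanish.\<close>

lemma kernel_AE_unique:
  assumes A: "has_kernel M rep A a" and B: "has_kernel M rep A b"
  shows "AE p in M \<Otimes>\<^sub>M M. a p = b p"
proof -
  note [measurable] = has_kernel_measurable[OF A] has_kernel_measurable[OF B]
  have D: "has_kernel M rep 0 (\<lambda>p. a p - b p)" using has_kernel_diff[OF A B] by simp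
  have z: "AE x in M. integrable M (\<lambda>y. Re (a (x, y) - b (x, y)) * cmod (rep f y)) \<and>
      integrable M (\<lambda>y. Im (a (x, y) - b (x, y)) * cmod (rep f y)) \<and>
      (\<integral>y. Re (a (x, y) - b (x, y)) * cmod (rep f y) \<partial>M) = 0 \<and> (\<integral>y. Im (a (x, y) - b (x, y)) * cmod (rep f y) \<partial>M) = 0" for f
    using has_kernel_Re_integrable[OF D, of f] rep_zero by eventually_elim (simp add: zero_complex.ctr)
  have "AE p in M \<Otimes>\<^sub>M M. 0 \<le> s * Re (a p - b p)" for s
    apply (rule kernel_nonneg_AE, measurable)
    subgoal for f using z[of f] by eventually_elim (simp add: mult.assoc del: minus_complex.simps)
    done
  from this[of 1] this[of "-1"] have re: "AE p in M \<Otimes>\<^sub>M M. Re (a p - b p) = 0" by eventually_elim simp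
  have "AE p in M \<Otimes>\<^sub>M M. 0 \<le> s * Im (a p - b p)" for s
    apply (rule kernel_nonneg_AE, measurable)
    subgoal for f using z[of f] by eventually_elim (simp add: mult.assoc del: minus_complex.simps)
    done
  from this[of 1] this[of "-1"] have "AE p in M \<Otimes>\<^sub>M M. Im (a p - b p) = 0" by eventually_elim simp
  with re show ?thesis by eventually_elim (simp add: complex_eq_iff)
qed

text \<open>Positivity of A gives a sign for each f off a null set that depends on f;
  \<open>kernel_nonneg_AE\<close> turns this into a sign of the kernel itself.\<close>

lemma positive_kernel_nonneg:
  assumes pos: "\<forall>f\<in>fun_nonneg M rep. blinfun_apply A f \<in> fun_nonneg M rep" and A: "has_kernel M rep A a"
  shows "nn_kernel A (\<lambda>p. cmod (a p))"
proof -
  note [measurable] = has_kernel_measurable[OF A]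
  have z: "AE x in M. integrable M (\<lambda>y. Re (a (x, y)) * cmod (rep f y)) \<and>
      integrable M (\<lambda>y. Im (a (x, y)) * cmod (rep f y)) \<and>
      (\<integral>y. Re (a (x, y)) * cmod (rep f y) \<partial>M) \<ge> 0 \<and> (\<integral>y. Im (a (x, y)) * cmod (rep f y) \<partial>M) = 0" for f
  proof -
    have "AE x in M. rep (A (modulus f)) x \<in> \<real>\<^sub>\<ge>\<^sub>0"
      using pos modulus_nonneg[of f] by (auto simp: fun_nonneg_def)
    then show ?thesis
      using has_kernel_Re_integrable[OF A, of f] by eventually_elim (simp add: complex_nonneg_Reals_iff)
  qed
  have re: "AE p in M \<Otimes>\<^sub>M M. 0 \<le> Re (a p)"
    apply (rule kernel_nonneg_AE, measurable)
    subgoal for f using z[of f] by eventually_elim (simp)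
    done
  have "AE p in M \<Otimes>\<^sub>M M. 0 \<le> s * Im (a p)" for s
    apply (rule kernel_nonneg_AE, measurable)
    subgoal for f using z[of f] by eventually_elim (simp add: mult.assoc)
    done
  from this[of 1] this[of "-1"] re have "AE p in M \<Otimes>\<^sub>M M. a p = of_real (cmod (a p))"
    by eventually_elim (simp add: complex_eq_iff cmod_eq_Re)
  then have "has_kernel M rep A (\<lambda>p. of_real (cmod (a p)))" by (intro has_kernel_cong_AE[OF A]) auto
  then show ?thesis by (simp add: nn_kernel_def)
qed

lemma nn_kernel_nonneg:
  assumes A: "nn_kernel A k" and f: "f \<in> fun_nonneg M rep"
  shows "A f \<in> fun_nonneg M rep"
proof -
  have "modulus f = f"
    by (rule rep_inject) (use rep_modulus[of f] f[unfolded nonneg_iff] in eventually_elim, simp)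
  then have "AE x in M. rep (A f) x = of_real (\<integral>y. k (x, y) * cmod (rep f y) \<partial>M)"
    using nn_kernel_modulus[OF A, of f] by (auto elim!: AE_mp)
  then show ?thesis
    unfolding fun_nonneg_def mem_Collect_eq
    by eventually_elim (auto intro!: integral_nonneg_AE simp: nn_kernelD(2)[OF A])
qed

lemma positive_kernel_operator_iff: "positive_kernel_operator M rep A \<longleftrightarrow> (\<exists>k. nn_kernel A k)"
proof
  show "positive_kernel_operator M rep A \<Longrightarrow> \<exists>k. nn_kernel A k"
    unfolding positive_kernel_operator_def using positive_kernel_nonneg by blast
  show "\<exists>k. nn_kernel A k \<Longrightarrow> positive_kernel_operator M rep A"
    unfolding positive_kernel_operator_def
    using nn_kernel_nonneg nn_kernelD(3) has_kernel_complex_linear by blast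
qed

lemma nn_kernel_cmod_le:
  assumes A: "nn_kernel A k"
  shows "AE x in M. cmod (rep (A f) x) \<le> cmod (rep (A (modulus f)) x)"
  using nn_kernel_modulus[OF A, of f] has_kernelD[OF nn_kernelD(3)[OF A], of f]
proof eventually_elim
  case (elim x)
  have "cmod (rep (A f) x) \<le> (\<integral>y. norm (of_real (k (x, y)) * rep f y) \<partial>M)"
    using elim by (simp add: integral_norm_bound)
  also have "\<dots> = (\<integral>y. k (x, y) * cmod (rep f y) \<partial>M)" by (simp add: norm_mult nn_kernelD(2)[OF A])
  also have "\<dots> \<le> cmod (rep (A (modulus f)) x)" using elim by simp
  finally show ?case .
qed

end

section \<open>Compact approximation of positive kernel operators\<close>

locale order_continuous_function_space = banach_function_space M rep
  for M :: "'a measure" and rep :: "'l::banach \<Rightarrow> 'a \<Rightarrow> complex" +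
  assumes order_continuous: "order_continuous_norm (fun_nonneg M rep)"
    and dual_order_continuous: "order_continuous_norm (dual_nonneg M rep)"
begin

text \<open>One fixed weight embeds L contractively into the weighted L^1 space, where convergence
  yields a.e. convergent subsequences.\<close>

definition weight :: "'a \<Rightarrow> real" where
  "weight = (SOME w. w \<in> borel_measurable M \<and> (\<forall>x. 0 < w x) \<and>
    (\<forall>f. (\<integral>\<^sup>+x. ennreal (cmod (rep f x) * w x) \<partial>M) \<le> ennreal (norm f)))"

lemma weight: "weight \<in> borel_measurable M" "0 < weight x"
  "(\<integral>\<^sup>+x. ennreal (cmod (rep f x) * weight x) \<partial>M) \<le> ennreal (norm f)"
proof -
  have "\<exists>w. w \<in> borel_measurable M \<and> (\<forall>x. 0 < w x) \<and>
    (\<forall>f. (\<integral>\<^sup>+x. ennreal (cmod (rep f x) * w x) \<partial>M) \<le> ennreal (norm f))"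
    using ex_weight[OF order_continuous] by metis
  from someI_ex[OF this] show "weight \<in> borel_measurable M" "0 < weight x"
    "(\<integral>\<^sup>+x. ennreal (cmod (rep f x) * weight x) \<partial>M) \<le> ennreal (norm f)"
    unfolding weight_def by blast+
qed

declare weight(1) [measurable]

definition unit_fun :: "'a \<Rightarrow> real" where
  "unit_fun = (SOME \<gamma>. \<gamma> \<in> borel_measurable M \<and> (\<forall>x. 0 < \<gamma> x) \<and> (\<exists>g. AE x in M. rep g x = of_real (\<gamma> x)))"

lemma unit_fun: "unit_fun \<in> borel_measurable M" "0 < unit_fun x" "\<exists>g. AE x in M. rep g x = of_real (unit_fun x)"
proof -
  have "\<exists>\<gamma>. \<gamma> \<in> borel_measurable M \<and> (\<forall>x. 0 < (\<gamma> x :: real)) \<and> (\<exists>g. AE x in M. rep g x = of_real (\<gamma> x))"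
    using ex_weak_unit by metis
  from someI_ex[OF this] show "unit_fun \<in> borel_measurable M" "0 < unit_fun x" "\<exists>g. AE x in M. rep g x = of_real (unit_fun x)"
    unfolding unit_fun_def by blast+
qed

declare unit_fun(1) [measurable]

definition unit_elem :: 'l where "unit_elem = (SOME g. AE x in M. rep g x = of_real (unit_fun x))"

lemma rep_unit_elem: "AE x in M. rep unit_elem x = of_real (unit_fun x)"
  unfolding unit_elem_def using someI_ex[OF unit_fun(3)] .

lemma integrable_weight: "integrable M (\<lambda>x. rep f x * of_real (weight x))"
  and integral_weight_le: "(\<integral>x. norm (rep f x * of_real (weight x)) \<partial>M) \<le> norm f"
proof -
  have e: "norm (rep f x * of_real (weight x)) = cmod (rep f x) * weight x" for x
    using weight(2)[of x] by (simp add: norm_mult)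
  have "(\<integral>\<^sup>+x. ennreal (norm (rep f x * of_real (weight x))) \<partial>M) \<le> ennreal (norm f)"
    unfolding e by (rule weight(3))
  moreover from this show "integrable M (\<lambda>x. rep f x * of_real (weight x))"
    by (intro integrableI_bounded) (auto intro: le_less_trans)
  ultimately have "ennreal (\<integral>x. norm (rep f x * of_real (weight x)) \<partial>M) \<le> ennreal (norm f)"
    by (subst nn_integral_eq_integral[symmetric]) auto
  then show "(\<integral>x. norm (rep f x * of_real (weight x)) \<partial>M) \<le> norm f" by simp
qed

text \<open>A strictly positive element of the Banach dual; composing it with operators brings order
  continuity of the dual norm to bear on them.\<close>

definition wint :: "'l \<Rightarrow>\<^sub>L complex" where "wint = Blinfun (\<lambda>f. \<integral>x. rep f x * of_real (weight x) \<partial>M)"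

lemma wint: "wint f = (\<integral>x. rep f x * of_real (weight x) \<partial>M)" and wint_le: "cmod (wint f) \<le> norm f"
proof -
  have le: "cmod (\<integral>x. rep f x * of_real (weight x) \<partial>M) \<le> norm f" for f
    by (rule order_trans[OF integral_norm_bound integral_weight_le])
  have "bounded_linear (\<lambda>f. \<integral>x. rep f x * of_real (weight x) \<partial>M)"
  proof (rule bounded_linear_intro)
    fix f g
    have "(\<integral>x. rep (f + g) x * of_real (weight x) \<partial>M) = (\<integral>x. rep f x * of_real (weight x) + rep g x * of_real (weight x) \<partial>M)"
      by (rule integral_cong_AE) (use rep_add[of f g] in \<open>measurable, auto elim!: AE_mp simp: distrib_right\<close>)
    then show "(\<integral>x. rep (f + g) x * of_real (weight x) \<partial>M) = (\<integral>x. rep f x * of_real (weight x) \<partial>M) + (\<integral>x. rep g x * of_real (weight x) \<partial>M)"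
      by (simp add: integrable_weight)
    fix r
    have "(\<integral>x. rep (r *\<^sub>R f) x * of_real (weight x) \<partial>M) = (\<integral>x. of_real r * (rep f x * of_real (weight x)) \<partial>M)"
      by (rule integral_cong_AE) (use rep_scaleR[of r f] in \<open>measurable, auto elim!: AE_mp simp: mult_ac\<close>)
    then show "(\<integral>x. rep (r *\<^sub>R f) x * of_real (weight x) \<partial>M) = r *\<^sub>R (\<integral>x. rep f x * of_real (weight x) \<partial>M)"
      by (simp add: scaleR_conv_of_real)
    show "norm (\<integral>x. rep f x * of_real (weight x) \<partial>M) \<le> norm f * 1" using le[of f] by simp
  qed
  then show "wint f = (\<integral>x. rep f x * of_real (weight x) \<partial>M)" by (simp add: wint_def bounded_linear_Blinfun_apply)
  with le show "cmod (wint f) \<le> norm f" by simp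
qed

lemma wint_cscale: "wint (cscale M rep c f) = c * wint f"
proof -
  have "(\<integral>x. rep (cscale M rep c f) x * of_real (weight x) \<partial>M) = (\<integral>x. c * (rep f x * of_real (weight x)) \<partial>M)"
    by (rule integral_cong_AE) (use ae_rep_cscale[of c f] in \<open>measurable, auto elim!: AE_mp simp: mult_ac\<close>)
  then show ?thesis by (simp add: wint)
qed

lemma wint_nonneg:
  assumes "f \<in> fun_nonneg M rep"
  shows "wint f = of_real (\<integral>x. norm (rep f x * of_real (weight x)) \<partial>M)"
proof -
  have "wint f = (\<integral>x. complex_of_real (norm (rep f x * of_real (weight x))) \<partial>M)"
    unfolding wint
  proof (rule integral_cong_AE)
    show "AE x in M. rep f x * of_real (weight x) = complex_of_real (norm (rep f x * of_real (weight x)))"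
      using assms[unfolded nonneg_iff]
    proof eventually_elim
      case (elim x)
      have "rep f x * of_real (weight x) = of_real (cmod (rep f x)) * of_real (weight x)" using elim by metis
      also have "\<dots> = of_real (norm (rep f x * of_real (weight x)))"
        using weight(2)[of x] by (simp add: norm_mult)
      finally show ?case .
    qed
  qed measurable
  then show ?thesis by simp
qed

section \<open>Kernels decreasing to 0\<close>

lemma nn_kernel_mono:
  assumes A: "nn_kernel A a" and B: "nn_kernel B b" and le: "AE p in M \<Otimes>\<^sub>M M. a p \<le> b p"
  shows "AE x in M. cmod (rep (A (modulus f)) x) \<le> cmod (rep (B (modulus f)) x)"
  using nn_kernel_modulus[OF A, of f] nn_kernel_modulus[OF B, of f] pair.AE_pair[OF le]
proof eventually_elim
  case (elim x)
  have "(\<integral>y. a (x, y) * cmod (rep f y) \<partial>M) \<le> (\<integral>y. b (x, y) * cmod (rep f y) \<partial>M)"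
    using elim by (intro integral_mono_AE) (auto elim!: AE_mp intro!: mult_right_mono)
  moreover have "0 \<le> (\<integral>y. a (x, y) * cmod (rep f y) \<partial>M)"
    by (intro integral_nonneg_AE) (auto simp: nn_kernelD(2)[OF A])
  ultimately show ?case using elim(1,2) by simp
qed

text \<open>Dominated convergence in y makes D n |f| tend to 0 pointwise, and order continuity of
  the norm turns this into norm convergence.\<close>

lemma nn_kernel_norm_tendsto:
  assumes D: "\<And>n::nat. nn_kernel (D n) (d n)"
    and dec: "AE p in M \<Otimes>\<^sub>M M. \<forall>n. d n p \<le> d 0 p"
    and lim: "AE p in M \<Otimes>\<^sub>M M. (\<lambda>n. d n p) \<longlonglongrightarrow> 0"
  shows "(\<lambda>n. norm (D n f)) \<longlonglongrightarrow> 0"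
proof -
  have "(\<lambda>n. norm (D n (modulus f))) \<longlonglongrightarrow> 0"
  proof (rule dominated_convergence_norm[OF order_continuous, where u = "D 0 (modulus f)"])
    show "AE x in M. cmod (rep (D n (modulus f)) x) \<le> cmod (rep (D 0 (modulus f)) x)" for n
      by (rule nn_kernel_mono[OF D D]) (use dec in \<open>auto elim!: AE_mp\<close>)
    have "AE x in M. \<forall>n. integrable M (\<lambda>y. d n (x, y) * cmod (rep f y)) \<and>
        rep (D n (modulus f)) x = of_real (\<integral>y. d n (x, y) * cmod (rep f y) \<partial>M)"
      unfolding AE_all_countable using nn_kernel_modulus[OF D] by simp
    then show "AE x in M. (\<lambda>n. rep (D n (modulus f)) x) \<longlonglongrightarrow> 0"
      using pair.AE_pair[OF dec] pair.AE_pair[OF lim] AE_space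
    proof eventually_elim
      case (elim x)
      have [measurable]: "d n \<in> borel_measurable (M \<Otimes>\<^sub>M M)" for n by (rule nn_kernelD(1)[OF D])
      have "(\<lambda>n. \<integral>y. d n (x, y) * cmod (rep f y) \<partial>M) \<longlonglongrightarrow> (\<integral>y. 0 \<partial>M)"
      proof (rule integral_dominated_convergence[where w = "\<lambda>y. d 0 (x, y) * cmod (rep f y)"])
        show "AE y in M. (\<lambda>n. d n (x, y) * cmod (rep f y)) \<longlonglongrightarrow> 0"
          using elim(3) by eventually_elim (auto intro!: tendsto_eq_intros)
        show "AE y in M. norm (d n (x, y) * cmod (rep f y)) \<le> d 0 (x, y) * cmod (rep f y)" for n
          using elim(2) by eventually_elim (auto simp: abs_mult nn_kernelD(2)[OF D] intro!: mult_right_mono)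
      qed (use elim in \<open>simp_all, measurable\<close>)
      then have "(\<lambda>n. complex_of_real (\<integral>y. d n (x, y) * cmod (rep f y) \<partial>M)) \<longlonglongrightarrow> of_real 0"
        by (intro tendsto_of_real) simp
      then show ?case using elim(1) by simp
    qed
  qed
  moreover have "norm (norm (D n f)) \<le> norm (D n (modulus f))" for n
    using norm_le[OF nn_kernel_cmod_le[OF D]] by simp
  ultimately show ?thesis by (rule Lim_null_comparison[OF always_eventually[OF allI], rotated])
qed

lemma wint_compose_dual_nonneg:
  assumes A: "nn_kernel A k"
  shows "wint o\<^sub>L A \<in> dual_nonneg M rep"
  unfolding dual_nonneg_def
proof (intro CollectI conjI allI ballI)
  show "(wint o\<^sub>L A) (cscale M rep c f) = c * (wint o\<^sub>L A) f" for c f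
    using has_kernel_complex_linear[OF nn_kernelD(3)[OF A]] by (simp add: complex_linear_def wint_cscale)
  show "(wint o\<^sub>L A) f \<in> \<real>\<^sub>\<ge>\<^sub>0" if "f \<in> fun_nonneg M rep" for f
    using wint_nonneg[OF nn_kernel_nonneg[OF A that]] by simp
qed

text \<open>The functionals wint (D n f) of f decrease, and as D n f tends to 0 for each f, every
  lower bound is at most 0. Order continuity of the dual norm upgrades this to convergence uniform
  on the unit ball.\<close>

lemma wint_compose_tendsto:
  assumes D: "\<And>n::nat. nn_kernel (D n) (d n)"
    and dec: "\<And>n. AE p in M \<Otimes>\<^sub>M M. d (Suc n) p \<le> d n p"
    and lim: "AE p in M \<Otimes>\<^sub>M M. (\<lambda>n. d n p) \<longlonglongrightarrow> 0"
  shows "(\<lambda>n. norm (wint o\<^sub>L D n)) \<longlonglongrightarrow> 0"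
proof -
  have [measurable]: "d n \<in> borel_measurable (M \<Otimes>\<^sub>M M)" for n by (rule nn_kernelD(1)[OF D])
  have dec0: "AE p in M \<Otimes>\<^sub>M M. \<forall>n. d n p \<le> d 0 p"
  proof -
    have "AE p in M \<Otimes>\<^sub>M M. \<forall>n. d (Suc n) p \<le> d n p" unfolding AE_all_countable using dec by simp
    then show ?thesis by eventually_elim (meson decseq_SucI decseqD le0)
  qed
  have "(\<forall>n. wint o\<^sub>L D n \<in> dual_nonneg M rep) \<and> (\<forall>n. (wint o\<^sub>L D n) - (wint o\<^sub>L D (Suc n)) \<in> dual_nonneg M rep) \<and>
      (\<forall>\<psi>. (\<forall>n. (wint o\<^sub>L D n) - \<psi> \<in> dual_nonneg M rep) \<longrightarrow> 0 - \<psi> \<in> dual_nonneg M rep)"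
  proof (intro conjI allI impI)
    show "wint o\<^sub>L D n \<in> dual_nonneg M rep" for n by (rule wint_compose_dual_nonneg[OF D])
    show "(wint o\<^sub>L D n) - (wint o\<^sub>L D (Suc n)) \<in> dual_nonneg M rep" for n
    proof -
      have "has_kernel M rep (D n - D (Suc n)) (\<lambda>p. of_real (max 0 (d n p - d (Suc n) p)))"
      proof (rule has_kernel_cong_AE[OF has_kernel_diff[OF nn_kernelD(3)[OF D] nn_kernelD(3)[OF D]]])
        show "AE p in M \<Otimes>\<^sub>M M. of_real (d n p) - of_real (d (Suc n) p) = complex_of_real (max 0 (d n p - d (Suc n) p))"
          using dec[of n] by eventually_elim (simp add: max_def)
      qed measurable
      then have "nn_kernel (D n - D (Suc n)) (\<lambda>p. max 0 (d n p - d (Suc n) p))" by (simp add: nn_kernel_def)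
      from wint_compose_dual_nonneg[OF this] show ?thesis
        by (simp add: bounded_bilinear.diff_right[OF bounded_bilinear_blinfun_compose])
    qed
    fix \<psi> :: "'l \<Rightarrow>\<^sub>L complex" assume \<psi>: "\<forall>n. (wint o\<^sub>L D n) - \<psi> \<in> dual_nonneg M rep"
    show "0 - \<psi> \<in> dual_nonneg M rep"
      unfolding dual_nonneg_def
    proof (intro CollectI conjI allI ballI)
      show "(0 - \<psi>) (cscale M rep c f) = c * (0 - \<psi>) f" for c f
        using \<psi>[rule_format, of 0] wint_compose_dual_nonneg[OF D, of 0]
        by (simp add: dual_nonneg_def blinfun.bilinear_simps algebra_simps)
      fix f assume f: "f \<in> fun_nonneg M rep"
      have "norm (wint (D n f)) \<le> norm (D n f)" for n by (rule wint_le)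
      then have "(\<lambda>n. wint (D n f)) \<longlonglongrightarrow> 0"
        by (rule Lim_null_comparison[OF always_eventually[OF allI]]) (rule nn_kernel_norm_tendsto[OF D dec0 lim])
      then have "(\<lambda>n. wint (D n f) - \<psi> f) \<longlonglongrightarrow> 0 - \<psi> f" by (intro tendsto_diff tendsto_const)
      moreover have "wint (D n f) - \<psi> f \<in> \<real>\<^sub>\<ge>\<^sub>0" for n
        using \<psi>[rule_format, of n] f by (simp add: dual_nonneg_def blinfun.bilinear_simps)
      ultimately have "0 - \<psi> f \<in> \<real>\<^sub>\<ge>\<^sub>0"
        by (rule closed_sequentially[OF closed_nonneg_Reals_complex, rotated])
      then show "(0 - \<psi>) f \<in> \<real>\<^sub>\<ge>\<^sub>0" by (simp only: blinfun.diff_left blinfun.zero_left)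
    qed
  qed
  from mp[OF spec[OF dual_order_continuous[unfolded order_continuous_norm_def], of "\<lambda>n. wint o\<^sub>L D n"] this]
  show ?thesis .
qed

text \<open>T maps the nonnegative part of the unit ball into an order interval enlarged by a ball
  of radius \<delta>. Unlike an estimate of \<open>\<beta>\<close>, this passes to dominated
  operators at once.\<close>

definition order_approx :: "('l \<Rightarrow>\<^sub>L 'l) \<Rightarrow> 'l \<Rightarrow> real \<Rightarrow> bool" where
  "order_approx T u \<delta> \<longleftrightarrow> (\<forall>f\<in>fun_nonneg M rep. norm f \<le> 1 \<longrightarrow>
    (\<exists>h. norm h \<le> \<delta> \<and> (AE x in M. cmod (rep (T f) x) \<le> cmod (rep u x) + cmod (rep h x))))"

text \<open>
  If \<open>f n\<close> almost attains the norm of \<open>D n\<close>, then \<open>D n (f n)\<close> tends to \<open>0\<close> in \<open>L\<^sup>1\<close> for the weight by order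
  continuity of the dual norm, hence its part below \<open>u\<close> tends to \<open>0\<close> in norm along a subsequence by
  order continuity of the norm. What remains has norm at most \<open>\<delta>\<close>.
\<close>

lemma decreasing_kernels_norm:
  assumes D: "\<And>n::nat. nn_kernel (D n) (d n)"
    and dec: "\<And>n. AE p in M \<Otimes>\<^sub>M M. d (Suc n) p \<le> d n p"
    and lim: "AE p in M \<Otimes>\<^sub>M M. (\<lambda>n. d n p) \<longlonglongrightarrow> 0"
    and approx: "order_approx (D 0) u \<delta>" and \<delta>: "0 \<le> \<delta>" and \<epsilon>: "0 < \<epsilon>"
  shows "\<exists>n. norm (D n) \<le> \<delta> + \<epsilon>"
proof (rule ccontr)
  assume "\<not> ?thesis"
  then have big: "\<delta> + \<epsilon> < norm (D n)" for n by (simp add: not_le)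
  have "\<exists>f. norm f \<le> 1 \<and> \<delta> + \<epsilon> < norm (D n f)" for n
  proof -
    obtain f where f: "(\<delta> + \<epsilon>) * norm f < norm (D n f)"
      using big[of n] norm_blinfun_bound[of "\<delta> + \<epsilon>" "D n"] \<delta> \<epsilon> by (meson add_nonneg_nonneg less_imp_le not_le)
    then have "f \<noteq> 0" by auto
    then have "norm (D n ((1 / norm f) *\<^sub>R f)) > \<delta> + \<epsilon>" using f by (simp add: blinfun.bilinear_simps field_simps)
    moreover have "norm ((1 / norm f) *\<^sub>R f) \<le> 1" using \<open>f \<noteq> 0\<close> by simp
    ultimately show ?thesis by blast
  qed
  then obtain f where f: "\<And>n. norm (f n) \<le> 1" "\<And>n. \<delta> + \<epsilon> < norm (D n (f n))" by metis
  define F where "F n = D n (modulus (f n))" for n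
  have F_nn: "F n \<in> fun_nonneg M rep" for n
    unfolding F_def by (intro nn_kernel_nonneg[OF D] modulus_nonneg)
  have norm_F: "\<delta> + \<epsilon> < norm (F n)" for n
    using f(2)[of n] norm_le[OF nn_kernel_cmod_le[OF D, of n "f n"]] by (simp add: F_def)
  have "\<exists>h. norm h \<le> \<delta> \<and> (AE x in M. cmod (rep (D 0 (modulus (f n))) x) \<le> cmod (rep u x) + cmod (rep h x))" for n
    using approx f(1)[of n] modulus_nonneg[of "f n"] unfolding order_approx_def by simp
  then obtain h where h: "\<And>n. norm (h n) \<le> \<delta>"
    "\<And>n. AE x in M. cmod (rep (D 0 (modulus (f n))) x) \<le> cmod (rep u x) + cmod (rep (h n) x)" by metis
  have dec0: "AE p in M \<Otimes>\<^sub>M M. d n p \<le> d 0 p" for n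
  proof (induction n)
    case (Suc n)
    with dec[of n] show ?case by eventually_elim simp
  qed simp
  have F_le: "AE x in M. cmod (rep (F n) x) \<le> cmod (rep u x) + cmod (rep (h n) x)" for n
    using nn_kernel_mono[OF D D dec0, of n "f n"] h(2)[of n] unfolding F_def by eventually_elim simp
  \<comment> \<open>s n is the part of F n below |u|. From F n \<le> s n + |h n| its norm stays
    above \<epsilon>, which contradicts convergence to 0 along a subsequence.\<close>
  define s where "s n = emb (\<lambda>x. of_real (min (cmod (rep (F n) x)) (cmod (rep u x))))" for n
  have rep_s: "AE x in M. rep (s n) x = of_real (min (cmod (rep (F n) x)) (cmod (rep u x)))" for n
    unfolding s_def by (rule rep_emb[where f = u]) auto
  have norm_s: "\<epsilon> < norm (s n)" for n
  proof -
    have "norm (F n) \<le> norm (s n + modulus (h n))"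
    proof (rule norm_le)
      show "AE x in M. cmod (rep (F n) x) \<le> cmod (rep (s n + modulus (h n)) x)"
        using F_le[of n] rep_s[of n] rep_modulus[of "h n"] rep_add[of "s n" "modulus (h n)"]
      proof eventually_elim
        case (elim x)
        then have "rep (s n + modulus (h n)) x = of_real (min (cmod (rep (F n) x)) (cmod (rep u x)) + cmod (rep (h n) x))" by simp
        then have "cmod (rep (s n + modulus (h n)) x) = min (cmod (rep (F n) x)) (cmod (rep u x)) + cmod (rep (h n) x)"
          by (simp only: norm_of_real) simp
        then show ?case using elim(1) norm_ge_zero[of "rep (h n) x"] by (simp add: min_def del: norm_ge_zero)
      qed
    qed
    also have "\<dots> \<le> norm (s n) + \<delta>" using norm_triangle_ineq[of "s n" "modulus (h n)"] h(1)[of n] by simp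
    finally show ?thesis using norm_F[of n] by simp
  qed
  have "(\<lambda>n. \<integral>x. norm (rep (F n) x * of_real (weight x)) \<partial>M) \<longlonglongrightarrow> 0"
  proof (rule Lim_null_comparison[OF always_eventually[OF allI] wint_compose_tendsto[OF D dec lim]])
    fix n
    have "norm (\<integral>x. norm (rep (F n) x * of_real (weight x)) \<partial>M) = cmod (wint (F n))"
      by (simp add: wint_nonneg[OF F_nn])
    also have "\<dots> \<le> norm (wint o\<^sub>L D n) * norm (modulus (f n))"
      using norm_blinfun[of "wint o\<^sub>L D n" "modulus (f n)"] by (simp add: F_def)
    also have "\<dots> \<le> norm (wint o\<^sub>L D n)" using f(1)[of n] by (simp add: mult_left_le)
    finally show "norm (\<integral>x. norm (rep (F n) x * of_real (weight x)) \<partial>M) \<le> norm (wint o\<^sub>L D n)" .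
  qed
  from tendsto_L1_AE_subseq[OF integrable_weight this] obtain r :: "nat \<Rightarrow> nat"
    where r: "AE x in M. (\<lambda>n. rep (F (r n)) x * of_real (weight x)) \<longlonglongrightarrow> 0" by blast
  have "(\<lambda>n. norm (s (r n))) \<longlonglongrightarrow> 0"
  proof (rule dominated_convergence_norm[OF order_continuous])
    show "AE x in M. cmod (rep (s (r n)) x) \<le> cmod (rep u x)" for n
      using rep_s[of "r n"] by eventually_elim simp
    have "AE x in M. \<forall>n. rep (s (r n)) x = of_real (min (cmod (rep (F (r n)) x)) (cmod (rep u x)))"
      unfolding AE_all_countable using rep_s by simp
    with r show "AE x in M. (\<lambda>n. rep (s (r n)) x) \<longlonglongrightarrow> 0"
    proof eventually_elim
      case (elim x)
      have "(\<lambda>n. (rep (F (r n)) x * of_real (weight x)) * of_real (1 / weight x)) \<longlonglongrightarrow> 0 * of_real (1 / weight x)"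
        by (intro tendsto_mult elim tendsto_const)
      then have "(\<lambda>n. rep (F (r n)) x) \<longlonglongrightarrow> 0" using weight(2)[of x] by simp
      then have *: "(\<lambda>n. cmod (rep (F (r n)) x)) \<longlonglongrightarrow> 0" by (rule tendsto_norm_zero)
      show ?case
        by (rule Lim_null_comparison[OF always_eventually[OF allI] *]) (simp add: elim(2))
    qed
  qed
  then show False using \<epsilon> norm_s LIMSEQ_le_const[of "\<lambda>n. norm (s (r n))" 0 \<epsilon>] by (force simp: less_imp_le)
qed

section \<open>Compactness of operators with simple kernels\<close>

lemma has_kernel_sum:
  assumes "\<And>i. i \<in> I \<Longrightarrow> has_kernel M rep (A i) (a i)"
  shows "has_kernel M rep (sum A I) (\<lambda>p. \<Sum>i\<in>I. a i p)"
  using assms by (induction I rule: infinite_finite_induct) (auto intro: has_kernel_zero has_kernel_add)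

lemma hausdorff_noncompactness_sum_eq_0:
  fixes A :: "'i \<Rightarrow> 'l \<Rightarrow>\<^sub>L 'l"
  assumes "\<And>i. i \<in> I \<Longrightarrow> \<beta> (A i) = 0"
  shows "\<beta> (sum A I) = 0"
  using assms
proof (induction I rule: infinite_finite_induct)
  case (insert i I)
  then show ?case
    using hausdorff_noncompactness_triangle[of "A i" "sum A I"] hausdorff_noncompactness_nonneg[of "A i + sum A I"] by simp
qed (use calkin.zero in \<open>simp_all add: op_of_simps\<close>)

lemma hausdorff_noncompactness_scaleR_eq_0: "\<beta> A = 0 \<Longrightarrow> \<beta> (c *\<^sub>R A) = 0" for A :: "'l \<Rightarrow>\<^sub>L 'l"
proof -
  assume "\<beta> A = 0"
  moreover have "c *\<^sub>R A = (c *\<^sub>R id_blinfun) o\<^sub>L A" by (rule blinfun_eqI) (simp add: blinfun.bilinear_simps)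
  ultimately show ?thesis
    using hausdorff_noncompactness_compose[of "c *\<^sub>R id_blinfun" A] hausdorff_noncompactness_nonneg[of "c *\<^sub>R A"] by simp
qed

lemma rank_one_compact:
  fixes H :: "'l \<Rightarrow>\<^sub>L 'l"
  assumes H: "\<And>f. norm f \<le> 1 \<Longrightarrow> \<exists>c. cmod c \<le> 1 \<and> H f = cscale M rep c v"
  shows "\<beta> H = 0"
proof -
  have diff: "cscale M rep c v - cscale M rep d v = cscale M rep (c - d) v" for c d
    using calkin.scalar_diff[of c d] by (metis blinfun.diff_left op_of_scalar op_of_simps(2))
  have "(norm v)-lipschitz_on (cball 0 1) (\<lambda>c. cscale M rep c v)"
    by (rule lipschitz_onI) (auto simp: dist_norm diff norm_cscale mult.commute)
  then have "continuous_on (cball 0 1) (\<lambda>c. cscale M rep c v)" by (rule lipschitz_on_continuous_on)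
  then have c: "compact ((\<lambda>c. cscale M rep c v) ` cball 0 1)" by (rule compact_continuous_image) simp
  have sub: "H ` cball 0 1 \<subseteq> (\<lambda>c. cscale M rep c v) ` cball 0 1"
    using H by fastforce
  have "compact ((\<lambda>c. cscale M rep c v) ` cball 0 1 \<inter> closure (H ` cball 0 1))"
    using c by (rule compact_Int_closed) simp
  also have "(\<lambda>c. cscale M rep c v) ` cball 0 1 \<inter> closure (H ` cball 0 1) = closure (H ` cball 0 1)"
    using closure_minimal[OF sub compact_imp_closed[OF c]] by blast
  finally show ?thesis by (simp add: compact_operator_def flip: compact_operator_iff)
qed

text \<open>A strictly positive rank-one kernel. Every kernel has a density with respect to it, and
  its product with the indicator of any measurable set defines an operator on L.\<close>

abbreviation dominating_kernel :: "'a \<times> 'a \<Rightarrow> real" where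
  "dominating_kernel p \<equiv> unit_fun (fst p) * weight (snd p)"

lemma dominating_kernel_pos: "0 < dominating_kernel p"
  by (intro mult_pos_pos unit_fun weight)

lemma ex_dominating_operator: "\<exists>R. nn_kernel R dominating_kernel \<and> (\<forall>f. R f = cscale M rep (wint f) unit_elem)"
proof -
  let ?R = "\<lambda>f. cscale M rep (wint f) unit_elem"
  have rep_R: "AE x in M. rep (?R f) x = wint f * of_real (unit_fun x)" for f
    using ae_rep_cscale[of "wint f" unit_elem] rep_unit_elem by eventually_elim simp
  have bl: "bounded_linear ?R"
  proof (rule bounded_linear_intro)
    fix f g r
    have "scalar (wint f + wint g) = scalar (wint f) + scalar (wint g)" by (rule calkin.scalar_add)
    then show "?R (f + g) = ?R f + ?R g"
      by (metis blinfun.add_left blinfun.add_right op_of_scalar op_of_simps(1))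
    show "?R (r *\<^sub>R f) = r *\<^sub>R ?R f"
    proof (rule cscale_eqI)
      show "AE x in M. rep (r *\<^sub>R ?R f) x = wint (r *\<^sub>R f) * rep unit_elem x"
        using rep_scaleR[of r "?R f"] rep_R[of f] rep_unit_elem
        by eventually_elim (simp add: blinfun.bilinear_simps scaleR_conv_of_real)
    qed
    show "norm (?R f) \<le> norm f * norm unit_elem"
      using wint_le[of f] by (simp add: norm_cscale mult_right_mono)
  qed
  have "has_kernel M rep (Blinfun ?R) (\<lambda>p. of_real (dominating_kernel p))"
    unfolding has_kernel_def bounded_linear_Blinfun_apply[OF bl]
  proof (intro conjI allI)
    fix f
    have e: "complex_of_real (dominating_kernel (x, y)) * rep f y = of_real (unit_fun x) * (rep f y * of_real (weight y))" for x y
      by (simp add: mult_ac)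
    show "AE x in M. integrable M (\<lambda>y. complex_of_real (dominating_kernel (x, y)) * rep f y) \<and>
        rep (?R f) x = (\<integral>y. complex_of_real (dominating_kernel (x, y)) * rep f y \<partial>M)"
      using rep_R[of f]
    proof eventually_elim
      case (elim x)
      show ?case unfolding e elim using integrable_weight[of f] by (simp add: wint mult.commute)
    qed
  qed measurable
  moreover have "0 \<le> dominating_kernel p" for p by (rule less_imp_le[OF dominating_kernel_pos])
  ultimately have "nn_kernel (Blinfun ?R) dominating_kernel" unfolding nn_kernel_def by (intro conjI allI) measurable
  then show ?thesis using bounded_linear_Blinfun_apply[OF bl] by metis
qed

definition dominating_operator :: "'l \<Rightarrow>\<^sub>L 'l" where
  "dominating_operator = (SOME R. nn_kernel R dominating_kernel \<and> (\<forall>f. R f = cscale M rep (wint f) unit_elem))"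

lemma dominating_operator: "nn_kernel dominating_operator dominating_kernel"
  "dominating_operator f = cscale M rep (wint f) unit_elem"
  using someI_ex[OF ex_dominating_operator] unfolding dominating_operator_def by blast+

lemma order_approx_mono:
  assumes A: "nn_kernel A a" and B: "nn_kernel B b" and le: "AE p in M \<Otimes>\<^sub>M M. a p \<le> b p"
    and "order_approx B u \<delta>"
  shows "order_approx A u \<delta>"
  unfolding order_approx_def
proof (intro ballI impI)
  fix f assume f: "f \<in> fun_nonneg M rep" "norm f \<le> 1"
  have "modulus f = f"
    by (rule rep_inject) (use rep_modulus[of f] f(1)[unfolded nonneg_iff] in eventually_elim, simp)
  then have 1: "AE x in M. cmod (rep (A f) x) \<le> cmod (rep (B f) x)"
    using nn_kernel_mono[OF A B le, of f] by simp
  obtain h where h: "norm h \<le> \<delta>" "AE x in M. cmod (rep (B f) x) \<le> cmod (rep u x) + cmod (rep h x)"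
    using assms(4) f unfolding order_approx_def by blast
  from 1 h(2) have "AE x in M. cmod (rep (A f) x) \<le> cmod (rep u x) + cmod (rep h x)" by eventually_elim simp
  with h(1) show "\<exists>h. norm h \<le> \<delta> \<and> (AE x in M. cmod (rep (A f) x) \<le> cmod (rep u x) + cmod (rep h x))" by blast
qed

lemma order_approx_dominating: "order_approx dominating_operator unit_elem 0"
  unfolding order_approx_def
proof (intro ballI impI)
  fix f :: 'l assume f: "norm f \<le> 1"
  have "AE x in M. cmod (rep (dominating_operator f) x) \<le> cmod (rep unit_elem x) + cmod (rep 0 x)"
    using ae_rep_cscale[of "wint f" unit_elem] unfolding dominating_operator(2)
  proof eventually_elim
    case (elim x)
    have "cmod (wint f) * cmod (rep unit_elem x) \<le> 1 * cmod (rep unit_elem x)"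
      using wint_le[of f] f by (intro mult_right_mono) auto
    then show ?case using elim by (simp add: norm_mult add_increasing2)
  qed
  then show "\<exists>h. norm h \<le> 0 \<and> (AE x in M. cmod (rep (dominating_operator f) x) \<le> cmod (rep unit_elem x) + cmod (rep h x))"
    by (intro exI[of _ 0]) simp
qed

lemma ex_indicator_operator:
  assumes G: "G \<in> sets (M \<Otimes>\<^sub>M M)"
  shows "\<exists>H. nn_kernel H (\<lambda>p. indicator G p * dominating_kernel p)"
proof -
  have "(\<lambda>p. indicator G p * dominating_kernel p) \<in> borel_measurable (M \<Otimes>\<^sub>M M)" using G by measurable
  then show ?thesis
    using less_imp_le[OF dominating_kernel_pos]
    by (elim ex_dominated_nn_kernel[OF dominating_operator(1)]) (auto simp: indicator_def)
qed

text \<open>Rectangles give rank-one operators, complements are differences from the rank-one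
  \<open>dominating_operator\<close>, and for disjoint unions the tails tend to 0 in operator norm
  by \<open>decreasing_kernels_norm\<close> with \<delta> = 0.\<close>

lemma indicator_operator_compact:
  assumes G: "G \<in> sets (M \<Otimes>\<^sub>M M)"
  shows "\<exists>H. nn_kernel H (\<lambda>p. indicator G p * dominating_kernel p) \<and> \<beta> H = 0"
proof -
  let ?E = "{a \<times> b | a b. a \<in> sets M \<and> b \<in> sets M}" and ?\<Omega> = "space M \<times> space M"
  define P where "P G \<longleftrightarrow> (\<exists>H. nn_kernel H (\<lambda>p. indicator G p * dominating_kernel p) \<and> \<beta> H = 0)" for G
  have PD: "\<beta> H = 0" if "P G" and H: "nn_kernel H (\<lambda>p. indicator G p * dominating_kernel p)" for G H
  proof -
    obtain H' where H': "nn_kernel H' (\<lambda>p. indicator G p * dominating_kernel p)" "\<beta> H' = 0"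
      using \<open>P G\<close> unfolding P_def by blast
    then have "H = H'" using has_kernel_operator_unique[OF nn_kernelD(3)[OF H] nn_kernelD(3)[OF H'(1)]] by simp
    then show ?thesis using H' by simp
  qed
  have split: "H = H1 + H2"
    if "nn_kernel H (\<lambda>p. indicator G p * dominating_kernel p)" "nn_kernel H1 (\<lambda>p. indicator A p * dominating_kernel p)"
      "nn_kernel H2 (\<lambda>p. indicator B p * dominating_kernel p)" "A \<inter> B = {}" "G = A \<union> B" for H H1 H2 G A B
  proof -
    have "(\<lambda>p. complex_of_real (indicator A p * dominating_kernel p) + of_real (indicator B p * dominating_kernel p))
        = (\<lambda>p. of_real (indicator G p * dominating_kernel p))"
      using that(4,5) by (auto simp: fun_eq_iff indicator_def)
    with has_kernel_add[OF nn_kernelD(3)[OF that(2)] nn_kernelD(3)[OF that(3)]]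
    show ?thesis using has_kernel_operator_unique[OF nn_kernelD(3)[OF that(1)]] by simp
  qed
  have "P G"
    using Int_stable_pair_measure_generator[of M M] pair_measure_closed[of M M] G
    unfolding sets_pair_measure
  proof (induct rule: sigma_sets_induct_disjoint)
    case (basic G)
    then obtain A B where AB: "G = A \<times> B" and A: "A \<in> sets M" and B: "B \<in> sets M" by blast
    obtain H where H: "nn_kernel H (\<lambda>p. indicator G p * dominating_kernel p)"
      using ex_indicator_operator[of G] A B AB by auto
    have "\<beta> H = 0"
    proof (rule rank_one_compact[where v = "restr A unit_elem"])
      fix f :: 'l assume f: "norm f \<le> 1"
      have le: "norm (restr B f) \<le> norm f"
        by (rule norm_le) (use rep_restr[OF B, of f] in eventually_elim, auto simp: norm_mult indicator_def)
      have w: "wint (restr B f) = (\<integral>y. indicator B y * (rep f y * of_real (weight y)) \<partial>M)"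
        unfolding wint
        by (rule integral_cong_AE) (use rep_restr[OF B, of f] B in \<open>measurable, auto elim!: AE_mp simp: mult_ac\<close>)
      have "cscale M rep (wint (restr B f)) (restr A unit_elem) = H f"
      proof (rule cscale_eqI)
        show "AE x in M. rep (H f) x = wint (restr B f) * rep (restr A unit_elem) x"
          using has_kernelD[OF nn_kernelD(3)[OF H], of f] rep_restr[OF A, of unit_elem] rep_unit_elem
        proof eventually_elim
          case (elim x)
          have e: "complex_of_real (indicator G (x, y) * dominating_kernel (x, y)) * rep f y
              = (indicator A x * of_real (unit_fun x)) * (indicator B y * (rep f y * of_real (weight y)))" for y
            by (auto simp: AB indicator_def mult_ac)
          have "rep (H f) x = (\<integral>y. complex_of_real (indicator G (x, y) * dominating_kernel (x, y)) * rep f y \<partial>M)"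
            using elim(1) by blast
          also have "\<dots> = (\<integral>y. (indicator A x * of_real (unit_fun x)) * (indicator B y * (rep f y * of_real (weight y))) \<partial>M)"
            unfolding e ..
          also have "\<dots> = (indicator A x * of_real (unit_fun x)) * wint (restr B f)"
            unfolding w by (rule integral_mult_right_zero)
          finally show ?case using elim by (simp add: mult.commute)
        qed
      qed
      then show "\<exists>c. cmod c \<le> 1 \<and> H f = cscale M rep c (restr A unit_elem)"
        using wint_le[of "restr B f"] le f by (intro exI[of _ "wint (restr B f)"]) auto
    qed
    then show ?case using H unfolding P_def by blast
  next
    case empty
    have "nn_kernel 0 (\<lambda>p. indicator {} p * dominating_kernel p)"
      using has_kernel_zero by (simp add: nn_kernel_def)
    then show ?case unfolding P_def using calkin.zero by (intro exI[of _ 0]) (simp add: op_of_simps)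
  next
    case (compl G)
    then have G: "G \<in> sets (M \<Otimes>\<^sub>M M)" by (simp add: sets_pair_measure)
    then have [measurable]: "G \<in> sets (M \<Otimes>\<^sub>M M)" "?\<Omega> - G \<in> sets (M \<Otimes>\<^sub>M M)" by auto
    obtain H where H: "nn_kernel H (\<lambda>p. indicator G p * dominating_kernel p)" "\<beta> H = 0"
      using compl unfolding P_def by blast
    obtain H' where H': "nn_kernel H' (\<lambda>p. indicator (?\<Omega> - G) p * dominating_kernel p)"
      using ex_indicator_operator[of "?\<Omega> - G"] by auto
    have "has_kernel M rep (dominating_operator - H) (\<lambda>p. of_real (indicator (?\<Omega> - G) p * dominating_kernel p))"
    proof (rule has_kernel_cong_AE[OF has_kernel_diff[OF nn_kernelD(3)[OF dominating_operator(1)] nn_kernelD(3)[OF H(1)]]])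
      show "AE p in M \<Otimes>\<^sub>M M. complex_of_real (dominating_kernel p) - of_real (indicator G p * dominating_kernel p)
          = of_real (indicator (?\<Omega> - G) p * dominating_kernel p)"
        using AE_space by eventually_elim (auto simp: indicator_def space_pair_measure)
    qed measurable
    then have "H' = dominating_operator - H" by (rule has_kernel_operator_unique[OF nn_kernelD(3)[OF H']])
    moreover have "\<beta> dominating_operator = 0"
    proof (rule rank_one_compact[where v = unit_elem])
      show "\<exists>c. cmod c \<le> 1 \<and> dominating_operator f = cscale M rep c unit_elem" if "norm f \<le> 1" for f
        using that wint_le[of f] dominating_operator(2) by (intro exI[of _ "wint f"]) auto
    qed
    ultimately have "\<beta> H' = 0"
      using H(2) hausdorff_noncompactness_triangle[of dominating_operator "- H"] hausdorff_noncompactness_nonneg[of H']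
      by (simp add: hausdorff_noncompactness_minus)
    then show ?case using H' unfolding P_def by blast
  next
    case (union A)
    then have A [measurable]: "\<And>i. A i \<in> sets (M \<Otimes>\<^sub>M M)" by (auto simp: sets_pair_measure)
    define T where "T n = (\<Union>i. A i) - (\<Union>i<n. A i)" for n
    have [measurable]: "T n \<in> sets (M \<Otimes>\<^sub>M M)" for n unfolding T_def by measurable
    obtain H where H: "nn_kernel H (\<lambda>p. indicator (\<Union>i. A i) p * dominating_kernel p)"
      using ex_indicator_operator[of "\<Union>i. A i"] by auto
    have "\<exists>D. \<forall>n. nn_kernel (D n) (\<lambda>p. indicator (T n) p * dominating_kernel p)"
      by (intro choice allI ex_indicator_operator) measurable
    then obtain D where D: "\<And>n. nn_kernel (D n) (\<lambda>p. indicator (T n) p * dominating_kernel p)" by blast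
    have part: "P (\<Union>i<n. A i)" for n
    proof (induction n)
      case 0
      have "nn_kernel 0 (\<lambda>p. indicator {} p * dominating_kernel p)" using has_kernel_zero by (simp add: nn_kernel_def)
      then show ?case unfolding P_def using calkin.zero by (intro exI[of _ 0]) (simp add: op_of_simps)
    next
      case (Suc n)
      obtain H1 where H1: "nn_kernel H1 (\<lambda>p. indicator (\<Union>i<n. A i) p * dominating_kernel p)" "\<beta> H1 = 0"
        using Suc unfolding P_def by blast
      obtain H2 where H2: "nn_kernel H2 (\<lambda>p. indicator (A n) p * dominating_kernel p)" "\<beta> H2 = 0"
        using union(3)[of n] unfolding P_def by blast
      obtain H3 where H3: "nn_kernel H3 (\<lambda>p. indicator (\<Union>i<Suc n. A i) p * dominating_kernel p)"
        using ex_indicator_operator[of "\<Union>i<Suc n. A i"] by auto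
      have "A i \<inter> A n = {}" if "i < n" for i using union(1) that by (intro disjoint_family_onD) auto
      then have "(\<Union>i<n. A i) \<inter> A n = {}" by blast
      then have "H3 = H1 + H2" by (rule split[OF H3 H1(1) H2(1)]) (auto simp: lessThan_Suc)
      then have "\<beta> H3 = 0"
        using hausdorff_noncompactness_triangle[of H1 H2] hausdorff_noncompactness_nonneg[of H3] H1 H2 by simp
      then show ?case using H3 unfolding P_def by blast
    qed
    have "\<beta> H \<le> 0 + e" if e: "e > 0" for e
    proof -
      have "\<exists>n. norm (D n) \<le> 0 + e"
      proof (rule decreasing_kernels_norm[OF D])
        show "AE p in M \<Otimes>\<^sub>M M. indicator (T (Suc n)) p * dominating_kernel p \<le> indicator (T n) p * dominating_kernel p" for n
          using less_imp_le[OF dominating_kernel_pos]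
          by (intro AE_I2 mult_right_mono) (auto simp: T_def indicator_def lessThan_Suc)
        show "AE p in M \<Otimes>\<^sub>M M. (\<lambda>n. indicator (T n) p * dominating_kernel p) \<longlonglongrightarrow> 0"
        proof (rule AE_I2)
          fix p
          obtain N where N: "\<And>n. n \<ge> N \<Longrightarrow> p \<notin> T n"
          proof (cases "p \<in> (\<Union>i. A i)")
            case True
            then obtain i where "p \<in> A i" by blast
            then show ?thesis by (intro that[of "Suc i"]) (auto simp: T_def)
          qed (use that[of 0] in \<open>auto simp: T_def\<close>)
          then have "\<forall>\<^sub>F n in sequentially. indicator (T n) p * dominating_kernel p = 0"
            by (intro eventually_sequentiallyI[of N]) simp
          then show "(\<lambda>n. indicator (T n) p * dominating_kernel p) \<longlonglongrightarrow> 0" by (rule tendsto_eventually)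
        qed
        show "order_approx (D 0) unit_elem 0"
        proof (rule order_approx_mono[OF D dominating_operator(1) _ order_approx_dominating])
          show "AE p in M \<Otimes>\<^sub>M M. indicator (T 0) p * dominating_kernel p \<le> dominating_kernel p"
            using less_imp_le[OF dominating_kernel_pos] by (intro AE_I2) (auto simp: indicator_def)
        qed
      qed (use e in auto)
      then obtain n where n: "norm (D n) \<le> e" by auto
      obtain H1 where H1: "nn_kernel H1 (\<lambda>p. indicator (\<Union>i<n. A i) p * dominating_kernel p)" "\<beta> H1 = 0"
        using part unfolding P_def by blast
      have "H = H1 + D n" by (rule split[OF H H1(1) D]) (auto simp: T_def)
      then have "\<beta> H \<le> \<beta> H1 + \<beta> (D n)" using hausdorff_noncompactness_triangle by simp
      also have "\<dots> \<le> 0 + e" using n H1 hausdorff_noncompactness_le_norm[of "D n"] by simp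
      finally show ?thesis .
    qed
    then have "\<beta> H \<le> 0" by (rule field_le_epsilon)
    then have "\<beta> H = 0" using hausdorff_noncompactness_nonneg[of H] by simp
    then show ?case using H unfolding P_def by blast
  qed
  then show ?thesis unfolding P_def .
qed

lemma simple_kernel_compact:
  assumes s: "simple_function (M \<Otimes>\<^sub>M M) s"
  shows "\<exists>K. has_kernel M rep K (\<lambda>p. of_real (s p * dominating_kernel p)) \<and> \<beta> K = 0"
proof -
  let ?\<Omega> = "space (M \<Otimes>\<^sub>M M)"
  define V where "V c = s -` {c} \<inter> ?\<Omega>" for c
  have V: "V c \<in> sets (M \<Otimes>\<^sub>M M)" for c unfolding V_def by (rule simple_functionD(2)[OF s])
  have fin: "finite (s ` ?\<Omega>)" by (rule simple_functionD(1)[OF s])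
  have [measurable]: "s \<in> borel_measurable (M \<Otimes>\<^sub>M M)" by (rule borel_measurable_simple_function[OF s])
  have "\<exists>H. \<forall>c. nn_kernel (H c) (\<lambda>p. indicator (V c) p * dominating_kernel p) \<and> \<beta> (H c) = 0"
    by (intro choice allI indicator_operator_compact V)
  then obtain H where H: "\<And>c. nn_kernel (H c) (\<lambda>p. indicator (V c) p * dominating_kernel p)" "\<And>c. \<beta> (H c) = 0" by blast
  let ?K = "\<Sum>c\<in>s ` ?\<Omega>. c *\<^sub>R H c"
  have "has_kernel M rep ?K (\<lambda>p. \<Sum>c\<in>s ` ?\<Omega>. of_real c * of_real (indicator (V c) p * dominating_kernel p))"
    by (intro has_kernel_sum has_kernel_scaleR nn_kernelD(3) H)
  then have "has_kernel M rep ?K (\<lambda>p. of_real (s p * dominating_kernel p))"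
  proof (rule has_kernel_cong_AE)
    show "AE p in M \<Otimes>\<^sub>M M. (\<Sum>c\<in>s ` ?\<Omega>. of_real c * of_real (indicator (V c) p * dominating_kernel p))
        = complex_of_real (s p * dominating_kernel p)"
      using AE_space
    proof eventually_elim
      case (elim p)
      have "(\<Sum>c\<in>s ` ?\<Omega>. complex_of_real c * of_real (indicator (V c) p * dominating_kernel p))
          = (\<Sum>c\<in>s ` ?\<Omega>. if c = s p then of_real (s p * dominating_kernel p) else 0)"
        using elim by (intro sum.cong refl) (auto simp: V_def indicator_def)
      also have "\<dots> = of_real (s p * dominating_kernel p)" using fin elim by simp
      finally show ?case .
    qed
  qed measurable
  moreover have "\<beta> ?K = 0"
    by (intro hausdorff_noncompactness_sum_eq_0 hausdorff_noncompactness_scaleR_eq_0 H)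
  ultimately show ?thesis by blast
qed

text \<open>The density of a with respect to the dominating kernel is approximated from below by
  simple functions. The remainders have kernels decreasing to 0 and inherit
  \<open>order_approx\<close> from T, so \<open>decreasing_kernels_norm\<close> bounds the norm of
  one of them by \<delta> + \<epsilon>.\<close>

theorem compact_approximation:
  assumes T: "nn_kernel T a" and approx: "order_approx T u \<delta>" and \<delta>: "0 \<le> \<delta>" and \<epsilon>: "0 < \<epsilon>"
  obtains K where "complex_linear M rep K" "\<beta> K = 0" "norm (T - K) \<le> \<delta> + \<epsilon>"
proof -
  have [measurable]: "a \<in> borel_measurable (M \<Otimes>\<^sub>M M)" by (rule nn_kernelD(1)[OF T])
  define F where "F p = a p / dominating_kernel p" for p
  have [measurable]: "F \<in> borel_measurable (M \<Otimes>\<^sub>M M)" unfolding F_def by measurable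
  have F0: "0 \<le> F p" for p
    unfolding F_def using nn_kernelD(2)[OF T] less_imp_le[OF dominating_kernel_pos] by (intro divide_nonneg_nonneg)
  have Fa: "F p * dominating_kernel p = a p" for p
    using dominating_kernel_pos[of p] unfolding F_def by (metis less_irrefl nonzero_eq_divide_eq)
  have "(\<lambda>p. ennreal (F p)) \<in> borel_measurable (M \<Otimes>\<^sub>M M)" by measurable
  then obtain S where S: "\<And>i. simple_function (M \<Otimes>\<^sub>M M) (S i)" "incseq S" "\<And>i p. S i p < top" "\<And>p. (SUP i. S i p) = ennreal (F p)"
    using borel_measurable_implies_simple_function_sequence' by blast
  define s where "s i p = enn2real (S i p)" for i p
  have Ss: "S i p = ennreal (s i p)" for i p using S(3)[of i p] by (simp add: s_def)
  have s0: "0 \<le> s i p" for i p by (simp add: s_def)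
  have s_simple: "simple_function (M \<Otimes>\<^sub>M M) (s i)" for i
    unfolding s_def using simple_function_compose1[OF S(1), of enn2real i] by simp
  have [measurable]: "s i \<in> borel_measurable (M \<Otimes>\<^sub>M M)" for i by (rule borel_measurable_simple_function[OF s_simple])
  have s_inc: "s i p \<le> s (Suc i) p" for i p
  proof -
    have "S i p \<le> S (Suc i) p" by (rule le_funD[OF incseq_SucD[OF S(2)]])
    then show ?thesis using s0 by (simp add: Ss)
  qed
  have s_le: "s i p \<le> F p" for i p
  proof -
    have "S i p \<le> ennreal (F p)" unfolding S(4)[symmetric] by (rule SUP_upper) simp
    then show ?thesis using F0 by (simp add: Ss)
  qed
  have s_lim: "(\<lambda>i. s i p) \<longlonglongrightarrow> F p" for p
  proof -
    have "incseq (\<lambda>i. S i p)" using S(2) unfolding incseq_def le_fun_def by blast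
    then have "(\<lambda>i. S i p) \<longlonglongrightarrow> (SUP i. S i p)" by (rule LIMSEQ_SUP)
    then have "(\<lambda>i. S i p) \<longlonglongrightarrow> ennreal (F p)" by (simp only: S(4))
    then have "(\<lambda>i. ennreal (s i p)) \<longlonglongrightarrow> ennreal (F p)" by (simp only: Ss)
    then show ?thesis using s0 F0 by (subst (asm) tendsto_ennreal_iff) auto
  qed
  have "\<exists>K. \<forall>i. has_kernel M rep (K i) (\<lambda>p. of_real (s i p * dominating_kernel p)) \<and> \<beta> (K i) = 0"
    by (intro choice allI simple_kernel_compact s_simple)
  then obtain K where K: "\<And>i. has_kernel M rep (K i) (\<lambda>p. of_real (s i p * dominating_kernel p))" "\<And>i. \<beta> (K i) = 0" by blast
  define d where "d i p = a p - s i p * dominating_kernel p" for i p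
  have [measurable]: "d i \<in> borel_measurable (M \<Otimes>\<^sub>M M)" for i unfolding d_def by measurable
  have d: "d i p = (F p - s i p) * dominating_kernel p" for i p
    by (simp add: d_def left_diff_distrib Fa)
  have d0: "0 \<le> d i p" for i p
    unfolding d using s_le[of i p] less_imp_le[OF dominating_kernel_pos[of p]]
    by (metis diff_ge_0_iff_ge mult_nonneg_nonneg)
  have D: "nn_kernel (T - K i) (d i)" for i
    using has_kernel_diff[OF nn_kernelD(3)[OF T] K(1), of i] d0[of i] by (simp add: nn_kernel_def d_def)
  have "\<exists>i. norm (T - K i) \<le> \<delta> + \<epsilon>"
  proof (rule decreasing_kernels_norm[OF D _ _ _ \<delta> \<epsilon>])
    show "AE p in M \<Otimes>\<^sub>M M. d (Suc i) p \<le> d i p" for i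
      unfolding d using s_inc less_imp_le[OF dominating_kernel_pos] by (intro AE_I2 mult_right_mono) auto
    have "(\<lambda>i. (F p - s i p) * dominating_kernel p) \<longlonglongrightarrow> (F p - F p) * dominating_kernel p" for p
      by (intro tendsto_mult tendsto_diff tendsto_const s_lim)
    then show "AE p in M \<Otimes>\<^sub>M M. (\<lambda>i. d i p) \<longlonglongrightarrow> 0" unfolding d by simp
    show "order_approx (T - K 0) u \<delta>"
    proof (rule order_approx_mono[OF D T _ approx])
      show "AE p in M \<Otimes>\<^sub>M M. d 0 p \<le> a p"
        unfolding d_def using s0 less_imp_le[OF dominating_kernel_pos] by (intro AE_I2) (simp add: mult_nonneg_nonneg)
    qed
  qed
  then show ?thesis using that K has_kernel_complex_linear[OF K(1)] by blast
qed

text \<open>u is the sum of the moduli of a finite \<delta>-net for the image of the unit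
  ball.\<close>

lemma order_approx_of_noncompactness:
  fixes P :: "'l \<Rightarrow>\<^sub>L 'l"
  assumes "\<beta> P < \<delta>"
  shows "\<exists>u. order_approx P u \<delta>"
proof -
  obtain F where F: "finite F" "\<And>x. norm x \<le> 1 \<Longrightarrow> \<exists>f\<in>F. norm (f - P x) \<le> \<delta>"
    using hausdorff_noncompactness_lessD[OF assms] by blast
  let ?u = "\<Sum>f\<in>F. modulus f"
  have u: "AE x in M. \<forall>f\<in>F. cmod (rep f x) \<le> cmod (rep ?u x)"
  proof -
    have "AE x in M. \<forall>f\<in>F. rep (modulus f) x = of_real (cmod (rep f x))"
      by (rule AE_finite_allI[OF F(1) rep_modulus])
    with rep_sum[of modulus F] show ?thesis
    proof eventually_elim
      case (elim x)
      then have "rep ?u x = of_real (\<Sum>f\<in>F. cmod (rep f x))" by simp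
      then have "cmod (rep ?u x) = (\<Sum>f\<in>F. cmod (rep f x))"
        by (simp only: norm_of_real) (simp add: sum_nonneg)
      then show ?case using F(1) by (auto intro!: member_le_sum)
    qed
  qed
  have "order_approx P ?u \<delta>"
    unfolding order_approx_def
  proof (intro ballI impI)
    fix g :: 'l assume "norm g \<le> 1"
    then obtain f where f: "f \<in> F" "norm (f - P g) \<le> \<delta>" using F(2) by blast
    have "AE x in M. cmod (rep (P g) x) \<le> cmod (rep ?u x) + cmod (rep (f - P g) x)"
      using u rep_diff[of f "P g"]
    proof eventually_elim
      case (elim x)
      have "cmod (rep (P g) x) \<le> cmod (rep f x) + cmod (rep f x - rep (P g) x)"
        using norm_triangle_ineq4[of "rep f x" "rep f x - rep (P g) x"] by simp
      then show ?case using elim f(1) by fastforce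
    qed
    then show "\<exists>h. norm h \<le> \<delta> \<and> (AE x in M. cmod (rep (P g) x) \<le> cmod (rep ?u x) + cmod (rep h x))"
      using f(2) by blast
  qed
  then show ?thesis by blast
qed

section \<open>Domination by weighted sums\<close>

lemma rep_weighted_modulus_sum:
  assumes "finite I"
  shows "AE x in M. rep (\<Sum>i\<in>I. t i *\<^sub>R modulus (h i)) x = of_real (\<Sum>i\<in>I. t i * cmod (rep (h i) x))"
proof -
  have "AE x in M. \<forall>i\<in>I. rep (t i *\<^sub>R modulus (h i)) x = of_real (t i * cmod (rep (h i) x))"
  proof (rule AE_finite_allI[OF assms])
    show "AE x in M. rep (t i *\<^sub>R modulus (h i)) x = of_real (t i * cmod (rep (h i) x))" for i
      using rep_scaleR[of "t i" "modulus (h i)"] rep_modulus[of "h i"] by eventually_elim simp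
  qed
  with rep_sum[of "\<lambda>i. t i *\<^sub>R modulus (h i)" I] show ?thesis by eventually_elim simp
qed

lemma order_approx_weighted_sum:
  fixes T :: "'l \<Rightarrow>\<^sub>L 'l" and P :: "'i \<Rightarrow> 'l \<Rightarrow>\<^sub>L 'l"
  assumes I: "finite I" and t: "\<And>i. i \<in> I \<Longrightarrow> 0 \<le> t i"
    and le: "\<And>f. f \<in> fun_nonneg M rep \<Longrightarrow> AE x in M. cmod (rep (T f) x) \<le> (\<Sum>i\<in>I. t i * cmod (rep (P i f) x))"
    and P: "\<And>i. i \<in> I \<Longrightarrow> order_approx (P i) (u i) (\<delta> i)"
  shows "order_approx T (\<Sum>i\<in>I. t i *\<^sub>R modulus (u i)) (\<Sum>i\<in>I. t i * \<delta> i)"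
  unfolding order_approx_def
proof (intro ballI impI)
  fix f assume f: "f \<in> fun_nonneg M rep" "norm f \<le> 1"
  have "\<forall>i\<in>I. \<exists>h. norm h \<le> \<delta> i \<and> (AE x in M. cmod (rep (P i f) x) \<le> cmod (rep (u i) x) + cmod (rep h x))"
    using P f unfolding order_approx_def by blast
  then obtain h where h: "\<And>i. i \<in> I \<Longrightarrow> norm (h i) \<le> \<delta> i"
    "\<And>i. i \<in> I \<Longrightarrow> AE x in M. cmod (rep (P i f) x) \<le> cmod (rep (u i) x) + cmod (rep (h i) x)" by metis
  let ?u = "\<Sum>i\<in>I. t i *\<^sub>R modulus (u i)" and ?h = "\<Sum>i\<in>I. t i *\<^sub>R modulus (h i)"
  have "AE x in M. \<forall>i\<in>I. cmod (rep (P i f) x) \<le> cmod (rep (u i) x) + cmod (rep (h i) x)"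
    by (rule AE_finite_allI[OF I h(2)])
  then have "AE x in M. cmod (rep (T f) x) \<le> cmod (rep ?u x) + cmod (rep ?h x)"
    using le[OF f(1)] rep_weighted_modulus_sum[OF I, of t u] rep_weighted_modulus_sum[OF I, of t h]
  proof eventually_elim
    case (elim x)
    have "cmod (rep (T f) x) \<le> (\<Sum>i\<in>I. t i * (cmod (rep (u i) x) + cmod (rep (h i) x)))"
      using elim(1) t by (intro order_trans[OF elim(2)] sum_mono mult_left_mono) auto
    also have "\<dots> = (\<Sum>i\<in>I. t i * cmod (rep (u i) x)) + (\<Sum>i\<in>I. t i * cmod (rep (h i) x))"
      by (simp add: distrib_left sum.distrib)
    also have "\<dots> \<le> cmod (rep ?u x) + cmod (rep ?h x)"
      unfolding elim(3,4) norm_of_real by (intro add_mono abs_ge_self)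
    finally show ?case .
  qed
  moreover have "norm ?h \<le> (\<Sum>i\<in>I. t i * \<delta> i)"
  proof (rule sum_norm_le)
    show "norm (t i *\<^sub>R modulus (h i)) \<le> t i * \<delta> i" if "i \<in> I" for i
      using h(1)[OF that] t[OF that] by (simp add: mult_left_mono)
  qed
  ultimately show "\<exists>h. norm h \<le> (\<Sum>i\<in>I. t i * \<delta> i) \<and> (AE x in M. cmod (rep (T f) x) \<le> cmod (rep ?u x) + cmod (rep h x))"
    by blast
qed

lemma noncompactness_le_weighted_sum:
  fixes P :: "'i \<Rightarrow> 'l \<Rightarrow>\<^sub>L 'l"
  assumes T: "nn_kernel T a" and I: "finite I" and t: "\<And>i. i \<in> I \<Longrightarrow> 0 \<le> t i"
    and le: "\<And>f. f \<in> fun_nonneg M rep \<Longrightarrow> AE x in M. cmod (rep (T f) x) \<le> (\<Sum>i\<in>I. t i * cmod (rep (P i f) x))"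
  shows "\<beta> T \<le> (\<Sum>i\<in>I. t i * \<beta> (P i))"
proof (rule tendsto_lowerbound)
  show "((\<lambda>e. (\<Sum>i\<in>I. t i * (\<beta> (P i) + e)) + e) \<longlongrightarrow> (\<Sum>i\<in>I. t i * \<beta> (P i))) (at_right 0)"
    by (auto intro!: tendsto_eq_intros)
  have "\<beta> T \<le> (\<Sum>i\<in>I. t i * (\<beta> (P i) + e)) + e" if e: "e > 0" for e
  proof -
    have "\<exists>u. \<forall>i. order_approx (P i) (u i) (\<beta> (P i) + e)"
      by (intro choice allI order_approx_of_noncompactness) (use e in simp)
    then obtain u where "\<And>i. order_approx (P i) (u i) (\<beta> (P i) + e)" by blast
    then have "order_approx T (\<Sum>i\<in>I. t i *\<^sub>R modulus (u i)) (\<Sum>i\<in>I. t i * (\<beta> (P i) + e))"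
      using I t le by (intro order_approx_weighted_sum) auto
    moreover have "0 \<le> (\<Sum>i\<in>I. t i * (\<beta> (P i) + e))"
      using t hausdorff_noncompactness_nonneg e by (intro sum_nonneg mult_nonneg_nonneg add_nonneg_nonneg) auto
    ultimately obtain K where K: "\<beta> K = 0" "norm (T - K) \<le> (\<Sum>i\<in>I. t i * (\<beta> (P i) + e)) + e"
      using compact_approximation[OF T] e by blast
    have "\<beta> T \<le> \<beta> (T - K) + \<beta> K" using hausdorff_noncompactness_triangle[of "T - K" K] by simp
    then show ?thesis using K hausdorff_noncompactness_le_norm[of "T - K"] by simp
  qed
  then show "\<forall>\<^sub>F e in at_right 0. \<beta> T \<le> (\<Sum>i\<in>I. t i * (\<beta> (P i) + e)) + e"
    unfolding eventually_at_right_field by (intro exI[of _ 1]) auto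
qed simp

text \<open>The other half of Gelfand's formula. For z beyond s some power T ^ n has
  \<open>\<beta>\<close> below |z| ^ n; \<open>compact_approximation\<close> turns this into
  closeness in norm to a compact operator, as required by
  \<open>not_in_ess_spectrum\<close>.\<close>

lemma ess_spectral_radius_le_of_power_bound:
  assumes T: "nn_kernel T a" and s: "0 < s" and le: "\<And>n. n \<ge> 1 \<Longrightarrow> \<beta> (op_power T n) \<le> C * s ^ n"
  shows "ess_spectral_radius M rep T \<le> s"
proof (rule ess_spectral_radius_le)
  fix z assume z: "z \<in> ess_spectrum M rep T"
  show "cmod z \<le> s"
  proof (rule ccontr)
    assume "\<not> cmod z \<le> s"
    then have "s < cmod z" by simp
    have "\<forall>\<^sub>F n in sequentially. max C 1 * s ^ n \<le> ((s + cmod z) / 2) ^ n"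
      using s \<open>s < cmod z\<close> by (intro eventually_const_mult_power_le) auto
    \<comment> \<open>A rate strictly between s and |z| absorbs the constant C for large n.\<close>
    then obtain n where n: "n \<ge> 1" "max C 1 * s ^ n \<le> ((s + cmod z) / 2) ^ n"
      by (meson eventually_sequentially le_add1 le_add2)
    have "\<beta> (op_power T n) \<le> max C 1 * s ^ n"
      using le[OF n(1)] s by (meson max.cobounded1 mult_right_mono order_trans zero_le_power less_imp_le)
    also have "\<dots> \<le> ((s + cmod z) / 2) ^ n" by (rule n)
    also have "\<dots> < cmod z ^ n" using s \<open>s < cmod z\<close> n(1) by (intro power_strict_mono) auto
    finally have less: "\<beta> (op_power T n) < cmod z ^ n" .
    obtain b where "\<beta> (op_power T n) < b" "b < cmod z ^ n" using dense[OF less] by blast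
    then obtain u where u: "order_approx (op_power T n) u b" using order_approx_of_noncompactness by blast
    have "\<exists>k. nn_kernel (op_power T n) k"
      using n(1)
    proof (induction n rule: dec_induct)
      case base
      then show ?case using T by auto
    next
      case (step n)
      then show ?case using nn_kernel_compose[OF T] by (auto simp: funpow_Suc_right)
    qed
    then obtain k where k: "nn_kernel (op_power T n) k" by blast
    obtain K where K: "complex_linear M rep K" "\<beta> K = 0" "norm (op_power T n - K) \<le> b + (cmod z ^ n - b) / 2"
      using compact_approximation[OF k u, of "(cmod z ^ n - b) / 2"] \<open>b < cmod z ^ n\<close> \<open>\<beta> (op_power T n) < b\<close>
        hausdorff_noncompactness_nonneg[of "op_power T n"] by auto
    have "b + (cmod z ^ n - b) / 2 < cmod z ^ n" using \<open>b < cmod z ^ n\<close> by (simp add: field_simps)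
    with K(3) have "norm (op_power T n - K) < cmod z ^ n" by simp
    then have "z \<notin> ess_spectrum M rep T"
      by (rule not_in_ess_spectrum[OF has_kernel_complex_linear[OF nn_kernelD(3)[OF T]] K(1,2)])
    with z show False by simp
  qed
qed (use s in simp)

end

section \<open>Hadamard weighted geometric means\<close>

text \<open>Integrating the scaled weighted means and optimizing over t proves Hoelder's inequality
  for several factors uniformly, including the case of vanishing integrals.\<close>

lemma holder_prod_powr:
  fixes F :: "'i \<Rightarrow> 'a \<Rightarrow> real"
  assumes S: "finite S" "\<And>i. i \<in> S \<Longrightarrow> \<alpha> i > 0" "sum \<alpha> S = 1"
    and F: "\<And>i. i \<in> S \<Longrightarrow> integrable M (F i)" "\<And>i x. i \<in> S \<Longrightarrow> 0 \<le> F i x"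
  shows "(\<integral>x. (\<Prod>i\<in>S. F i x powr \<alpha> i) \<partial>M) \<le> (\<Prod>i\<in>S. (\<integral>x. F i x \<partial>M) powr \<alpha> i)"
proof (rule le_prod_powr_optimize[OF S])
  show "0 \<le> (\<integral>x. F i x \<partial>M)" if "i \<in> S" for i using F(2)[OF that] by (intro integral_nonneg_AE) auto
  fix t :: "'i \<Rightarrow> real" assume t: "\<And>i. i \<in> S \<Longrightarrow> 0 < t i" "(\<Prod>i\<in>S. t i powr \<alpha> i) = 1"
  have [measurable]: "F i \<in> borel_measurable M" if "i \<in> S" for i using F(1)[OF that] by simp
  have le: "(\<Prod>i\<in>S. F i x powr \<alpha> i) \<le> (\<Sum>i\<in>S. \<alpha> i * t i * F i x)" for x
    by (rule weighted_arith_geom_mean_scaled[OF S]) (use F(2) t in auto)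
  have int: "integrable M (\<lambda>x. \<Sum>i\<in>S. \<alpha> i * t i * F i x)"
    using F(1) by (intro Bochner_Integration.integrable_sum integrable_mult_right) auto
  have "(\<integral>x. (\<Prod>i\<in>S. F i x powr \<alpha> i) \<partial>M) \<le> (\<integral>x. (\<Sum>i\<in>S. \<alpha> i * t i * F i x) \<partial>M)"
  proof (rule integral_mono[OF _ int le])
    show "integrable M (\<lambda>x. \<Prod>i\<in>S. F i x powr \<alpha> i)"
    proof (rule Bochner_Integration.integrable_bound[OF int])
      show "(\<lambda>x. \<Prod>i\<in>S. F i x powr \<alpha> i) \<in> borel_measurable M" by measurable
      show "AE x in M. norm (\<Prod>i\<in>S. F i x powr \<alpha> i) \<le> norm (\<Sum>i\<in>S. \<alpha> i * t i * F i x)"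
      proof (rule AE_I2)
        fix x
        have "0 \<le> (\<Prod>i\<in>S. F i x powr \<alpha> i)" by (intro prod_nonneg) simp
        then show "norm (\<Prod>i\<in>S. F i x powr \<alpha> i) \<le> norm (\<Sum>i\<in>S. \<alpha> i * t i * F i x)"
          using le[of x] by simp
      qed
    qed
  qed
  also have "\<dots> = (\<Sum>i\<in>S. \<alpha> i * t i * (\<integral>x. F i x \<partial>M))"
    using F(1) by (subst Bochner_Integration.integral_sum) auto
  finally show "(\<integral>x. (\<Prod>i\<in>S. F i x powr \<alpha> i) \<partial>M) \<le> (\<Sum>i\<in>S. \<alpha> i * t i * (\<integral>x. F i x \<partial>M))" .
qed

lemma mod_add_right_cancel_less:
  fixes a b c m :: nat
  assumes eq: "(a + c) mod m = (b + c) mod m" and less: "a < m" "b < m"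
  shows "a = b"
proof (rule ccontr)
  assume "a \<noteq> b"
  then consider "a < b" | "b < a" by linarith
  then show False
  proof cases
    case 1
    then have "m dvd (b + c) - (a + c)" using eq mod_eq_dvd_iff_nat[of "a + c" "b + c" m] by simp
    then show False using 1 less by (auto dest: dvd_imp_le)
  next
    case 2
    then have "m dvd (a + c) - (b + c)" using eq mod_eq_dvd_iff_nat[of "b + c" "a + c" m] by simp
    then show False using 2 less by (auto dest: dvd_imp_le)
  qed
qed

text \<open>Indexing by lists makes concatenation correspond to composition, so powers, block
  decompositions and rotations become identities between lists.\<close>

definition ops_prod :: "('k \<Rightarrow> 'l::real_normed_vector \<Rightarrow>\<^sub>L 'l) \<Rightarrow> 'k list \<Rightarrow> 'l \<Rightarrow>\<^sub>L 'l" where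
  "ops_prod A ks = foldr (\<lambda>k B. A k o\<^sub>L B) ks id_blinfun"

lemma ops_prod_simps [simp]:
  "ops_prod A [] = id_blinfun" "ops_prod A (k # ks) = A k o\<^sub>L ops_prod A ks"
  by (simp_all add: ops_prod_def)

lemma ops_prod_append: "ops_prod A (ks @ ls) = ops_prod A ks o\<^sub>L ops_prod A ls"
  by (induction ks) (auto simp: blinfun_compose_assoc)

lemma ops_prod_eq_map: "map A ks = map B ls \<Longrightarrow> ops_prod A ks = ops_prod B ls"
  by (induction ks arbitrary: ls) auto

lemma ops_prod_replicate: "ops_prod A (concat (replicate n ks)) = op_power (ops_prod A ks) n"
  by (induction n) (auto simp: ops_prod_append)

lemma norm_ops_prod:
  assumes "\<And>k. k \<in> set ks \<Longrightarrow> norm (A k) \<le> c" "0 \<le> c"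
  shows "norm (ops_prod A ks) \<le> c ^ length ks"
  using assms(1)
proof (induction ks)
  case (Cons k ks)
  have "norm (ops_prod A (k # ks)) \<le> norm (A k) * norm (ops_prod A ks)" by (simp add: norm_blinfun_compose)
  also have "\<dots> \<le> c * c ^ length ks" using Cons assms(2) by (intro mult_mono) auto
  finally show ?case by simp
qed (simp add: norm_blinfun_id_le)

lemma mem_product_set_iff:
  "T \<in> product_set m \<Psi> \<longleftrightarrow> (\<exists>A. (\<forall>i\<in>{1..m}. A i \<in> \<Psi> i) \<and> T = ops_prod A [1..<Suc m])"
  unfolding product_set_def ops_prod_def by blast

lemma ops_prod_in_product_set:
  assumes "\<And>j. j < m \<Longrightarrow> C (p + j) \<in> \<Psi> (Suc j)"
  shows "ops_prod C [p..<p + m] \<in> product_set m \<Psi>"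
  unfolding mem_product_set_iff
proof (intro exI conjI ballI)
  show "C (p + (i - 1)) \<in> \<Psi> i" if "i \<in> {1..m}" for i
    using assms[of "i - 1"] that by (cases i) auto
  show "ops_prod C [p..<p + m] = ops_prod (\<lambda>i. C (p + (i - 1))) [1..<Suc m]"
    by (intro ops_prod_eq_map nth_equalityI) (auto simp del: upt_Suc)
qed

lemma ops_prod_in_set_power:
  assumes "\<And>k. k \<in> set ks \<Longrightarrow> C k \<in> \<Sigma>"
  shows "ops_prod C ks \<in> set_power \<Sigma> (length ks)"
proof -
  have "ops_prod (\<lambda>j. C (ks ! j)) [0..<0 + length ks] \<in> set_power \<Sigma> (length ks)"
    unfolding set_power_def by (rule ops_prod_in_product_set) (use assms in auto)
  also have "ops_prod (\<lambda>j. C (ks ! j)) [0..<0 + length ks] = ops_prod C ks"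
    by (intro ops_prod_eq_map nth_equalityI) auto
  finally show ?thesis .
qed

lemma mem_set_powerE:
  assumes "T \<in> set_power \<Sigma> n"
  obtains A where "\<And>i. i \<in> {1..n} \<Longrightarrow> A i \<in> \<Sigma>" "T = ops_prod A [1..<Suc n]"
  using assms unfolding set_power_def mem_product_set_iff by blast

lemma set_power_add:
  assumes "T \<in> set_power \<Sigma> (n + k)"
  obtains T1 T2 where "T1 \<in> set_power \<Sigma> n" "T2 \<in> set_power \<Sigma> k" "T = T1 o\<^sub>L T2"
proof -
  obtain A where A: "\<And>i. i \<in> {1..n + k} \<Longrightarrow> A i \<in> \<Sigma>" "T = ops_prod A [1..<Suc (n + k)]"
    by (rule mem_set_powerE[OF assms]) (rule that)
  have "[1..<Suc (n + k)] = [1..<Suc n] @ [Suc n..<Suc (n + k)]"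
    using upt_add_eq_append[of 1 "Suc n" k] by simp
  then have "T = ops_prod A [1..<Suc n] o\<^sub>L ops_prod A [Suc n..<Suc (n + k)]"
    by (simp only: A(2) ops_prod_append)
  moreover have "ops_prod A [1..<Suc n] \<in> set_power \<Sigma> (length [1..<Suc n])"
    by (rule ops_prod_in_set_power) (use A(1) in auto)
  moreover have "ops_prod A [Suc n..<Suc (n + k)] \<in> set_power \<Sigma> (length [Suc n..<Suc (n + k)])"
    by (rule ops_prod_in_set_power) (use A(1) in auto)
  ultimately show ?thesis using that by (simp del: upt_Suc)
qed

lemma op_power_in_set_power:
  assumes "T \<in> set_power \<Sigma> n"
  shows "op_power T m \<in> set_power \<Sigma> (n * m)"
proof -
  obtain A where A: "\<And>i. i \<in> {1..n} \<Longrightarrow> A i \<in> \<Sigma>" "T = ops_prod A [1..<Suc n]"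
    by (rule mem_set_powerE[OF assms]) (rule that)
  have "ops_prod A (concat (replicate m [1..<Suc n])) \<in> set_power \<Sigma> (length (concat (replicate m [1..<Suc n])))"
    by (rule ops_prod_in_set_power) (use A(1) in \<open>auto simp del: upt_Suc split: if_splits\<close>)
  moreover have "length (concat (replicate m [1..<Suc n])) = n * m"
    by (induction m) (auto simp del: upt_Suc)
  ultimately show ?thesis by (simp only: ops_prod_replicate A(2))
qed

text \<open>The index p runs through n blocks of length m aligned at multiples of m;
  \<open>Suc (p mod m)\<close> is the position within a block, as \<Psi> is numbered from 1.\<close>

lemma ops_prod_block_in_set_power:
  assumes "\<And>p. a * m \<le> p \<Longrightarrow> p < (a + n) * m \<Longrightarrow> C p \<in> \<Psi> (Suc (p mod m))"
  shows "ops_prod C [a * m..<(a + n) * m] \<in> set_power (product_set m \<Psi>) n"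
proof -
  define B where "B q = ops_prod C [(a + q) * m..<(a + q) * m + m]" for q
  have B: "B q \<in> product_set m \<Psi>" if "q < n" for q
    unfolding B_def
  proof (rule ops_prod_in_product_set)
    fix j assume j: "j < m"
    have "(a + q) * m + m \<le> (a + n) * m" using mult_le_mono1[of "Suc (a + q)" "a + n" m] that by simp
    then have "C ((a + q) * m + j) \<in> \<Psi> (Suc (((a + q) * m + j) mod m))"
      using j by (intro assms) (auto simp: algebra_simps)
    then show "C ((a + q) * m + j) \<in> \<Psi> (Suc j)" using j by simp
  qed
  have "ops_prod C [a * m..<(a + k) * m] = ops_prod B [0..<k]" for k
  proof (induction k)
    case (Suc k)
    have "[a * m..<(a + Suc k) * m] = [a * m..<(a + k) * m] @ [(a + k) * m..<(a + k) * m + m]"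
      using upt_add_eq_append[of "a * m" "(a + k) * m" m] by (simp add: algebra_simps)
    then show ?case using Suc by (simp add: ops_prod_append B_def)
  qed simp
  moreover have "ops_prod B [0..<n] \<in> set_power (product_set m \<Psi>) (length [0..<n])"
    by (rule ops_prod_in_set_power) (use B in auto)
  ultimately show ?thesis by simp
qed

lemma upt_split: "i \<le> j \<Longrightarrow> j \<le> k \<Longrightarrow> [i..<k] = [i..<j] @ [j..<k]"
  using upt_add_eq_append[of i j "k - j"] by simp

text \<open>A window of n periods starting at offset i: the end of one block, n - 1 complete blocks
  and the beginning of another. The middle is written with 1 * m to match
  \<open>ops_prod_block_in_set_power\<close> at a = 1.\<close>

lemma rotation_split:
  fixes i m n :: nat
  assumes "i < m" "n \<ge> 1"
  shows "[i..<i + n * m] = [i..<m] @ [1 * m..<(1 + (n - 1)) * m] @ [n * m..<n * m + i]"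
proof -
  have n: "m \<le> n * m" "(1 + (n - 1)) * m = n * m" using assms(2) by (auto simp: Suc_diff_le)
  have "[i..<i + n * m] = [i..<m] @ [m..<n * m + i]"
    using upt_split[of i m "i + n * m"] assms n by (simp add: add.commute)
  also have "[m..<n * m + i] = [m..<n * m] @ [n * m..<n * m + i]"
    using upt_split[of m "n * m" "n * m + i"] n by simp
  finally show ?thesis using n by simp
qed

text \<open>The common expression under the roots in both radii, with F the measure of
  noncompactness or the essential spectral radius.\<close>

definition power_sup :: "(('l::banach \<Rightarrow>\<^sub>L 'l) \<Rightarrow> real) \<Rightarrow> ('l \<Rightarrow>\<^sub>L 'l) set \<Rightarrow> nat \<Rightarrow> real" where
  "power_sup F \<Sigma> n = Sup (insert 0 (F ` set_power \<Sigma> n))"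

context order_continuous_function_space begin

section \<open>Products of geometric means\<close>

lemma ops_prod_nn_kernel:
  assumes "ks \<noteq> []" "\<And>k. k \<in> set ks \<Longrightarrow> \<exists>h. nn_kernel (H k) h"
  shows "\<exists>h. nn_kernel (ops_prod H ks) h"
  using assms
proof (induction ks rule: list_nonempty_induct)
  case (cons k ks)
  obtain h where h: "nn_kernel (H k) h" using cons.prems[of k] by auto
  obtain h' where h': "nn_kernel (ops_prod H ks) h'" using cons.IH cons.prems by auto
  show ?case
    unfolding ops_prod_simps
    by (rule exI[where x = "\<lambda>p. \<integral>y. h (fst p, y) * h' (y, snd p) \<partial>M"]) (rule nn_kernel_compose[OF h h'])
qed auto

lemma ops_prod_nonneg:
  assumes "\<And>k. k \<in> set ks \<Longrightarrow> \<exists>h. nn_kernel (H k) h" "f \<in> fun_nonneg M rep"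
  shows "ops_prod H ks f \<in> fun_nonneg M rep"
  using assms by (induction ks) (auto dest: nn_kernel_nonneg)

lemma modulus_of_nonneg: "f \<in> fun_nonneg M rep \<Longrightarrow> modulus f = f"
  by (rule rep_inject) (use rep_modulus[of f] in \<open>auto simp: nonneg_iff elim!: AE_mp\<close>)

text \<open>Induction along the list: each further factor is an integral against a geometric mean of
  kernels, to which Hoelder's inequality applies. For the empty product, the identity, the claim
  holds since the weights sum to 1.\<close>

lemma ops_prod_geometric_mean_le:
  assumes S: "finite S" "\<And>i. i \<in> S \<Longrightarrow> \<alpha> i > 0" "sum \<alpha> S = 1"
    and A: "\<And>k i. k \<in> set ks \<Longrightarrow> i \<in> S \<Longrightarrow> nn_kernel (A k i) (a k i)"
    and H: "\<And>k. k \<in> set ks \<Longrightarrow> nn_kernel (H k) (\<lambda>p. \<Prod>i\<in>S. a k i p powr \<alpha> i)"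
    and f: "f \<in> fun_nonneg M rep"
  shows "AE x in M. cmod (rep (ops_prod H ks f) x) \<le> (\<Prod>i\<in>S. cmod (rep (ops_prod (\<lambda>k. A k i) ks f) x) powr \<alpha> i)"
  using A H
proof (induction ks)
  case Nil
  have "x \<le> (\<Prod>i\<in>S. x powr \<alpha> i)" if "0 \<le> x" for x :: real
  proof (cases "x = 0")
    case True
    then show ?thesis by (simp add: prod_nonneg)
  next
    case False
    then have "(\<Prod>i\<in>S. x powr \<alpha> i) = x powr (sum \<alpha> S)" using S(1) by (simp add: powr_sum)
    then show ?thesis using S(3) that by simp
  qed
  then show ?case by simp
next
  case (Cons k ks)
  let ?g = "ops_prod H ks f" and ?gi = "\<lambda>i. ops_prod (\<lambda>k. A k i) ks f"
  have g: "modulus ?g = ?g"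
    by (intro modulus_of_nonneg ops_prod_nonneg f) (use Cons.prems(2) in auto)
  have gi: "modulus (?gi i) = ?gi i" if "i \<in> S" for i
    by (intro modulus_of_nonneg ops_prod_nonneg f) (use Cons.prems(1) that in auto)
  have IH: "AE y in M. cmod (rep ?g y) \<le> (\<Prod>i\<in>S. cmod (rep (?gi i) y) powr \<alpha> i)"
    using Cons by auto
  have Hk: "nn_kernel (H k) (\<lambda>p. \<Prod>i\<in>S. a k i p powr \<alpha> i)" using Cons.prems(2) by simp
  have Ak: "nn_kernel (A k i) (a k i)" if "i \<in> S" for i using Cons.prems(1) that by simp
  have "AE x in M. \<forall>i\<in>S. integrable M (\<lambda>y. a k i (x, y) * cmod (rep (?gi i) y)) \<and>
      rep (A k i (?gi i)) x = of_real (\<integral>y. a k i (x, y) * cmod (rep (?gi i) y) \<partial>M)"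
  proof (rule AE_finite_allI[OF S(1)])
    fix i assume i: "i \<in> S"
    show "AE x in M. integrable M (\<lambda>y. a k i (x, y) * cmod (rep (?gi i) y)) \<and>
      rep (A k i (?gi i)) x = of_real (\<integral>y. a k i (x, y) * cmod (rep (?gi i) y) \<partial>M)"
      using nn_kernel_modulus[OF Ak[OF i], of "?gi i"] by (simp only: gi[OF i])
  qed
  then show ?case
    using nn_kernel_modulus[OF Hk, of ?g] AE_space unfolding g
  proof eventually_elim
    case (elim x)
    have [measurable]: "a k i \<in> borel_measurable (M \<Otimes>\<^sub>M M)" if "i \<in> S" for i by (rule nn_kernelD(1)[OF Ak[OF that]])
    have le: "AE y in M. (\<Prod>i\<in>S. a k i (x, y) powr \<alpha> i) * cmod (rep ?g y)
        \<le> (\<Prod>i\<in>S. (a k i (x, y) * cmod (rep (?gi i) y)) powr \<alpha> i)"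
      using IH
    proof eventually_elim
      case (elim y)
      have "(\<Prod>i\<in>S. a k i (x, y) powr \<alpha> i) * cmod (rep ?g y)
          \<le> (\<Prod>i\<in>S. a k i (x, y) powr \<alpha> i) * (\<Prod>i\<in>S. cmod (rep (?gi i) y) powr \<alpha> i)"
        using elim by (intro mult_left_mono prod_nonneg) auto
      also have "\<dots> = (\<Prod>i\<in>S. (a k i (x, y) * cmod (rep (?gi i) y)) powr \<alpha> i)"
        unfolding prod.distrib[symmetric]
        by (intro prod.cong refl) (simp add: powr_mult nn_kernelD(2)[OF Ak])
      finally show ?case .
    qed
    have int: "integrable M (\<lambda>y. \<Sum>i\<in>S. \<alpha> i * (a k i (x, y) * cmod (rep (?gi i) y)))"
      using elim(1) by (intro Bochner_Integration.integrable_sum integrable_mult_right) auto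
    have int2: "integrable M (\<lambda>y. \<Prod>i\<in>S. (a k i (x, y) * cmod (rep (?gi i) y)) powr \<alpha> i)"
    proof (rule Bochner_Integration.integrable_bound[OF int])
      show "(\<lambda>y. \<Prod>i\<in>S. (a k i (x, y) * cmod (rep (?gi i) y)) powr \<alpha> i) \<in> borel_measurable M"
        using elim(3) by measurable
      show "AE y in M. norm (\<Prod>i\<in>S. (a k i (x, y) * cmod (rep (?gi i) y)) powr \<alpha> i)
          \<le> norm (\<Sum>i\<in>S. \<alpha> i * (a k i (x, y) * cmod (rep (?gi i) y)))"
      proof (rule AE_I2)
        fix y
        have "(\<Prod>i\<in>S. (a k i (x, y) * cmod (rep (?gi i) y)) powr \<alpha> i) \<le> (\<Sum>i\<in>S. \<alpha> i * (a k i (x, y) * cmod (rep (?gi i) y)))"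
          by (rule weighted_arith_geom_mean[OF S]) (auto simp: nn_kernelD(2)[OF Ak])
        moreover have "0 \<le> (\<Prod>i\<in>S. (a k i (x, y) * cmod (rep (?gi i) y)) powr \<alpha> i)" by (intro prod_nonneg) simp
        ultimately show "norm (\<Prod>i\<in>S. (a k i (x, y) * cmod (rep (?gi i) y)) powr \<alpha> i)
          \<le> norm (\<Sum>i\<in>S. \<alpha> i * (a k i (x, y) * cmod (rep (?gi i) y)))" by simp
      qed
    qed
    have "0 \<le> (\<integral>y. (\<Prod>i\<in>S. a k i (x, y) powr \<alpha> i) * cmod (rep ?g y) \<partial>M)"
      by (intro integral_nonneg_AE AE_I2 mult_nonneg_nonneg prod_nonneg) auto
    then have "cmod (rep (H k ?g) x) = (\<integral>y. (\<Prod>i\<in>S. a k i (x, y) powr \<alpha> i) * cmod (rep ?g y) \<partial>M)"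
      using elim(2) by simp
    also have "\<dots> \<le> (\<integral>y. (\<Prod>i\<in>S. (a k i (x, y) * cmod (rep (?gi i) y)) powr \<alpha> i) \<partial>M)"
      using elim(2) by (intro integral_mono_AE int2 le) auto
    also have "\<dots> \<le> (\<Prod>i\<in>S. (\<integral>y. a k i (x, y) * cmod (rep (?gi i) y) \<partial>M) powr \<alpha> i)"
      using elim(1) by (intro holder_prod_powr S) (auto simp: nn_kernelD(2)[OF Ak])
    also have "\<dots> \<le> (\<Prod>i\<in>S. cmod (rep (A k i (?gi i)) x) powr \<alpha> i)"
    proof (intro prod_mono conjI powr_mono2)
      fix i assume i: "i \<in> S"
      show "0 \<le> (\<integral>y. a k i (x, y) * cmod (rep (?gi i) y) \<partial>M)"
        using nn_kernelD(2)[OF Ak[OF i]] by (intro integral_nonneg_AE) auto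
      show "(\<integral>y. a k i (x, y) * cmod (rep (?gi i) y) \<partial>M) \<le> cmod (rep (A k i (?gi i)) x)"
        using elim(1) i by simp
    qed (use S(2) in \<open>auto simp: less_imp_le\<close>)
    finally show ?case by simp
  qed
qed

lemma noncompactness_ops_prod_le:
  assumes S: "finite S" "\<And>i. i \<in> S \<Longrightarrow> \<alpha> i > 0" "sum \<alpha> S = 1" and ks: "ks \<noteq> []"
    and A: "\<And>k i. k \<in> set ks \<Longrightarrow> i \<in> S \<Longrightarrow> nn_kernel (A k i) (a k i)"
    and H: "\<And>k. k \<in> set ks \<Longrightarrow> nn_kernel (H k) (\<lambda>p. \<Prod>i\<in>S. a k i p powr \<alpha> i)"
  shows "\<beta> (ops_prod H ks) \<le> (\<Prod>i\<in>S. \<beta> (ops_prod (\<lambda>k. A k i) ks) powr \<alpha> i)"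
proof (rule le_prod_powr_optimize[OF S hausdorff_noncompactness_nonneg])
  obtain h where h: "nn_kernel (ops_prod H ks) h" using ops_prod_nn_kernel[OF ks] H by metis
  fix t assume t: "\<And>i. i \<in> S \<Longrightarrow> t i > 0" "(\<Prod>i\<in>S. t i powr \<alpha> i) = 1"
  show "\<beta> (ops_prod H ks) \<le> (\<Sum>i\<in>S. \<alpha> i * t i * \<beta> (ops_prod (\<lambda>k. A k i) ks))"
  proof (rule noncompactness_le_weighted_sum[OF h S(1)])
    show "0 \<le> \<alpha> i * t i" if "i \<in> S" for i using S(2)[OF that] t(1)[OF that] by simp
    fix f assume f: "f \<in> fun_nonneg M rep"
    have "AE x in M. cmod (rep (ops_prod H ks f) x) \<le> (\<Prod>i\<in>S. cmod (rep (ops_prod (\<lambda>k. A k i) ks f) x) powr \<alpha> i)"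
      using S A H f by (rule ops_prod_geometric_mean_le)
    then show "AE x in M. cmod (rep (ops_prod H ks f) x) \<le> (\<Sum>i\<in>S. \<alpha> i * t i * cmod (rep (ops_prod (\<lambda>k. A k i) ks f) x))"
    proof eventually_elim
      case (elim x)
      also have "(\<Prod>i\<in>S. cmod (rep (ops_prod (\<lambda>k. A k i) ks f) x) powr \<alpha> i)
          \<le> (\<Sum>i\<in>S. \<alpha> i * t i * cmod (rep (ops_prod (\<lambda>k. A k i) ks f) x))"
        by (rule weighted_arith_geom_mean_scaled[OF S _ t]) auto
      finally show ?case .
    qed
  qed
qed

text \<open>The n-th power of the product is the product over the n-fold repeated list, and its
  columns are the n-th powers of the columns. So the bound for \<open>\<beta>\<close> holds for all
  powers, and the two halves of Gelfand's formula translate it.\<close>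

lemma ess_spectral_radius_ops_prod_le:
  assumes S: "finite S" "\<And>i. i \<in> S \<Longrightarrow> \<alpha> i > 0" "sum \<alpha> S = 1" and ks: "ks \<noteq> []"
    and A: "\<And>k i. k \<in> set ks \<Longrightarrow> i \<in> S \<Longrightarrow> nn_kernel (A k i) (a k i)"
    and H: "\<And>k. k \<in> set ks \<Longrightarrow> nn_kernel (H k) (\<lambda>p. \<Prod>i\<in>S. a k i p powr \<alpha> i)"
  shows "ess_spectral_radius M rep (ops_prod H ks)
    \<le> (\<Prod>i\<in>S. ess_spectral_radius M rep (ops_prod (\<lambda>k. A k i) ks) powr \<alpha> i)"
proof (rule le_prod_powr_limit[OF S(2)])
  let ?P = "\<lambda>i. ops_prod (\<lambda>k. A k i) ks"
  have P: "\<exists>p. nn_kernel (?P i) p" if "i \<in> S" for i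
    using ops_prod_nn_kernel[OF ks, of "\<lambda>k. A k i"] A that by metis
  have cl: "complex_linear M rep (?P i)" if "i \<in> S" for i
    using P[OF that] nn_kernelD(3) has_kernel_complex_linear by blast
  then show "0 \<le> ess_spectral_radius M rep (?P i)" if "i \<in> S" for i
    using that by (intro ess_spectral_radius_nonneg) auto
  obtain h where h: "nn_kernel (ops_prod H ks) h" using ops_prod_nn_kernel[OF ks] H by metis
  fix c assume c: "\<And>i. i \<in> S \<Longrightarrow> ess_spectral_radius M rep (?P i) < c i"
  have c0: "0 < c i" if "i \<in> S" for i using c[OF that] ess_spectral_radius_nonneg[OF cl[OF that]] by simp
  have "\<forall>i\<in>S. \<exists>C. \<forall>n. \<beta> (op_power (?P i) n) \<le> C * c i ^ n"
    using hausdorff_noncompactness_power_bound[OF cl c] by blast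
  then obtain C where C: "\<And>i n. i \<in> S \<Longrightarrow> \<beta> (op_power (?P i) n) \<le> C i * c i ^ n" by metis
  have C0: "0 \<le> C i" if "i \<in> S" for i
    using C[OF that, of 0] hausdorff_noncompactness_nonneg[of "op_power (?P i) 0"] by simp
  show "ess_spectral_radius M rep (ops_prod H ks) \<le> (\<Prod>i\<in>S. c i powr \<alpha> i)"
  proof (rule ess_spectral_radius_le_of_power_bound[OF h])
    show "0 < (\<Prod>i\<in>S. c i powr \<alpha> i)" using c0 by (intro prod_pos) (auto simp: less_le)
    fix n :: nat assume n: "n \<ge> 1"
    let ?ks = "concat (replicate n ks)"
    have ne: "?ks \<noteq> []" using n ks by (cases n) auto
    have "\<beta> (op_power (ops_prod H ks) n) = \<beta> (ops_prod H ?ks)" by (simp only: ops_prod_replicate)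
    also have "\<dots> \<le> (\<Prod>i\<in>S. \<beta> (ops_prod (\<lambda>k. A k i) ?ks) powr \<alpha> i)"
      by (rule noncompactness_ops_prod_le[OF S ne]) (use A H in auto)
    also have "\<dots> \<le> (\<Prod>i\<in>S. (C i * c i ^ n) powr \<alpha> i)"
      unfolding ops_prod_replicate
      by (intro prod_mono conjI powr_mono2) (use C S(2) hausdorff_noncompactness_nonneg in \<open>auto simp: less_imp_le\<close>)
    also have "\<dots> = (\<Prod>i\<in>S. C i powr \<alpha> i * (c i powr \<alpha> i) ^ n)"
    proof (intro prod.cong refl)
      fix i assume i: "i \<in> S"
      have "(c i ^ n) powr \<alpha> i = (c i powr \<alpha> i) ^ n"
        using c0[OF i] by (simp add: powr_powr mult.commute flip: powr_realpow)
      then show "(C i * c i ^ n) powr \<alpha> i = C i powr \<alpha> i * (c i powr \<alpha> i) ^ n"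
        using C0[OF i] c0[OF i] by (simp add: powr_mult)
    qed
    also have "\<dots> = (\<Prod>i\<in>S. C i powr \<alpha> i) * (\<Prod>i\<in>S. c i powr \<alpha> i) ^ n"
      by (simp add: prod.distrib prod_power_distrib)
    finally show "\<beta> (op_power (ops_prod H ks) n) \<le> (\<Prod>i\<in>S. C i powr \<alpha> i) * (\<Prod>i\<in>S. c i powr \<alpha> i) ^ n" .
  qed
qed

text \<open>(AB) ^ (j + 1) = A (BA) ^ j B, so growth bounds for \<open>\<beta>\<close> on the powers
  of BA carry over to AB up to a constant factor.\<close>

lemma ess_spectral_radius_commute_le:
  assumes AB: "nn_kernel (A o\<^sub>L B) k" and BA: "complex_linear M rep (B o\<^sub>L A)"
  shows "ess_spectral_radius M rep (A o\<^sub>L B) \<le> ess_spectral_radius M rep (B o\<^sub>L A)"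
proof (rule dense_ge)
  fix s assume s: "ess_spectral_radius M rep (B o\<^sub>L A) < s"
  have s0: "0 < s" using ess_spectral_radius_nonneg[OF BA] s by simp
  obtain C where C: "\<And>n. \<beta> (op_power (B o\<^sub>L A) n) \<le> C * s ^ n"
    using hausdorff_noncompactness_power_bound[OF BA s] by blast
  show "ess_spectral_radius M rep (A o\<^sub>L B) \<le> s"
  proof (rule ess_spectral_radius_le_of_power_bound[OF AB s0])
    fix n :: nat assume "n \<ge> 1"
    then obtain j where n: "n = Suc j" by (cases n) auto
    have "op_power (A o\<^sub>L B) n = op_power (A o\<^sub>L B) (j + 1)" by (simp only: n Suc_eq_plus1)
    also have "\<dots> = op_power (A o\<^sub>L B) j o\<^sub>L op_power (A o\<^sub>L B) 1" by (rule op_power_add)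
    also have "op_power (A o\<^sub>L B) 1 = A o\<^sub>L B" by simp
    also have "op_power (A o\<^sub>L B) j o\<^sub>L (A o\<^sub>L B) = (op_power (A o\<^sub>L B) j o\<^sub>L A) o\<^sub>L B"
      by (rule blinfun_compose_assoc[symmetric])
    also have "\<dots> = A o\<^sub>L (op_power (B o\<^sub>L A) j o\<^sub>L B)"
      by (simp only: op_power_shift blinfun_compose_assoc)
    finally have "\<beta> (op_power (A o\<^sub>L B) n) \<le> \<beta> A * \<beta> (op_power (B o\<^sub>L A) j o\<^sub>L B)"
      by (simp only: hausdorff_noncompactness_compose)
    also have "\<dots> \<le> \<beta> A * (\<beta> (op_power (B o\<^sub>L A) j) * \<beta> B)"
      by (intro mult_left_mono hausdorff_noncompactness_compose hausdorff_noncompactness_nonneg)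
    also have "\<dots> \<le> \<beta> A * ((C * s ^ j) * \<beta> B)"
      by (intro mult_left_mono mult_right_mono C hausdorff_noncompactness_nonneg)
    also have "\<dots> = (\<beta> A * \<beta> B * C / s) * s ^ n" using s0 by (simp add: n)
    finally show "\<beta> (op_power (A o\<^sub>L B) n) \<le> (\<beta> A * \<beta> B * C / s) * s ^ n" .
  qed
qed

text \<open>Division with remainder n = m q + r bounds \<open>\<beta>\<close> of T ^ n by that of (T
  ^ m) ^ q times one of finitely many constants.\<close>

lemma ess_spectral_radius_le_root_power:
  assumes T: "nn_kernel T k" and m: "m \<ge> 1"
  shows "ess_spectral_radius M rep T \<le> ess_spectral_radius M rep (op_power T m) powr (1 / real m)"
proof -
  have clT: "complex_linear M rep T" by (rule has_kernel_complex_linear[OF nn_kernelD(3)[OF T]])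
  have cl: "complex_linear M rep (op_power T m)"
    using clT calkin.commuting_power[of "endo_of T" m] by (simp add: commuting_iff op_of_power op_of_simps)
  \<comment> \<open>A product over one index, which lets \<open>le_prod_powr_limit\<close> perform
    the passage to strict upper bounds.\<close>
  have "ess_spectral_radius M rep T \<le> (\<Prod>i\<in>{0::nat}. ess_spectral_radius M rep (op_power T m) powr (1 / real m))"
  proof (rule le_prod_powr_limit)
    fix c :: "nat \<Rightarrow> real" assume "\<And>i. i \<in> {0} \<Longrightarrow> ess_spectral_radius M rep (op_power T m) < c i"
    then have c: "ess_spectral_radius M rep (op_power T m) < c 0" by simp
    have c0: "0 < c 0" using ess_spectral_radius_nonneg[OF cl] c by simp
    obtain C where C: "\<And>n. \<beta> (op_power (op_power T m) n) \<le> C * c 0 ^ n"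
      using hausdorff_noncompactness_power_bound[OF cl c] by blast
    have C0: "0 \<le> C" using order_trans[OF hausdorff_noncompactness_nonneg C[of 0]] by simp
    define t where "t = c 0 powr (1 / real m)"
    have t0: "0 < t" using c0 by (simp add: t_def)
    have tm: "t ^ m = c 0" using c0 m by (simp add: t_def powr_powr flip: powr_realpow)
    have "ess_spectral_radius M rep T \<le> t"
    proof (rule ess_spectral_radius_le_of_power_bound[OF T t0])
      fix n :: nat
      let ?q = "n div m" and ?r = "n mod m"
      have "op_power T n = op_power T (m * ?q + ?r)" by (simp only: mult_div_mod_eq)
      also have "\<dots> = op_power (op_power T m) ?q o\<^sub>L op_power T ?r"
        by (simp only: op_power_add op_power_mult)
      finally have "\<beta> (op_power T n) \<le> \<beta> (op_power (op_power T m) ?q) * \<beta> (op_power T ?r)"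
        by (simp only: hausdorff_noncompactness_compose)
      also have "\<dots> \<le> (C * c 0 ^ ?q) * norm T ^ ?r"
        by (intro mult_mono C order_trans[OF hausdorff_noncompactness_le_norm norm_op_power])
          (auto simp: hausdorff_noncompactness_nonneg C0 c0 less_imp_le)
      also have "\<dots> = C * (norm T / t) ^ ?r * t ^ n"
      proof -
        have "t ^ n = c 0 ^ ?q * t ^ ?r" by (metis tm power_mult power_add mult_div_mod_eq)
        then show ?thesis using t0 by (simp add: power_divide)
      qed
      also have "\<dots> \<le> C * (\<Sum>r<m. (norm T / t) ^ r) * t ^ n"
        using m t0 C0 by (intro mult_right_mono mult_left_mono member_le_sum) auto
      finally show "\<beta> (op_power T n) \<le> C * (\<Sum>r<m. (norm T / t) ^ r) * t ^ n" .
    qed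
    then show "ess_spectral_radius M rep T \<le> (\<Prod>i\<in>{0}. c i powr (1 / real m))" by (simp add: t_def)
  qed (use m ess_spectral_radius_nonneg[OF cl] in auto)
  then show ?thesis by simp
qed

text \<open>Existence: the geometric mean of the kernels lies below the kernel of the weighted sum
  of the A i, whose norm also bounds that of the mean. Uniqueness: kernels are determined a.e., so
  the description in \<open>hadamard_mean\<close> denotes this operator.\<close>

lemma hadamard_mean_nn_kernel:
  assumes m: "m \<ge> 1" and \<alpha>: "\<And>i. i \<in> {1..m} \<Longrightarrow> \<alpha> i > 0" "sum \<alpha> {1..m} = 1"
    and A: "\<And>i. i \<in> {1..m} \<Longrightarrow> \<exists>k. nn_kernel (A i) k"
  shows "\<exists>a. (\<forall>i\<in>{1..m}. nn_kernel (A i) (a i)) \<and>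
      nn_kernel (hadamard_mean M rep m \<alpha> A) (\<lambda>p. \<Prod>i\<in>{1..m}. a i p powr \<alpha> i)"
    and "norm (hadamard_mean M rep m \<alpha> A) \<le> (\<Sum>i = 1..m. \<alpha> i * norm (A i))"
proof -
  let ?S = "{1..m}"
  obtain a where a: "\<And>i. i \<in> ?S \<Longrightarrow> nn_kernel (A i) (a i)" using A by metis
  have am [measurable]: "a i \<in> borel_measurable (M \<Otimes>\<^sub>M M)" if "i \<in> ?S" for i by (rule nn_kernelD(1)[OF a[OF that]])
  let ?h = "\<lambda>p. \<Prod>i\<in>?S. a i p powr \<alpha> i" and ?B = "\<Sum>i\<in>?S. \<alpha> i *\<^sub>R A i"
  have B: "nn_kernel ?B (\<lambda>p. \<Sum>i\<in>?S. \<alpha> i * a i p)"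
  proof -
    have "has_kernel M rep ?B (\<lambda>p. \<Sum>i\<in>?S. of_real (\<alpha> i) * of_real (a i p))"
      by (intro has_kernel_sum has_kernel_scaleR nn_kernelD(3) a)
    moreover have "0 \<le> (\<Sum>i\<in>?S. \<alpha> i * a i p)" for p
      using \<alpha>(1) nn_kernelD(2)[OF a] by (intro sum_nonneg mult_nonneg_nonneg) (auto simp: less_imp_le)
    ultimately show ?thesis unfolding nn_kernel_def by (auto intro!: borel_measurable_sum)
  qed
  have hm: "?h \<in> borel_measurable (M \<Otimes>\<^sub>M M)" by measurable
  have "?h p \<le> (\<Sum>i\<in>?S. \<alpha> i * a i p)" for p
    by (rule weighted_arith_geom_mean[OF _ \<alpha>]) (auto simp: nn_kernelD(2)[OF a])
  then obtain H where H: "nn_kernel H ?h" "norm H \<le> norm ?B"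
    using ex_dominated_nn_kernel[OF B hm] by (auto simp: prod_nonneg)
  have "hadamard_mean M rep m \<alpha> A = H"
    unfolding hadamard_mean_def
  proof (rule the_equality)
    show "\<exists>a. (\<forall>i\<in>?S. has_kernel M rep (A i) (a i)) \<and> has_kernel M rep H (\<lambda>p. of_real (\<Prod>i = 1..m. cmod (a i p) powr \<alpha> i))"
    proof (intro exI conjI ballI)
      show "has_kernel M rep (A i) (\<lambda>p. of_real (a i p))" if "i \<in> ?S" for i by (rule nn_kernelD(3)[OF a[OF that]])
      have "(\<Prod>i = 1..m. cmod (complex_of_real (a i p)) powr \<alpha> i) = ?h p" for p
        by (intro prod.cong refl) (simp add: nn_kernelD(2)[OF a])
      then show "has_kernel M rep H (\<lambda>p. of_real (\<Prod>i = 1..m. cmod (complex_of_real (a i p)) powr \<alpha> i))"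
        using nn_kernelD(3)[OF H(1)] by simp
    qed
    fix H' assume "\<exists>a. (\<forall>i\<in>?S. has_kernel M rep (A i) (a i)) \<and> has_kernel M rep H' (\<lambda>p. of_real (\<Prod>i = 1..m. cmod (a i p) powr \<alpha> i))"
    then obtain b where b: "\<And>i. i \<in> ?S \<Longrightarrow> has_kernel M rep (A i) (b i)"
      and H': "has_kernel M rep H' (\<lambda>p. of_real (\<Prod>i = 1..m. cmod (b i p) powr \<alpha> i))" by blast
    have "AE p in M \<Otimes>\<^sub>M M. \<forall>i\<in>?S. b i p = of_real (a i p)"
      by (rule AE_finite_allI) (auto intro: kernel_AE_unique[OF b nn_kernelD(3)[OF a]])
    then have "AE p in M \<Otimes>\<^sub>M M. complex_of_real (\<Prod>i = 1..m. cmod (b i p) powr \<alpha> i) = of_real (?h p)"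
    proof eventually_elim
      case (elim p)
      have "(\<Prod>i = 1..m. cmod (b i p) powr \<alpha> i) = ?h p"
        using elim by (intro prod.cong refl) (simp add: nn_kernelD(2)[OF a])
      then show ?case by simp
    qed
    then have "has_kernel M rep H' (\<lambda>p. of_real (?h p))"
      using hm by (intro has_kernel_cong_AE[OF H']) auto
    then show "H' = H" by (rule has_kernel_operator_unique[OF _ nn_kernelD(3)[OF H(1)]])
  qed
  with H have H': "nn_kernel (hadamard_mean M rep m \<alpha> A) ?h" "norm (hadamard_mean M rep m \<alpha> A) \<le> norm ?B"
    by simp_all
  show "\<exists>a. (\<forall>i\<in>?S. nn_kernel (A i) (a i)) \<and>
      nn_kernel (hadamard_mean M rep m \<alpha> A) (\<lambda>p. \<Prod>i\<in>?S. a i p powr \<alpha> i)"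
    using a H'(1) by blast
  have "norm ?B \<le> (\<Sum>i\<in>?S. norm (\<alpha> i *\<^sub>R A i))" by (rule norm_sum)
  also have "\<dots> = (\<Sum>i\<in>?S. \<alpha> i * norm (A i))"
    using \<alpha>(1) by (intro sum.cong refl) (simp add: less_imp_le)
  finally show "norm (hadamard_mean M rep m \<alpha> A) \<le> (\<Sum>i = 1..m. \<alpha> i * norm (A i))" using H'(2) by simp
qed

section \<open>Generalized and joint essential spectral radius\<close>

definition bounded_nn_kernels :: "('l \<Rightarrow>\<^sub>L 'l) set \<Rightarrow> bool" where
  "bounded_nn_kernels \<Sigma> \<longleftrightarrow> bounded \<Sigma> \<and> (\<forall>A\<in>\<Sigma>. \<exists>k. nn_kernel A k)"

lemma bounded_nn_kernelsE:
  assumes "bounded_nn_kernels \<Sigma>"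
  obtains c where "1 \<le> c" "\<And>A. A \<in> \<Sigma> \<Longrightarrow> norm A \<le> c"
proof -
  obtain b where "\<And>A. A \<in> \<Sigma> \<Longrightarrow> norm A \<le> b" using assms by (auto simp: bounded_nn_kernels_def bounded_iff)
  then show ?thesis using that[of "max b 1"] by fastforce
qed

lemma set_power_nn_kernel:
  assumes "bounded_nn_kernels \<Sigma>" "n \<ge> 1" "T \<in> set_power \<Sigma> n"
  shows "\<exists>k. nn_kernel T k"
proof -
  obtain A where A: "\<And>i. i \<in> {1..n} \<Longrightarrow> A i \<in> \<Sigma>" "T = ops_prod A [1..<Suc n]"
    by (rule mem_set_powerE[OF assms(3)]) (rule that)
  show ?thesis
    unfolding A(2) by (rule ops_prod_nn_kernel) (use assms(1,2) A(1) in \<open>auto simp: bounded_nn_kernels_def\<close>)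
qed

lemma product_set_norm_le:
  assumes "\<And>i A. i \<in> {1..m} \<Longrightarrow> A \<in> \<Psi> i \<Longrightarrow> norm A \<le> c" "1 \<le> c" "T \<in> product_set m \<Psi>"
  shows "norm T \<le> c ^ m"
proof -
  obtain A where A: "\<forall>i\<in>{1..m}. A i \<in> \<Psi> i" "T = ops_prod A [1..<Suc m]"
    using assms(3) unfolding mem_product_set_iff by blast
  have "norm (ops_prod A [1..<Suc m]) \<le> c ^ length [1..<Suc m]"
  proof (rule norm_ops_prod)
    fix i assume "i \<in> set [1..<Suc m]"
    then have i: "i \<in> {1..m}" by auto
    show "norm (A i) \<le> c" by (rule assms(1)[OF i bspec[OF A(1) i]])
  qed (use assms(2) in simp)
  then show ?thesis by (simp add: A(2) del: upt_Suc)
qed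

lemma bounded_nn_kernels_product_set:
  assumes m: "m \<ge> 1" and \<Psi>: "\<And>i. i \<in> {1..m} \<Longrightarrow> bounded_nn_kernels (\<Psi> i)"
  obtains c where "1 \<le> c" "\<And>i A. i \<in> {1..m} \<Longrightarrow> A \<in> \<Psi> i \<Longrightarrow> norm A \<le> c" "bounded_nn_kernels (product_set m \<Psi>)"
proof -
  have "\<exists>c. \<forall>i\<in>{1..m}. 1 \<le> c i \<and> (\<forall>A\<in>\<Psi> i. norm A \<le> c i)"
    using \<Psi> by (intro bchoice ballI) (metis bounded_nn_kernelsE)
  then obtain c where c: "\<And>i. i \<in> {1..m} \<Longrightarrow> 1 \<le> (c i :: real)" "\<And>i A. i \<in> {1..m} \<Longrightarrow> A \<in> \<Psi> i \<Longrightarrow> norm A \<le> c i" by blast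
  define b where "b = (\<Sum>i = 1..m. c i)"
  have cb: "c i \<le> b" if "i \<in> {1..m}" for i
    unfolding b_def using that by (intro member_le_sum) (auto intro: order_trans[OF zero_le_one c(1)])
  have b1: "1 \<le> b" using c(1)[of 1] cb[of 1] m by auto
  have bA: "norm A \<le> b" if "i \<in> {1..m}" "A \<in> \<Psi> i" for i A using c(2)[OF that] cb[OF that(1)] by simp
  have "\<exists>k. nn_kernel T k" if "T \<in> product_set m \<Psi>" for T
  proof -
    obtain A where A: "\<forall>i\<in>{1..m}. A i \<in> \<Psi> i" "T = ops_prod A [1..<Suc m]"
      using \<open>T \<in> product_set m \<Psi>\<close> unfolding mem_product_set_iff by blast
    show ?thesis
      unfolding A(2)
    proof (rule ops_prod_nn_kernel)
      show "\<exists>k. nn_kernel (A i) k" if "i \<in> set [1..<Suc m]" for i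
        using \<Psi>[of i] A(1) that by (auto simp: bounded_nn_kernels_def simp del: upt_Suc)
    qed (use m in simp)
  qed
  moreover have "bounded (product_set m \<Psi>)"
  proof -
    have "norm T \<le> b ^ m" if "T \<in> product_set m \<Psi>" for T
      using bA b1 that by (rule product_set_norm_le)
    then show ?thesis unfolding bounded_iff by blast
  qed
  ultimately have "bounded_nn_kernels (product_set m \<Psi>)" unfolding bounded_nn_kernels_def by blast
  then show ?thesis using that b1 bA by blast
qed

lemma bounded_nn_kernels_hadamard:
  assumes m: "m \<ge> 1" and \<alpha>: "\<And>i. i \<in> {1..m} \<Longrightarrow> \<alpha> i > 0" "sum \<alpha> {1..m} = 1"
    and \<Psi>: "\<And>i. i \<in> {1..m} \<Longrightarrow> bounded_nn_kernels (\<Psi> i)"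
  shows "bounded_nn_kernels (hadamard_mean_set M rep m \<alpha> \<Psi>)"
proof -
  obtain c where c: "1 \<le> c" "\<And>i A. i \<in> {1..m} \<Longrightarrow> A \<in> \<Psi> i \<Longrightarrow> norm A \<le> c"
  proof (rule bounded_nn_kernels_product_set[OF m, of \<Psi>])
    show "bounded_nn_kernels (\<Psi> i)" if "i \<in> {1..m}" for i by (rule \<Psi>[OF that])
  qed (rule that)
  have "norm H \<le> c \<and> (\<exists>k. nn_kernel H k)" if "H \<in> hadamard_mean_set M rep m \<alpha> \<Psi>" for H
  proof -
    obtain A where H: "H = hadamard_mean M rep m \<alpha> A" and A: "\<forall>i\<in>{1..m}. A i \<in> \<Psi> i"
      using \<open>H \<in> _\<close> unfolding hadamard_mean_set_def by blast
    have A': "\<exists>k. nn_kernel (A i) k" if "i \<in> {1..m}" for i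
      using \<Psi>[OF that] A that unfolding bounded_nn_kernels_def by blast
    note hm = hadamard_mean_nn_kernel[of m \<alpha> A, OF m \<alpha> A']
    have "norm H \<le> (\<Sum>i = 1..m. \<alpha> i * norm (A i))" unfolding H by (rule hm(2))
    also have "\<dots> \<le> (\<Sum>i = 1..m. \<alpha> i * c)"
      using A c(2) \<alpha>(1) by (intro sum_mono mult_left_mono) (auto simp: less_imp_le)
    also have "\<dots> = c" using \<alpha>(2) by (simp flip: sum_distrib_right)
    finally show ?thesis using hm(1) unfolding H by blast
  qed
  then show ?thesis unfolding bounded_nn_kernels_def bounded_iff by blast
qed

section \<open>Suprema over powers of a set of operators\<close>

lemma set_power_norm_le:
  assumes "\<And>A. A \<in> \<Sigma> \<Longrightarrow> norm A \<le> c" "1 \<le> c" "T \<in> set_power \<Sigma> n"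
  shows "norm T \<le> c ^ n"
  using assms unfolding set_power_def by (intro product_set_norm_le)

lemma power_sup_le:
  assumes "0 \<le> b" "\<And>T. T \<in> set_power \<Sigma> n \<Longrightarrow> F T \<le> b"
  shows "power_sup F \<Sigma> n \<le> b"
  unfolding power_sup_def using assms by (intro cSup_least) auto

lemma bdd_above_functional:
  assumes F: "\<forall>T k. nn_kernel T k \<longrightarrow> F T \<le> norm T" and \<Sigma>: "bounded_nn_kernels \<Sigma>" and n: "n \<ge> 1"
  shows "bdd_above (insert 0 (F ` set_power \<Sigma> n))"
proof -
  obtain c where c: "1 \<le> c" "\<And>A. A \<in> \<Sigma> \<Longrightarrow> norm A \<le> c" by (rule bounded_nn_kernelsE[OF \<Sigma>]) (rule that)
  have "F T \<le> c ^ n" if "T \<in> set_power \<Sigma> n" for T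
    using set_power_nn_kernel[OF \<Sigma> n that] F set_power_norm_le[OF c(2,1) that] by (meson order_trans)
  then show ?thesis using c(1) by (intro bdd_aboveI[of _ "c ^ n"]) auto
qed

lemma le_power_sup:
  assumes F: "\<forall>T k. nn_kernel T k \<longrightarrow> F T \<le> norm T" and \<Sigma>: "bounded_nn_kernels \<Sigma>" and n: "n \<ge> 1"
    and T: "T \<in> set_power \<Sigma> n"
  shows "F T \<le> power_sup F \<Sigma> n"
  unfolding power_sup_def using bdd_above_functional[OF F \<Sigma> n] T by (intro cSup_upper) auto

lemma power_sup_nonneg:
  assumes F: "\<forall>T k. nn_kernel T k \<longrightarrow> F T \<le> norm T" and \<Sigma>: "bounded_nn_kernels \<Sigma>" and n: "n \<ge> 1"
  shows "0 \<le> power_sup F \<Sigma> n"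
  unfolding power_sup_def using bdd_above_functional[OF F \<Sigma> n] by (intro cSup_upper) auto

lemma power_sup_le_power:
  assumes F: "\<forall>T k. nn_kernel T k \<longrightarrow> F T \<le> norm T" and \<Sigma>: "bounded_nn_kernels \<Sigma>"
  obtains c where "1 \<le> c" "\<And>n. n \<ge> 1 \<Longrightarrow> power_sup F \<Sigma> n \<le> c ^ n"
proof -
  obtain c where c: "1 \<le> c" "\<And>A. A \<in> \<Sigma> \<Longrightarrow> norm A \<le> c" by (rule bounded_nn_kernelsE[OF \<Sigma>]) (rule that)
  have "power_sup F \<Sigma> n \<le> c ^ n" if n: "n \<ge> 1" for n
  proof (rule power_sup_le)
    show "F T \<le> c ^ n" if "T \<in> set_power \<Sigma> n" for T
      using set_power_nn_kernel[OF \<Sigma> n that] F set_power_norm_le[OF c(2,1) that] by (meson order_trans)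
  qed (use c(1) in simp)
  then show ?thesis using that c(1) by blast
qed

end

text \<open>What the two pairs of functional and radius have in common, so that both inequalities
  are proved once. By \<open>multiples\<close>, bounds on products whose length is a multiple of m
  control the radius; \<open>rotate_bound\<close> handles products that begin inside a
  period.\<close>

locale essential_radius = order_continuous_function_space M rep
  for M :: "'a measure" and rep :: "'l::banach \<Rightarrow> 'a \<Rightarrow> complex" +
  fixes F :: "('l \<Rightarrow>\<^sub>L 'l) \<Rightarrow> real" and r :: "('l \<Rightarrow>\<^sub>L 'l) set \<Rightarrow> real"
  assumes F_nonneg: "nn_kernel T k \<Longrightarrow> 0 \<le> F T"
    and F_le_norm: "\<forall>T k. nn_kernel T k \<longrightarrow> F T \<le> norm T"
    and F_geometric_mean: "\<lbrakk>finite S; \<And>i. i \<in> S \<Longrightarrow> \<alpha> i > 0; sum \<alpha> S = 1; ks \<noteq> [];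
      \<And>k i. k \<in> set ks \<Longrightarrow> i \<in> S \<Longrightarrow> nn_kernel (A k i) (a k i);
      \<And>k. k \<in> set ks \<Longrightarrow> nn_kernel (H k) (\<lambda>p. \<Prod>i\<in>S. a k i p powr \<alpha> i)\<rbrakk>
      \<Longrightarrow> F (ops_prod H ks) \<le> (\<Prod>i\<in>(S :: nat set). F (ops_prod (\<lambda>k. A k i) (ks :: nat list)) powr \<alpha> i)"
    and growth: "bounded_nn_kernels \<Sigma> \<Longrightarrow> growth_rate (power_sup F \<Sigma>) (r \<Sigma>)"
    and multiples: "\<lbrakk>bounded_nn_kernels \<Sigma>; m \<ge> 1; s > 0; \<And>n. n \<ge> 1 \<Longrightarrow> power_sup F \<Sigma> (n * m) \<le> C * s ^ n\<rbrakk>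
      \<Longrightarrow> r \<Sigma> \<le> s powr (1 / real m)"
    and rotate_bound: "\<lbrakk>m \<ge> 1; \<And>i. i \<in> {1..m} \<Longrightarrow> bounded_nn_kernels (\<Psi> i); r (product_set m \<Psi>) < s\<rbrakk>
      \<Longrightarrow> \<exists>C\<ge>0. \<forall>n\<ge>1. \<forall>i<m. \<forall>B. (\<forall>p\<in>{i..<i + n * m}. B p \<in> \<Psi> (Suc (p mod m))) \<longrightarrow>
        F (ops_prod B [i..<i + n * m]) \<le> C * s ^ n"
begin

lemmas F_le_power_sup = le_power_sup[of F, OF F_le_norm]

text \<open>A product of n means is governed by its columns, and the i-th column is a product of n
  elements of \<Psi> i. The exponential bounds of the columns combine into their weighted geometric
  mean.\<close>

theorem radius_hadamard_mean_le:
  assumes m: "m \<ge> 1" and \<alpha>: "\<And>i. i \<in> {1..m} \<Longrightarrow> \<alpha> i > 0" "sum \<alpha> {1..m} = 1"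
    and \<Psi>: "\<And>i. i \<in> {1..m} \<Longrightarrow> bounded_nn_kernels (\<Psi> i)"
  shows "r (hadamard_mean_set M rep m \<alpha> \<Psi>) \<le> (\<Prod>i = 1..m. r (\<Psi> i) powr \<alpha> i)"
proof (rule le_prod_powr_limit[OF \<alpha>(1)])
  let ?S = "{1..m}" and ?H = "hadamard_mean_set M rep m \<alpha> \<Psi>"
  note growth_\<Psi> = growth_rateD[OF growth[OF \<Psi>]]
  have H_bdd: "bounded_nn_kernels ?H" using m \<alpha> \<Psi> by (rule bounded_nn_kernels_hadamard)
  note growth_H = growth_rateD[OF growth[OF H_bdd]]
  show "0 \<le> r (\<Psi> i)" if "i \<in> ?S" for i by (rule growth_\<Psi>(1)[OF that])
  fix s assume s: "\<And>i. i \<in> ?S \<Longrightarrow> r (\<Psi> i) < s i"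
  have s0: "0 < s i" if "i \<in> ?S" for i using s[OF that] growth_\<Psi>(1)[OF that] by simp
  have "\<forall>i\<in>?S. \<exists>C\<ge>0. \<forall>n\<ge>1. power_sup F (\<Psi> i) n \<le> C * s i ^ n" using growth_\<Psi>(2) s by blast
  then obtain C where C: "\<And>i. i \<in> ?S \<Longrightarrow> 0 \<le> C i" "\<And>i n. i \<in> ?S \<Longrightarrow> n \<ge> 1 \<Longrightarrow> power_sup F (\<Psi> i) n \<le> C i * s i ^ n" by metis
  show "r ?H \<le> (\<Prod>i\<in>?S. s i powr \<alpha> i)"
  proof (rule growth_H(3))
    show "0 < (\<Prod>i\<in>?S. s i powr \<alpha> i)"
    proof (rule prod_pos)
      show "0 < s i powr \<alpha> i" if "i \<in> ?S" for i using s0[OF that] by simp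
    qed
    fix n :: nat assume n: "n \<ge> 1"
    have "power_sup F ?H n \<le> (\<Prod>i\<in>?S. (C i * s i ^ n) powr \<alpha> i)"
    proof (rule power_sup_le)
      show "0 \<le> (\<Prod>i\<in>?S. (C i * s i ^ n) powr \<alpha> i)" by (intro prod_nonneg) simp
      fix T assume "T \<in> set_power ?H n"
      then obtain H where H: "\<And>k. k \<in> {1..n} \<Longrightarrow> H k \<in> ?H" "T = ops_prod H [1..<Suc n]"
        by (rule mem_set_powerE) (rule that)
      have "\<forall>k\<in>{1..n}. \<exists>A. H k = hadamard_mean M rep m \<alpha> A \<and> (\<forall>i\<in>?S. A i \<in> \<Psi> i)"
        using H(1) unfolding hadamard_mean_set_def by blast
      then obtain A where A: "\<And>k. k \<in> {1..n} \<Longrightarrow> H k = hadamard_mean M rep m \<alpha> (A k)"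
        "\<And>k i. k \<in> {1..n} \<Longrightarrow> i \<in> ?S \<Longrightarrow> A k i \<in> \<Psi> i" by metis
      have "\<forall>k\<in>{1..n}. \<exists>a. (\<forall>i\<in>?S. nn_kernel (A k i) (a i)) \<and> nn_kernel (H k) (\<lambda>p. \<Prod>i\<in>?S. a i p powr \<alpha> i)"
      proof
        fix k assume k: "k \<in> {1..n}"
        have nn: "\<exists>k'. nn_kernel (A k i) k'" if "i \<in> ?S" for i
          using \<Psi>[OF that] A(2)[OF k that] unfolding bounded_nn_kernels_def by blast
        show "\<exists>a. (\<forall>i\<in>?S. nn_kernel (A k i) (a i)) \<and> nn_kernel (H k) (\<lambda>p. \<Prod>i\<in>?S. a i p powr \<alpha> i)"
          unfolding A(1)[OF k] using m \<alpha> nn by (rule hadamard_mean_nn_kernel(1))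
      qed
      from bchoice[OF this] obtain a where
        a': "\<forall>k\<in>{1..n}. (\<forall>i\<in>?S. nn_kernel (A k i) (a k i)) \<and> nn_kernel (H k) (\<lambda>p. \<Prod>i\<in>?S. a k i p powr \<alpha> i)"
        by (rule exE)
      have a: "nn_kernel (A k i) (a k i)" if "k \<in> {1..n}" "i \<in> ?S" for k i using a' that by blast
      have aH: "nn_kernel (H k) (\<lambda>p. \<Prod>i\<in>?S. a k i p powr \<alpha> i)" if "k \<in> {1..n}" for k using a' that by blast
      have set: "set [1..<Suc n] = {1..n}" by (simp only: set_upt atLeastLessThanSuc_atLeastAtMost)
      have "F T \<le> (\<Prod>i\<in>?S. F (ops_prod (\<lambda>k. A k i) [1..<Suc n]) powr \<alpha> i)"
        unfolding H(2) by (rule F_geometric_mean[OF _ \<alpha>, where a = a]) (use a aH n in \<open>simp_all add: set del: upt_Suc\<close>)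
      also have "\<dots> \<le> (\<Prod>i\<in>?S. (C i * s i ^ n) powr \<alpha> i)"
      proof (intro prod_mono conjI powr_mono2)
        fix i assume i: "i \<in> ?S"
        have mem: "ops_prod (\<lambda>k. A k i) [1..<Suc n] \<in> set_power (\<Psi> i) n"
          using ops_prod_in_set_power[of "[1..<Suc n]" "\<lambda>k. A k i" "\<Psi> i"] A(2) i by (simp add: set del: upt_Suc)
        then obtain k where "nn_kernel (ops_prod (\<lambda>k. A k i) [1..<Suc n]) k"
          using set_power_nn_kernel[OF \<Psi>[OF i] n] by blast
        then show "0 \<le> F (ops_prod (\<lambda>k. A k i) [1..<Suc n])" by (rule F_nonneg)
        show "F (ops_prod (\<lambda>k. A k i) [1..<Suc n]) \<le> C i * s i ^ n"
          by (rule order_trans[OF F_le_power_sup[OF \<Psi>[OF i] n mem] C(2)[OF i n]])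
        show "0 \<le> \<alpha> i" using \<alpha>(1)[OF i] by simp
      qed simp
      finally show "F T \<le> (\<Prod>i\<in>?S. (C i * s i ^ n) powr \<alpha> i)" .
    qed
    also have "\<dots> = (\<Prod>i\<in>?S. C i powr \<alpha> i * (s i powr \<alpha> i) ^ n)"
    proof (intro prod.cong refl)
      fix i assume i: "i \<in> ?S"
      have "(s i ^ n) powr \<alpha> i = (s i powr \<alpha> i) ^ n"
        using s0[OF i] by (simp add: powr_powr mult.commute flip: powr_realpow)
      then show "(C i * s i ^ n) powr \<alpha> i = C i powr \<alpha> i * (s i powr \<alpha> i) ^ n"
        using C(1)[OF i] s0[OF i] by (simp add: powr_mult)
    qed
    also have "\<dots> = (\<Prod>i\<in>?S. C i powr \<alpha> i) * (\<Prod>i\<in>?S. s i powr \<alpha> i) ^ n"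
      by (simp add: prod.distrib prod_power_distrib)
    finally show "power_sup F ?H n \<le> (\<Prod>i\<in>?S. C i powr \<alpha> i) * (\<Prod>i\<in>?S. s i powr \<alpha> i) ^ n" .
  qed
qed

text \<open>
  Since all weights are equal, the factors of the \<open>k\<close>-th mean may be shifted cyclically by \<open>k - 1\<close>. Then
  every column of a product of \<open>n m\<close> means is, up to a rotation, a product of \<open>n\<close> elements of \<open>\<Psi>\<^sub>1 \<cdots> \<Psi>\<^sub>m\<close>.
\<close>

theorem radius_hadamard_mean_le_product:
  assumes m: "m \<ge> 1" and \<Psi>: "\<And>i. i \<in> {1..m} \<Longrightarrow> bounded_nn_kernels (\<Psi> i)"
  shows "r (hadamard_mean_set M rep m (\<lambda>_. 1 / real m) \<Psi>) \<le> r (product_set m \<Psi>) powr (1 / real m)"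
proof -
  let ?\<alpha> = "\<lambda>_::nat. 1 / real m" and ?S = "{1..m}"
  let ?H = "hadamard_mean_set M rep m ?\<alpha> \<Psi>" and ?\<Pi> = "product_set m \<Psi>"
  have \<alpha>: "?\<alpha> i > 0" "sum ?\<alpha> ?S = 1" for i using m by simp_all
  have \<Pi>: "bounded_nn_kernels ?\<Pi>" using bounded_nn_kernels_product_set[OF m, of \<Psi>] \<Psi> by blast
  have H_bdd: "bounded_nn_kernels ?H" using m \<alpha> \<Psi> by (rule bounded_nn_kernels_hadamard)
  have "r ?H \<le> (\<Prod>i\<in>{0::nat}. r ?\<Pi> powr (1 / real m))"
  proof (rule le_prod_powr_limit)
    fix c :: "nat \<Rightarrow> real" assume "\<And>i. i \<in> {0} \<Longrightarrow> r ?\<Pi> < c i"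
    then have c: "r ?\<Pi> < c 0" by simp
    have c0: "0 < c 0" using growth_rateD(1)[OF growth[OF \<Pi>]] c by simp
    obtain C where C: "C \<ge> 0" "\<And>n i B. n \<ge> 1 \<Longrightarrow> i < m \<Longrightarrow> (\<And>p. p \<in> {i..<i + n * m} \<Longrightarrow> B p \<in> \<Psi> (Suc (p mod m))) \<Longrightarrow>
        F (ops_prod B [i..<i + n * m]) \<le> C * c 0 ^ n"
      using rotate_bound[OF m \<Psi> c] by blast
    have "r ?H \<le> c 0 powr (1 / real m)"
    proof (rule multiples[OF H_bdd m c0])
      fix n :: nat assume n: "n \<ge> 1"
      let ?N = "n * m"
      have N: "?N \<ge> 1" using n m by simp
      show "power_sup F ?H ?N \<le> C * c 0 ^ n"
      proof (rule power_sup_le)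
        show "0 \<le> C * c 0 ^ n" using C(1) c0 by simp
        fix T assume "T \<in> set_power ?H ?N"
        then obtain H where H: "\<And>k. k \<in> {1..?N} \<Longrightarrow> H k \<in> ?H" "T = ops_prod H [1..<Suc ?N]"
          by (rule mem_set_powerE) (rule that)
        have "\<forall>k\<in>{1..?N}. \<exists>A. H k = hadamard_mean M rep m ?\<alpha> A \<and> (\<forall>i\<in>?S. A i \<in> \<Psi> i)"
          using H(1) unfolding hadamard_mean_set_def by blast
        then obtain A where A: "\<And>k. k \<in> {1..?N} \<Longrightarrow> H k = hadamard_mean M rep m ?\<alpha> (A k)"
          "\<And>k i. k \<in> {1..?N} \<Longrightarrow> i \<in> ?S \<Longrightarrow> A k i \<in> \<Psi> i" by metis
        have "\<forall>k\<in>{1..?N}. \<exists>a. (\<forall>i\<in>?S. nn_kernel (A k i) (a i)) \<and> nn_kernel (H k) (\<lambda>p. \<Prod>i\<in>?S. a i p powr ?\<alpha> i)"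
        proof
          fix k assume k: "k \<in> {1..?N}"
          have nn: "\<exists>k'. nn_kernel (A k i) k'" if "i \<in> ?S" for i
            using \<Psi>[OF that] A(2)[OF k that] unfolding bounded_nn_kernels_def by blast
          show "\<exists>a. (\<forall>i\<in>?S. nn_kernel (A k i) (a i)) \<and> nn_kernel (H k) (\<lambda>p. \<Prod>i\<in>?S. a i p powr ?\<alpha> i)"
            unfolding A(1)[OF k] using m \<alpha> nn by (rule hadamard_mean_nn_kernel(1))
        qed
        from bchoice[OF this] obtain a where
          a': "\<forall>k\<in>{1..?N}. (\<forall>i\<in>?S. nn_kernel (A k i) (a k i)) \<and> nn_kernel (H k) (\<lambda>p. \<Prod>i\<in>?S. a k i p powr ?\<alpha> i)"
          by (rule exE)
        have a: "nn_kernel (A k i) (a k i)" if "k \<in> {1..?N}" "i \<in> ?S" for k i using a' that by blast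
        have aH: "nn_kernel (H k) (\<lambda>p. \<Prod>i\<in>?S. a k i p powr ?\<alpha> i)" if "k \<in> {1..?N}" for k using a' that by blast
        \<comment> \<open>With i - 1 and k - 1 counted from 0, the cyclic shift is addition modulo
          m; \<open>Suc\<close> returns to the numbering from 1.\<close>
        define \<sigma> where "\<sigma> k i = Suc ((i - 1 + (k - 1)) mod m)" for k i :: nat
        have \<sigma>S: "\<sigma> k i \<in> ?S" for k i using m by (simp add: \<sigma>_def Suc_le_eq)
        have \<sigma>: "bij_betw (\<sigma> k) ?S ?S" for k
        proof -
          have "inj_on (\<sigma> k) ?S"
          proof (rule inj_onI)
            fix i j assume ij: "i \<in> ?S" "j \<in> ?S" "\<sigma> k i = \<sigma> k j"
            have "i - 1 = j - 1"
              by (rule mod_add_right_cancel_less[of _ "k - 1" m]) (use ij in \<open>auto simp: \<sigma>_def\<close>)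
            then show "i = j" using ij by auto
          qed
          moreover have "\<sigma> k ` ?S \<subseteq> ?S" using \<sigma>S by auto
          ultimately show ?thesis by (simp add: bij_betw_def endo_inj_surj)
        qed
        have set: "set [1..<Suc ?N] = {1..?N}" by (simp only: set_upt atLeastLessThanSuc_atLeastAtMost)
        have "F T \<le> (\<Prod>i\<in>?S. F (ops_prod (\<lambda>k. A k (\<sigma> k i)) [1..<Suc ?N]) powr ?\<alpha> i)"
          unfolding H(2)
        proof (rule F_geometric_mean[OF _ \<alpha>, where a = "\<lambda>k i. a k (\<sigma> k i)"])
          fix k assume "k \<in> set [1..<Suc ?N]"
          then have k: "k \<in> {1..?N}" unfolding set .
          show "nn_kernel (A k (\<sigma> k i)) (a k (\<sigma> k i))" for i by (rule a[OF k \<sigma>S])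
          have "(\<Prod>i\<in>?S. a k (\<sigma> k i) p powr ?\<alpha> i) = (\<Prod>i\<in>?S. a k i p powr ?\<alpha> i)" for p
            using prod.reindex_bij_betw[OF \<sigma>, of "\<lambda>i. a k i p powr (1 / real m)" k] by simp
          then show "nn_kernel (H k) (\<lambda>p. \<Prod>i\<in>?S. a k (\<sigma> k i) p powr ?\<alpha> i)" using aH[OF k] by simp
        qed (use N in \<open>simp_all del: upt_Suc\<close>)
        also have "\<dots> \<le> (\<Prod>i\<in>?S. (C * c 0 ^ n) powr ?\<alpha> i)"
        proof (intro prod_mono conjI powr_mono2)
          fix i assume i: "i \<in> ?S"
          have "\<exists>h. nn_kernel (ops_prod (\<lambda>k. A k (\<sigma> k i)) [1..<Suc ?N]) h"
          proof (rule ops_prod_nn_kernel)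
            show "\<exists>h. nn_kernel (A k (\<sigma> k i)) h" if "k \<in> set [1..<Suc ?N]" for k
              using that a[OF _ \<sigma>S] unfolding set by blast
          qed (use N in simp)
          then show "0 \<le> F (ops_prod (\<lambda>k. A k (\<sigma> k i)) [1..<Suc ?N])" using F_nonneg by blast
          \<comment> \<open>Re-indexing by p = (i - 1) + (k - 1) turns column i into a product over
            n periods starting at offset i - 1.\<close>
          define B where "B p = A (Suc (p - (i - 1))) (Suc (p mod m))" for p
          have "ops_prod (\<lambda>k. A k (\<sigma> k i)) [1..<Suc ?N] = ops_prod B [i - 1..<i - 1 + ?N]"
            by (intro ops_prod_eq_map nth_equalityI) (auto simp: B_def \<sigma>_def add.commute simp del: upt_Suc)
          also have "F \<dots> \<le> C * c 0 ^ n"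
          proof (rule C(2)[OF n])
            fix p assume p: "p \<in> {i - 1..<i - 1 + ?N}"
            show "B p \<in> \<Psi> (Suc (p mod m))"
              unfolding B_def using p m by (intro A(2)) (auto simp: Suc_le_eq)
          qed (use i in auto)
          finally show "F (ops_prod (\<lambda>k. A k (\<sigma> k i)) [1..<Suc ?N]) \<le> C * c 0 ^ n" .
        qed simp_all
        \<comment> \<open>All m factors are equal, and their exponents 1 / m add up to 1.\<close>
        also have "\<dots> = C * c 0 ^ n"
        proof -
          have "((C * c 0 ^ n) powr (1 / real m)) ^ m = C * c 0 ^ n"
            using C(1) c0 m by (cases "C = 0") (auto simp: powr_powr simp flip: powr_realpow)
          then show ?thesis by simp
        qed
        finally show "F T \<le> C * c 0 ^ n" .
      qed
    qed
    then show "r ?H \<le> (\<Prod>i\<in>{0}. c i powr (1 / real m))" by simp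
  qed (use m growth_rateD(1)[OF growth[OF \<Pi>]] in auto)
  then show ?thesis by simp
qed

end

section \<open>Verification of the common properties for both radii\<close>

context order_continuous_function_space begin

lemma beta_le_norm: "\<forall>T k. nn_kernel T k \<longrightarrow> \<beta> T \<le> norm T"
  using hausdorff_noncompactness_le_norm by blast

lemma ess_radius_le_norm: "\<forall>T k. nn_kernel T k \<longrightarrow> ess_spectral_radius M rep T \<le> norm T"
  using ess_spectral_radius_le_norm has_kernel_complex_linear nn_kernelD(3) by blast

lemma power_sup_beta_add:
  assumes \<Sigma>: "bounded_nn_kernels \<Sigma>" and n: "n \<ge> 1" "k \<ge> 1"
  shows "power_sup \<beta> \<Sigma> (n + k) \<le> power_sup \<beta> \<Sigma> n * power_sup \<beta> \<Sigma> k"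
proof (rule power_sup_le)
  note nonneg = power_sup_nonneg[of \<beta>, OF beta_le_norm \<Sigma>]
  show "0 \<le> power_sup \<beta> \<Sigma> n * power_sup \<beta> \<Sigma> k" by (intro mult_nonneg_nonneg nonneg n)
  fix T assume "T \<in> set_power \<Sigma> (n + k)"
  then obtain T1 T2 where T: "T1 \<in> set_power \<Sigma> n" "T2 \<in> set_power \<Sigma> k" "T = T1 o\<^sub>L T2"
    by (rule set_power_add) (rule that)
  have "\<beta> T \<le> \<beta> T1 * \<beta> T2" unfolding T(3) by (rule hausdorff_noncompactness_compose)
  also have "\<dots> \<le> power_sup \<beta> \<Sigma> n * power_sup \<beta> \<Sigma> k"
    by (intro mult_mono le_power_sup[of \<beta>, OF beta_le_norm \<Sigma>] n T nonneg hausdorff_noncompactness_nonneg)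
  finally show "\<beta> T \<le> power_sup \<beta> \<Sigma> n * power_sup \<beta> \<Sigma> k" .
qed

lemma growth_rate_joint:
  assumes \<Sigma>: "bounded_nn_kernels \<Sigma>"
  shows "growth_rate (power_sup \<beta> \<Sigma>) (joint_ess_radius \<Sigma>)"
  unfolding joint_ess_radius_def power_sup_def[symmetric]
  by (rule growth_rate_submultiplicative[OF power_sup_nonneg[of \<beta>, OF beta_le_norm \<Sigma>] power_sup_beta_add[OF \<Sigma>]])

lemma growth_rate_gen:
  assumes \<Sigma>: "bounded_nn_kernels \<Sigma>"
  shows "growth_rate (power_sup (ess_spectral_radius M rep) \<Sigma>) (gen_ess_radius M rep \<Sigma>)"
proof -
  let ?F = "ess_spectral_radius M rep"
  obtain c where c: "1 \<le> c" "\<And>n. n \<ge> 1 \<Longrightarrow> power_sup ?F \<Sigma> n \<le> c ^ n"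
    by (rule power_sup_le_power[of ?F, OF ess_radius_le_norm \<Sigma>]) (rule that)
  show ?thesis
    unfolding gen_ess_radius_def power_sup_def[symmetric]
    by (rule growth_rate_limsup[OF power_sup_nonneg[of ?F, OF ess_radius_le_norm \<Sigma>] c(2)]) (use c(1) in auto)
qed

text \<open>By submultiplicativity a single length n m with a bound by t ^ (n m) controls all
  lengths; a large n absorbs the constant.\<close>

lemma joint_multiples:
  assumes \<Sigma>: "bounded_nn_kernels \<Sigma>" and m: "m \<ge> 1" and s: "s > 0"
    and le: "\<And>n. n \<ge> 1 \<Longrightarrow> power_sup \<beta> \<Sigma> (n * m) \<le> C * s ^ n"
  shows "joint_ess_radius \<Sigma> \<le> s powr (1 / real m)"
proof (rule dense_ge)
  fix t assume t: "s powr (1 / real m) < t"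
  have t0: "0 < t" using t by (rule le_less_trans[rotated]) simp
  have "s = (s powr (1 / real m)) ^ m" using s m by (simp add: powr_powr flip: powr_realpow)
  also have "\<dots> < t ^ m" using t m by (intro power_strict_mono) auto
  finally have "s < t ^ m" .
  have "\<forall>\<^sub>F n in sequentially. max C 1 * s ^ n \<le> (t ^ m) ^ n"
    using s \<open>s < t ^ m\<close> by (intro eventually_const_mult_power_le) auto
  then obtain n where n: "n \<ge> 1" "max C 1 * s ^ n \<le> (t ^ m) ^ n"
    by (meson eventually_sequentially le_add1 le_add2)
  have "power_sup \<beta> \<Sigma> (n * m) \<le> max C 1 * s ^ n"
    using le[OF n(1)] s by (meson max.cobounded1 mult_right_mono order_trans zero_le_power less_imp_le)
  also have "\<dots> \<le> t ^ (n * m)" using n(2) by (simp add: power_mult mult.commute[of n])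
  finally obtain C' where "\<forall>k\<ge>1. power_sup \<beta> \<Sigma> k \<le> C' * t ^ k"
    using submultiplicative_growth_bound[OF power_sup_nonneg[of \<beta>, OF beta_le_norm \<Sigma>] power_sup_beta_add[OF \<Sigma>], of "n * m" t]
      n(1) m t0 by auto
  then show "joint_ess_radius \<Sigma> \<le> t" using growth_rateD(3)[OF growth_rate_joint[OF \<Sigma>] t0] by blast
qed

text \<open>These suprema need not be submultiplicative. Instead, for T in the n-th power of
  \<Sigma> the operator T ^ m is a product of length n m, and the radius of T is at most the m-th
  root of that of T ^ m.\<close>

lemma gen_multiples:
  assumes \<Sigma>: "bounded_nn_kernels \<Sigma>" and m: "m \<ge> 1" and s: "s > 0"
    and le: "\<And>n. n \<ge> 1 \<Longrightarrow> power_sup (ess_spectral_radius M rep) \<Sigma> (n * m) \<le> C * s ^ n"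
  shows "gen_ess_radius M rep \<Sigma> \<le> s powr (1 / real m)"
proof (rule growth_rateD(3)[OF growth_rate_gen[OF \<Sigma>]])
  let ?F = "ess_spectral_radius M rep"
  show "0 < s powr (1 / real m)" using s by simp
  fix n :: nat assume n: "n \<ge> 1"
  have nm: "n * m \<ge> 1" using n m by simp
  have Cs: "0 \<le> C * s ^ n" by (rule order_trans[OF power_sup_nonneg[of ?F, OF ess_radius_le_norm \<Sigma> nm] le[OF n]])
  have C0: "0 \<le> C"
    by (rule ccontr) (use Cs mult_neg_pos[of C "s ^ n"] s in auto)
  have "(s ^ n) powr (1 / real m) = (s powr (1 / real m)) ^ n"
    using s by (simp add: powr_powr mult.commute flip: powr_realpow)
  then have e: "(C * s ^ n) powr (1 / real m) = C powr (1 / real m) * (s powr (1 / real m)) ^ n"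
    using C0 s by (simp add: powr_mult)
  have "power_sup ?F \<Sigma> n \<le> (C * s ^ n) powr (1 / real m)"
  proof (rule power_sup_le)
    fix T assume T: "T \<in> set_power \<Sigma> n"
    obtain k where k: "nn_kernel T k" using set_power_nn_kernel[OF \<Sigma> n T] by blast
    obtain k' where k': "nn_kernel (op_power T m) k'"
      using set_power_nn_kernel[OF \<Sigma> nm op_power_in_set_power[OF T]] by blast
    have "?F T \<le> ?F (op_power T m) powr (1 / real m)" by (rule ess_spectral_radius_le_root_power[OF k m])
    also have "\<dots> \<le> (C * s ^ n) powr (1 / real m)"
      using le_power_sup[of ?F, OF ess_radius_le_norm \<Sigma> nm op_power_in_set_power[OF T]] le[OF n]
        ess_spectral_radius_nonneg[OF has_kernel_complex_linear[OF nn_kernelD(3)[OF k']]]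
      by (intro powr_mono2) auto
    finally show "?F T \<le> (C * s ^ n) powr (1 / real m)" .
  qed simp
  then show "power_sup ?F \<Sigma> n \<le> C powr (1 / real m) * (s powr (1 / real m)) ^ n" unfolding e .
qed

text \<open>The incomplete blocks at the two ends are split off; each contributes a factor bounded
  independently of n, and the middle lies in a power of the product set.\<close>

lemma joint_rotate_bound:
  assumes m: "m \<ge> 1" and \<Psi>: "\<And>i. i \<in> {1..m} \<Longrightarrow> bounded_nn_kernels (\<Psi> i)" and s: "joint_ess_radius (product_set m \<Psi>) < s"
  shows "\<exists>C\<ge>0. \<forall>n\<ge>1. \<forall>i<m. \<forall>B. (\<forall>p\<in>{i..<i + n * m}. B p \<in> \<Psi> (Suc (p mod m))) \<longrightarrow>
        \<beta> (ops_prod B [i..<i + n * m]) \<le> C * s ^ n"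
proof -
  let ?\<Pi> = "product_set m \<Psi>"
  obtain c where c: "1 \<le> c" "\<And>i A. i \<in> {1..m} \<Longrightarrow> A \<in> \<Psi> i \<Longrightarrow> norm A \<le> c" and \<Pi>: "bounded_nn_kernels ?\<Pi>"
    using bounded_nn_kernels_product_set[OF m, of \<Psi>] \<Psi> by blast
  note growth = growth_rateD[OF growth_rate_joint[OF \<Pi>]]
  have s0: "0 < s" using growth(1) s by simp
  obtain C where C: "C \<ge> 0" "\<And>n. n \<ge> 1 \<Longrightarrow> power_sup \<beta> ?\<Pi> n \<le> C * s ^ n" using growth(2)[OF s] by blast
  \<comment> \<open>Each end contributes at most c ^ m. Division by s makes up for having n - 1
    instead of n complete blocks, and max 1 C covers n = 1, where the middle is the
    identity.\<close>
  define C' where "C' = c ^ m * (max 1 C / s) * c ^ m"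
  have C'0: "0 \<le> C'" using c(1) s0 by (simp add: C'_def)
  have "\<beta> (ops_prod B [i..<i + n * m]) \<le> C' * s ^ n"
    if n: "n \<ge> 1" and i: "i < m" and B: "\<forall>p\<in>{i..<i + n * m}. B p \<in> \<Psi> (Suc (p mod m))" for n i B
  proof -
    have mn: "m \<le> n * m" "(1 + (n - 1)) * m = n * m" using n by (auto simp: Suc_diff_le)
    have "i \<le> n * m" using less_le_trans[OF i mn(1)] by (rule less_imp_le)
    let ?U = "ops_prod B [i..<m]" and ?W = "ops_prod B [1 * m..<(1 + (n - 1)) * m]" and ?V = "ops_prod B [n * m..<n * m + i]"
    have Bc: "norm (B p) \<le> c" if "p \<in> {i..<i + n * m}" for p
      using B that m by (intro c(2)[of "Suc (p mod m)"]) (auto simp: Suc_le_eq)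
    have U: "norm ?U \<le> c ^ m"
    proof -
      have "norm ?U \<le> c ^ length [i..<m]"
        using c(1) mn by (intro norm_ops_prod Bc) auto
      also have "\<dots> \<le> c ^ m" using c(1) by (intro power_increasing) auto
      finally show ?thesis .
    qed
    have V: "norm ?V \<le> c ^ m"
    proof -
      have "norm ?V \<le> c ^ length [n * m..<n * m + i]"
        using c(1) \<open>i \<le> n * m\<close> by (intro norm_ops_prod Bc) auto
      also have "\<dots> \<le> c ^ m" using c(1) i by (intro power_increasing) auto
      finally show ?thesis .
    qed
    have mem: "?W \<in> set_power ?\<Pi> (n - 1)"
    proof (rule ops_prod_block_in_set_power)
      fix p assume "1 * m \<le> p" "p < (1 + (n - 1)) * m"
      then have "p \<in> {i..<i + n * m}" using i unfolding mn(2) by auto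
      then show "B p \<in> \<Psi> (Suc (p mod m))" using B by blast
    qed
    have W: "\<beta> ?W \<le> max 1 C / s * s ^ n"
    proof (cases "n = 1")
      case True
      have "\<beta> (id_blinfun :: 'l \<Rightarrow>\<^sub>L 'l) \<le> 1"
        by (rule order_trans[OF hausdorff_noncompactness_le_norm norm_blinfun_id_le])
      then show ?thesis using True s0 by simp
    next
      case False
      then have n1: "n - 1 \<ge> 1" using n by simp
      have "\<beta> ?W \<le> power_sup \<beta> ?\<Pi> (n - 1)" by (rule le_power_sup[of \<beta>, OF beta_le_norm \<Pi> n1 mem])
      also have "\<dots> \<le> C * s ^ (n - 1)" by (rule C(2)[OF n1])
      also have "\<dots> \<le> max 1 C * s ^ (n - 1)" using s0 by (intro mult_right_mono) auto
      also have "\<dots> = max 1 C / s * s ^ n" using s0 n by (cases n) auto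
      finally show ?thesis .
    qed
    have "ops_prod B [i..<i + n * m] = ?U o\<^sub>L (?W o\<^sub>L ?V)"
      unfolding rotation_split[OF i n] ops_prod_append ..
    then have "\<beta> (ops_prod B [i..<i + n * m]) \<le> \<beta> ?U * \<beta> (?W o\<^sub>L ?V)"
      by (simp only: hausdorff_noncompactness_compose)
    also have "\<dots> \<le> \<beta> ?U * (\<beta> ?W * \<beta> ?V)"
      by (intro mult_left_mono hausdorff_noncompactness_compose hausdorff_noncompactness_nonneg)
    also have "\<dots> \<le> c ^ m * ((max 1 C / s * s ^ n) * c ^ m)"
      using c(1) s0
      by (intro mult_mono W order_trans[OF hausdorff_noncompactness_le_norm U] order_trans[OF hausdorff_noncompactness_le_norm V])
        (auto simp: hausdorff_noncompactness_nonneg)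
    also have "\<dots> = C' * s ^ n" by (simp add: C'_def mult_ac)
    finally show ?thesis .
  qed
  with C'0 show ?thesis by blast
qed

text \<open>By \<open>ess_spectral_radius_commute_le\<close> the incomplete first block may be moved
  to the end, where it completes the last one.\<close>

lemma gen_rotate_bound:
  assumes m: "m \<ge> 1" and \<Psi>: "\<And>i. i \<in> {1..m} \<Longrightarrow> bounded_nn_kernels (\<Psi> i)" and s: "gen_ess_radius M rep (product_set m \<Psi>) < s"
  shows "\<exists>C\<ge>0. \<forall>n\<ge>1. \<forall>i<m. \<forall>B. (\<forall>p\<in>{i..<i + n * m}. B p \<in> \<Psi> (Suc (p mod m))) \<longrightarrow>
        ess_spectral_radius M rep (ops_prod B [i..<i + n * m]) \<le> C * s ^ n"
proof -
  let ?\<Pi> = "product_set m \<Psi>" and ?F = "ess_spectral_radius M rep"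
  have \<Pi>: "bounded_nn_kernels ?\<Pi>"
    using bounded_nn_kernels_product_set[OF m, of \<Psi>] \<Psi> by blast
  obtain C where C: "C \<ge> 0" "\<And>n. n \<ge> 1 \<Longrightarrow> power_sup ?F ?\<Pi> n \<le> C * s ^ n"
    using growth_rateD(2)[OF growth_rate_gen[OF \<Pi>] s] by blast
  have "?F (ops_prod B [i..<i + n * m]) \<le> C * s ^ n"
    if n: "n \<ge> 1" and i: "i < m" and B: "\<forall>p\<in>{i..<i + n * m}. B p \<in> \<Psi> (Suc (p mod m))" for n i B
  proof -
    have mn: "m \<le> n * m" "(1 + (n - 1)) * m = n * m" "(1 + n) * m = n * m + m" using n by (auto simp: Suc_diff_le)
    let ?U = "ops_prod B [i..<m]" and ?WV = "ops_prod B ([1 * m..<(1 + (n - 1)) * m] @ [n * m..<n * m + i])"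
    \<comment> \<open>Positions from n * m + i on receive the factors of the initial piece, so the
      rotated product runs over aligned blocks.\<close>
    define B' where "B' p = (if p < n * m + i then B p else B (p - n * m))" for p
    have UWV: "ops_prod B [i..<i + n * m] = ?U o\<^sub>L ?WV"
      unfolding rotation_split[OF i n] ops_prod_append[of B "[i..<m]"] ..
    have WVU: "?WV o\<^sub>L ?U = ops_prod B' [1 * m..<(1 + n) * m]"
    proof -
      have "[1 * m..<(1 + n) * m] = ([1 * m..<(1 + (n - 1)) * m] @ [n * m..<n * m + i]) @ [n * m + i..<n * m + m]"
      proof -
        have "[m..<n * m + m] = [m..<n * m + i] @ [n * m + i..<n * m + m]"
          using upt_split[of m "n * m + i" "n * m + m"] mn i by simp
        also have "[m..<n * m + i] = [m..<n * m] @ [n * m..<n * m + i]"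
          using upt_split[of m "n * m" "n * m + i"] mn by simp
        finally show ?thesis using mn by (simp add: add.commute)
      qed
      then have "ops_prod B' [1 * m..<(1 + n) * m]
          = ops_prod B' ([1 * m..<(1 + (n - 1)) * m] @ [n * m..<n * m + i]) o\<^sub>L ops_prod B' [n * m + i..<n * m + m]"
        by (simp only: ops_prod_append)
      also have "ops_prod B' ([1 * m..<(1 + (n - 1)) * m] @ [n * m..<n * m + i]) = ?WV"
        by (rule ops_prod_eq_map) (use mn in \<open>auto simp: B'_def\<close>)
      also have "ops_prod B' [n * m + i..<n * m + m] = ?U"
        by (intro ops_prod_eq_map nth_equalityI) (auto simp: B'_def)
      finally show ?thesis by simp
    qed
    have mem: "?WV o\<^sub>L ?U \<in> set_power ?\<Pi> n"
      unfolding WVU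
    proof (rule ops_prod_block_in_set_power)
      fix p assume p: "1 * m \<le> p" "p < (1 + n) * m"
      show "B' p \<in> \<Psi> (Suc (p mod m))"
      proof (cases "p < n * m + i")
        case True
        then show ?thesis using B p i by (auto simp: B'_def)
      next
        case False
        have "p - n * m < m" using p(2) m unfolding mn(3) by linarith
        moreover have "i \<le> p - n * m" using False by linarith
        ultimately have "p - n * m \<in> {i..<i + n * m}" unfolding atLeastLessThan_iff using mn(1) by linarith
        with B have "B (p - n * m) \<in> \<Psi> (Suc ((p - n * m) mod m))" by blast
        moreover have "(p - n * m) mod m = p mod m"
          using False by (metis le_add1 linorder_not_less mod_mult_self1 le_add_diff_inverse2 le_trans)
        ultimately show ?thesis using False by (simp add: B'_def)
      qed
    qed
    have "\<exists>k. nn_kernel (ops_prod B [i..<i + n * m]) k"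
    proof (rule ops_prod_nn_kernel)
      show "[i..<i + n * m] \<noteq> []" using n m by simp
      show "\<exists>k. nn_kernel (B p) k" if "p \<in> set [i..<i + n * m]" for p
      proof -
        have "Suc (p mod m) \<in> {1..m}" using m by (simp add: Suc_le_eq)
        then have "bounded_nn_kernels (\<Psi> (Suc (p mod m)))" by (rule \<Psi>)
        moreover have "B p \<in> \<Psi> (Suc (p mod m))" using B that by auto
        ultimately show ?thesis unfolding bounded_nn_kernels_def by blast
      qed
    qed
    then obtain k where k: "nn_kernel (?U o\<^sub>L ?WV) k" unfolding UWV by blast
    obtain k' where "nn_kernel (?WV o\<^sub>L ?U) k'" using set_power_nn_kernel[OF \<Pi> n mem] by blast
    then have "complex_linear M rep (?WV o\<^sub>L ?U)" by (rule has_kernel_complex_linear[OF nn_kernelD(3)])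
    with k have "?F (?U o\<^sub>L ?WV) \<le> ?F (?WV o\<^sub>L ?U)" by (rule ess_spectral_radius_commute_le)
    also have "\<dots> \<le> power_sup ?F ?\<Pi> n" by (rule le_power_sup[of ?F, OF ess_radius_le_norm \<Pi> n mem])
    also have "\<dots> \<le> C * s ^ n" by (rule C(2)[OF n])
    finally show ?thesis unfolding UWV .
  qed
  with C(1) show ?thesis by blast
qed

lemma joint_essential_radius: "essential_radius M rep \<beta> joint_ess_radius"
proof
  show "\<exists>C\<ge>0. \<forall>n\<ge>1. \<forall>i<m. \<forall>B. (\<forall>p\<in>{i..<i + n * m}. B p \<in> \<Psi> (Suc (p mod m))) \<longrightarrow>
        \<beta> (ops_prod B [i..<i + n * m]) \<le> C * s ^ n"
    if "m \<ge> 1" "\<And>i. i \<in> {1..m} \<Longrightarrow> bounded_nn_kernels (\<Psi> i)" "joint_ess_radius (product_set m \<Psi>) < s" for m \<Psi> s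
    using that by (rule joint_rotate_bound)
qed (rule hausdorff_noncompactness_nonneg beta_le_norm noncompactness_ops_prod_le growth_rate_joint joint_multiples; assumption)+

lemma gen_essential_radius: "essential_radius M rep (ess_spectral_radius M rep) (gen_ess_radius M rep)"
proof
  show "\<exists>C\<ge>0. \<forall>n\<ge>1. \<forall>i<m. \<forall>B. (\<forall>p\<in>{i..<i + n * m}. B p \<in> \<Psi> (Suc (p mod m))) \<longrightarrow>
        ess_spectral_radius M rep (ops_prod B [i..<i + n * m]) \<le> C * s ^ n"
    if "m \<ge> 1" "\<And>i. i \<in> {1..m} \<Longrightarrow> bounded_nn_kernels (\<Psi> i)" "gen_ess_radius M rep (product_set m \<Psi>) < s" for m \<Psi> s
    using that by (rule gen_rotate_bound)
  show "0 \<le> ess_spectral_radius M rep T" if "nn_kernel T k" for T k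
    by (rule ess_spectral_radius_nonneg[OF has_kernel_complex_linear[OF nn_kernelD(3)[OF that]]])
qed (rule ess_radius_le_norm ess_spectral_radius_ops_prod_le growth_rate_gen gen_multiples; assumption)+

end

theorem theorem3p1:
  fixes M :: "'a measure"
    and rep :: "'l::banach \<Rightarrow> 'a \<Rightarrow> complex"
    and m :: nat
    and \<alpha> :: "nat \<Rightarrow> real"
    and \<Psi> :: "nat \<Rightarrow> ('l \<Rightarrow>\<^sub>L 'l) set"
    and r :: "('l \<Rightarrow>\<^sub>L 'l) set \<Rightarrow> real"
  assumes "banach_function_space M rep"
    and "order_continuous_norm (fun_nonneg M rep)"
    and "order_continuous_norm (dual_nonneg M rep)"
    and "\<And>i. i \<in> {1..m} \<Longrightarrow> bounded (\<Psi> i)"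
    and "\<And>i A. i \<in> {1..m} \<Longrightarrow> A \<in> \<Psi> i \<Longrightarrow> positive_kernel_operator M rep A"
    and "\<And>i. i \<in> {1..m} \<Longrightarrow> \<alpha> i > 0"
    and "(\<Sum>i = 1..m. \<alpha> i) = 1"
    and "r \<in> {gen_ess_radius M rep, joint_ess_radius}"
  shows "r (hadamard_mean_set M rep m \<alpha> \<Psi>) \<le> (\<Prod>i = 1..m. r (\<Psi> i) powr \<alpha> i)
    \<and> r (hadamard_mean_set M rep m (\<lambda>_. 1 / real m) \<Psi>) \<le> r (product_set m \<Psi>) powr (1 / real m)"
proof -
  interpret order_continuous_function_space M rep
    using assms(1-3) by (simp add: order_continuous_function_space_def order_continuous_function_space_axioms_def)
  have m: "m \<ge> 1" using assms(7) by (cases m) auto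
  have \<Psi>: "bounded_nn_kernels (\<Psi> i)" if "i \<in> {1..m}" for i
    using assms(4,5)[OF that] unfolding bounded_nn_kernels_def positive_kernel_operator_iff by blast
  obtain F where "essential_radius M rep F r"
    using assms(8) gen_essential_radius joint_essential_radius by blast
  then interpret essential_radius M rep F r .
  show ?thesis
  proof
    show "r (hadamard_mean_set M rep m \<alpha> \<Psi>) \<le> (\<Prod>i = 1..m. r (\<Psi> i) powr \<alpha> i)"
      using m assms(6,7) \<Psi> by (rule radius_hadamard_mean_le)
    show "r (hadamard_mean_set M rep m (\<lambda>_. 1 / real m) \<Psi>) \<le> r (product_set m \<Psi>) powr (1 / real m)"
      using m \<Psi> by (rule radius_hadamard_mean_le_product)
  qed
qed

end
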